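(* Let $A$ be a finite dimensional $\mathbb{K}$-algebra. Then $\alpha$ yields a bijective correspondence between (1) functorially finite torsion classes in $\mathrm{mod}(A)$; (2) functorially finite wide subcategories $\mathcal{W}$ in $\mathrm{mod}(A)$ for which $\mathcal{T}_{\mathcal{W}} := \mathrm{filt}(\mathrm{gen}(\mathcal{W}))$ is functorially finite.
   Context: $\mathbb{K}$ is an algebraically closed field, and $\mathrm{mod}(A)$ is the category of finitely generated left $A$-modules. All subcategories are full and replete. A subcategory $\mathcal{C}$ of $\mathrm{mod}(A)$ is functorially finite if for every $X\in\mathrm{mod}(A)$ there are $C_1,C_2\in\mathcal{C}$ and morphisms $g_1:X\to C_1$ and $g_2:C_2\to X$ such that $\mathrm{Hom}_A(g_1,\tilde C)$ and $\mathrm{Hom}_A(\tilde C,g_2)$ are surjective for all $\tilde C\in\mathcal{C}$. A subcategory is wide if it is exact abelian (i.e. contains $0$ and is closed under kernels and cokernels in $\mathrm{mod}(A)$) and closed under extensions. A torsion class is a (nonempty) subcategory of $\mathrm{mod}(A)$ closed under quotients and extensions. For a subcategory $\mathcal{C}$, $\mathrm{gen}(\mathcal{C})$ is the subcategory of all quotients of finite direct sums of objects of $\mathcal{C}$, and $\mathrm{filt}(\mathcal{C})$ is the subcategory of all modules $X$ in $\mathrm{mod}(A)$ admitting a finite filtration $0=F_0\subseteq F_1\subseteq\dots\subseteq F_n=X$ with $F_i/F_{i-1}\in\mathcal{C}$ for all $1\le i\le n$. The map $\alpha$ sends a torsion class $\mathcal{T}$ to $$\alpha(\mathcal{T}) :=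 \{X\in\mathcal{T} \mid \text{for every } Y\in\mathcal{T} \text{ and every } A\text{-linear map } g:Y\to X,\ \ker(g)\in\mathcal{T}\},$$ which is known to be a wide subcategory of $\mathrm{mod}(A)$. *)

theory Defs
  imports "HOL-Computational_Algebra.Polynomial" "HOL-Algebra.Module" "HOL-Algebra.AbelCoset"
begin

text \<open>
  The sort \<open>{ring, monoid_mult}\<close> is that of unital associative rings in which \<open>0 = 1\<close> is not
  excluded, so the zero algebra is allowed.
\<close>

locale finite_dim_algebra = vector_space scale
  for scale :: "'k::field \<Rightarrow> 'a::{ring, monoid_mult} \<Rightarrow> 'a" +
  assumes scale_mult_left: "scale c x * y = scale c (x * y)"
    and scale_mult_right: "x * scale c y = scale c (x * y)"
    and finite_dim: "\<exists>B. finite B \<and> span B = UNIV"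

text \<open>
  The library's module locale requires a commutative base ring, so left modules over a general
  ring are introduced here, on the library's module records. The ring is the type \<open>'a\<close>. The
  fields \<open>mult\<close> and \<open>one\<close> inherited by such a record, and the values of the operations off the
  carrier, play no role.
\<close>

locale left_module = abelian_group M
  for M :: "('a::{ring, monoid_mult}, 'm) module" (structure) +
  assumes smult_closed: "x \<in> carrier M \<Longrightarrow> a \<odot> x \<in> carrier M"
    and smult_l_distr: "x \<in> carrier M \<Longrightarrow> (a + b) \<odot> x = a \<odot> x \<oplus> b \<odot> x"
    and smult_r_distr:
      "\<lbrakk>x \<in> carrier M; y \<in> carrier M\<rbrakk> \<Longrightarrow> a \<odot> (x \<oplus> y) = a \<odot> x \<oplus> a \<odot> y"
    and smult_assoc: "x \<in> carrier M \<Longrightarrow> (a * b) \<odot> x = a \<odot> (b \<odot> x)"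
    and smult_one: "x \<in> carrier M \<Longrightarrow> 1 \<odot> x = x"

definition left_submodule :: "'m set \<Rightarrow> ('a::{ring, monoid_mult}, 'm) module \<Rightarrow> bool" where
  "left_submodule N M \<longleftrightarrow>
     additive_subgroup N M \<and> (\<forall>a. \<forall>x\<in>N. a \<odot>\<^bsub>M\<^esub> x \<in> N)"

definition finitely_generated :: "('a::{ring, monoid_mult}, 'm) module \<Rightarrow> bool" where
  "finitely_generated M \<longleftrightarrow>
     (\<exists>S. finite S \<and> S \<subseteq> carrier M \<and>
          (\<forall>N. left_submodule N M \<and> S \<subseteq> N \<longrightarrow> N = carrier M))"

text \<open>
  The objects of \<open>mod(A)\<close>: the finitely generated left modules over \<open>A = 'a\<close> whose underlying set
  lies in the type \<open>'m\<close>. If \<open>A\<close> is a finite dimensional algebra over an infinite field \<open>K\<close>, a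
  finitely generated module has at most \<open>|K|\<close> elements; hence as soon as \<open>K\<close> embeds into \<open>'m\<close>,
  every finitely generated module is isomorphic to one of these objects.
\<close>

definition fgmod :: "('a::{ring, monoid_mult}, 'm) module set" where
  "fgmod = {M. left_module M \<and> finitely_generated M}"

text \<open>
  Functions representing homomorphisms are only relevant on the carrier of their domain, as for
  the library's \<^const>\<open>hom\<close>.
\<close>

definition mod_hom ::
    "('a::{ring, monoid_mult}, 'm) module \<Rightarrow> ('a, 'n) module \<Rightarrow> ('m \<Rightarrow> 'n) set" where
  "mod_hom M N =
     {f \<in> carrier M \<rightarrow> carrier N.
        (\<forall>x\<in>carrier M. \<forall>y\<in>carrier M. f (x \<oplus>\<^bsub>M\<^esub> y) = f x \<oplus>\<^bsub>N\<^esub> f y) \<and>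
        (\<forall>a. \<forall>x\<in>carrier M. f (a \<odot>\<^bsub>M\<^esub> x) = a \<odot>\<^bsub>N\<^esub> f x)}"

definition mod_epi ::
    "('a::{ring, monoid_mult}, 'm) module \<Rightarrow> ('a, 'n) module \<Rightarrow> ('m \<Rightarrow> 'n) set" where
  "mod_epi M N = {f \<in> mod_hom M N. f ` carrier M = carrier N}"

definition mod_iso :: "('a::{ring, monoid_mult}, 'm) module \<Rightarrow> ('a, 'n) module \<Rightarrow> bool" where
  "mod_iso M N \<longleftrightarrow> (\<exists>f\<in>mod_hom M N. bij_betw f (carrier M) (carrier N))"

definition short_exact ::
    "('a::{ring, monoid_mult}, 'm) module \<Rightarrow> ('m \<Rightarrow> 'm) \<Rightarrow> ('a, 'm) module \<Rightarrow>
     ('m \<Rightarrow> 'm) \<Rightarrow> ('a, 'm) module \<Rightarrow> bool" where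
  "short_exact X f Y g Z \<longleftrightarrow>
     f \<in> mod_hom X Y \<and> inj_on f (carrier X) \<and> g \<in> mod_epi Y Z \<and>
     f ` carrier X = a_kernel Y Z g"

definition ker_module ::
    "('a::{ring, monoid_mult}, 'm) module \<Rightarrow> ('a, 'n) module \<Rightarrow> ('m \<Rightarrow> 'n) \<Rightarrow>
     ('a, 'm) module" where
  "ker_module X Y f = X\<lparr>carrier := a_kernel X Y f\<rparr>"

definition direct_sum ::
    "nat \<Rightarrow> (nat \<Rightarrow> ('a::{ring, monoid_mult}, 'm) module) \<Rightarrow> ('a, nat \<Rightarrow> 'm) module" where
  "direct_sum n M =
     \<lparr>carrier = (\<Pi>\<^sub>E i\<in>{..<n}. carrier (M i)),
      monoid.mult = undefined,
      one = undefined,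
      zero = (\<lambda>i\<in>{..<n}. \<zero>\<^bsub>M i\<^esub>),
      add = (\<lambda>x y. \<lambda>i\<in>{..<n}. x i \<oplus>\<^bsub>M i\<^esub> y i),
      module.smult = (\<lambda>a x. \<lambda>i\<in>{..<n}. a \<odot>\<^bsub>M i\<^esub> x i)\<rparr>"

text \<open>Full replete subcategories of \<open>mod(A)\<close> are given by isomorphism-closed sets of objects.\<close>

definition subcategory :: "('a::{ring, monoid_mult}, 'm) module set \<Rightarrow> bool" where
  "subcategory C \<longleftrightarrow>
     C \<subseteq> fgmod \<and> (\<forall>X\<in>C. \<forall>Y\<in>fgmod. mod_iso X Y \<longrightarrow> Y \<in> C)"

definition functorially_finite :: "('a::{ring, monoid_mult}, 'm) module set \<Rightarrow> bool" where
  "functorially_finite C \<longleftrightarrow>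
     (\<forall>X\<in>(fgmod :: ('a, 'm) module set). \<exists>C1\<in>C. \<exists>C2\<in>C.
        \<exists>g1\<in>mod_hom X C1. \<exists>g2\<in>mod_hom C2 X.
        (\<forall>D\<in>C. \<forall>h\<in>mod_hom X D. \<exists>h'\<in>mod_hom C1 D. \<forall>x\<in>carrier X. h' (g1 x) = h x) \<and>
        (\<forall>D\<in>C. \<forall>h\<in>mod_hom D X. \<exists>h'\<in>mod_hom D C2. \<forall>x\<in>carrier D. g2 (h' x) = h x))"

definition closed_under_extensions :: "('a::{ring, monoid_mult}, 'm) module set \<Rightarrow> bool" where
  "closed_under_extensions C \<longleftrightarrow>
     (\<forall>X\<in>C. \<forall>Z\<in>C. \<forall>Y\<in>fgmod. \<forall>f g. short_exact X f Y g Z \<longrightarrow> Y \<in> C)"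

definition closed_under_quotients :: "('a::{ring, monoid_mult}, 'm) module set \<Rightarrow> bool" where
  "closed_under_quotients C \<longleftrightarrow> (\<forall>X\<in>C. \<forall>Y\<in>fgmod. mod_epi X Y \<noteq> {} \<longrightarrow> Y \<in> C)"

definition closed_under_kernels :: "('a::{ring, monoid_mult}, 'm) module set \<Rightarrow> bool" where
  "closed_under_kernels C \<longleftrightarrow>
     (\<forall>X\<in>C. \<forall>Y\<in>C. \<forall>f\<in>mod_hom X Y. ker_module X Y f \<in> C)"

text \<open>
  Quotient modules live on sets of cosets, outside the type \<open>'m\<close>. A cokernel of \<open>f\<close>, and below a
  subquotient \<open>F (Suc i) / F i\<close>, is therefore any object \<open>Z\<close> that is the target of an epimorphism
  with kernel the image of \<open>f\<close>, respectively \<open>F i\<close>.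
\<close>

definition closed_under_cokernels :: "('a::{ring, monoid_mult}, 'm) module set \<Rightarrow> bool" where
  "closed_under_cokernels C \<longleftrightarrow>
     (\<forall>X\<in>C. \<forall>Y\<in>C. \<forall>f\<in>mod_hom X Y. \<forall>Z\<in>fgmod. \<forall>g\<in>mod_epi Y Z.
        a_kernel Y Z g = f ` carrier X \<longrightarrow> Z \<in> C)"

definition wide :: "('a::{ring, monoid_mult}, 'm) module set \<Rightarrow> bool" where
  "wide C \<longleftrightarrow>
     subcategory C \<and> (\<exists>X\<in>C. carrier X = {\<zero>\<^bsub>X\<^esub>}) \<and>
     closed_under_kernels C \<and> closed_under_cokernels C \<and> closed_under_extensions C"

definition torsion_class :: "('a::{ring, monoid_mult}, 'm) module set \<Rightarrow> bool" where
  "torsion_class T \<longleftrightarrow>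
     subcategory T \<and> T \<noteq> {} \<and> closed_under_quotients T \<and> closed_under_extensions T"

definition gen :: "('a::{ring, monoid_mult}, 'm) module set \<Rightarrow> ('a, 'm) module set" where
  "gen C =
     {X \<in> fgmod. \<exists>n M. (\<forall>i<n. M i \<in> C) \<and> mod_epi (direct_sum n M) X \<noteq> {}}"

definition filt :: "('a::{ring, monoid_mult}, 'm) module set \<Rightarrow> ('a, 'm) module set" where
  "filt C =
     {X \<in> fgmod. \<exists>n F.
        (\<forall>i\<le>n. left_submodule (F i) X) \<and> F 0 = {\<zero>\<^bsub>X\<^esub>} \<and> F n = carrier X \<and>
        (\<forall>i<n. F i \<subseteq> F (Suc i) \<and>
           (\<exists>Q\<in>C. \<exists>p\<in>mod_epi (X\<lparr>carrier := F (Suc i)\<rparr>) Q.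
              a_kernel (X\<lparr>carrier := F (Suc i)\<rparr>) Q p = F i))}"

definition alpha :: "('a::{ring, monoid_mult}, 'm) module set \<Rightarrow> ('a, 'm) module set" where
  "alpha T = {X \<in> T. \<forall>Y\<in>T. \<forall>g\<in>mod_hom Y X. ker_module Y X g \<in> T}"

end

theory Submission
  imports Defs "HOL-Library.Function_Algebras"
begin

text \<open>
  Let \<open>T\<close> be a functorially finite torsion class. A left \<open>T\<close>-approximation of the free module of
  rank one is an object \<open>G\<close> of \<open>T\<close> with an element \<open>t\<close> that can be mapped to any element of any
  object of \<open>T\<close>; choose \<open>G\<close> of minimal dimension. Then \<open>alpha T\<close> consists of the \<open>X\<close> in \<open>T\<close> such
  that every map \<open>G \<rightarrow> X\<close> killing \<open>t\<close> is zero. Hence \<open>alpha T\<close> is reflective in \<open>T\<close>, and the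
  reflection \<open>B\<close> of \<open>G\<close> is a projective generator of \<open>alpha T\<close> from which right approximations are
  built.

  To see that \<open>T\<close> is generated by \<open>alpha T\<close>, suppose not. As \<open>T\<close> is generated by the single object
  \<open>G\<close>, there is a maximal proper torsion subclass \<open>S\<close> containing \<open>filt (gen (alpha T))\<close>. An object
  \<open>M\<close> of minimal dimension in \<open>T\<close> but not in \<open>S\<close> has no nonzero submodule in \<open>S\<close>, all its proper
  quotients lie in \<open>S\<close>, and \<open>T\<close> is filtered by \<open>S\<close> and \<open>M\<close>; this forces
  \<open>M\<close> into \<open>alpha T\<close>, a contradiction.

  Conversely, for a wide subcategory \<open>W\<close>, induction on dimension shows that a map from an object of
  \<open>filt (gen W)\<close> to an object of \<open>W\<close> has its image in \<open>W\<close> and its kernel in \<open>filt (gen W)\<close>, which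
  gives \<open>alpha (filt (gen W)) = W\<close>.
\<close>

section \<open>Modules, submodules and homomorphisms\<close>

text \<open>All objects must have their elements in the fixed type \<open>'m\<close>, while cosets,
  pairs and the algebra itself form other types. Quotients are therefore carried by coset
  representatives, and products and the regular module are copied into \<open>'m\<close> by coding
  coefficient vectors as single scalars, which is possible because the field is infinite. Arguments
  by finite length become arguments on \<open>kdim\<close>, which drops for proper submodules and
  for proper quotients. For the step that forces \<open>M\<close> into \<open>alpha T\<close>, let
  \<open>g\<close> map \<open>Y\<close> to \<open>M\<close>, and divide \<open>Y\<close> by the
  largest submodule of the kernel that lies in \<open>T\<close>. If the new \<open>Y\<close> is
  nonzero, either its kernel contains a bottom factor of a filtration by \<open>S\<close> and copies
  of \<open>M\<close>, which has just been excluded, or that factor maps isomorphically onto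
  \<open>M\<close>. It then splits \<open>g\<close>, so the kernel is a summand, lies in
  \<open>T\<close> and vanishes. The object \<open>B\<close> is useful because a map from
  \<open>B\<close> into an object of \<open>alpha T\<close> can be prescribed at one element and is
  determined there: elements of such an object correspond to maps from \<open>B\<close>.\<close>

abbreviation submod :: "('a, 'm) module \<Rightarrow> 'm set \<Rightarrow> ('a, 'm) module" where
  "submod M N \<equiv> M\<lparr>carrier := N\<rparr>"

context left_module
begin

lemma smult_l_null: "x \<in> carrier M \<Longrightarrow> 0 \<odot> x = \<zero>"
  using smult_l_distr[of x 0 0] smult_closed[of x 0] by simp

lemma smult_r_null: "a \<odot> \<zero> = \<zero>"
  using smult_r_distr[of \<zero> \<zero> a] smult_closed[of \<zero> a] by auto

lemma smult_neg_one:
  assumes "x \<in> carrier M"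
  shows "(- 1) \<odot> x = \<ominus> x"
proof (rule minus_equality[symmetric])
  show "(- 1) \<odot> x \<oplus> x = \<zero>"
    using smult_l_distr[of x "- 1" 1] smult_l_null smult_one assms by simp
qed (use assms smult_closed in auto)

lemma smult_r_minus:
  "\<lbrakk>x \<in> carrier M; y \<in> carrier M\<rbrakk> \<Longrightarrow> a \<odot> (x \<ominus> y) = a \<odot> x \<ominus> a \<odot> y"
  using smult_assoc[of y a "- 1"] smult_assoc[of y "- 1" a]
  by (simp add: a_minus_def smult_neg_one[symmetric] smult_r_distr smult_closed)

lemma add_minus_cancel: "\<lbrakk>x \<in> carrier M; y \<in> carrier M\<rbrakk> \<Longrightarrow> y \<oplus> (x \<ominus> y) = x"
  by (simp add: a_minus_def a_lcomm r_neg)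

lemma minus_eq_zero_iff:
  assumes "x \<in> carrier M" "y \<in> carrier M"
  shows "x \<ominus> y = \<zero> \<longleftrightarrow> x = y"
proof
  assume "x \<ominus> y = \<zero>"
  then show "x = y" using add_minus_cancel[OF assms] assms by simp
qed (use assms in \<open>simp add: a_minus_def r_neg\<close>)

lemma minus_eq_smult: "y \<in> carrier M \<Longrightarrow> x \<ominus> y = x \<oplus> (- 1) \<odot> y"
  by (simp add: a_minus_def smult_neg_one)

text \<open>Closure under negatives is absent from the right-hand side because negation is the
  action of \<open>- 1\<close>.\<close>

lemma left_submodule_iff:
  "left_submodule N M \<longleftrightarrow>
     N \<subseteq> carrier M \<and> \<zero> \<in> N \<and> (\<forall>x\<in>N. \<forall>y\<in>N. x \<oplus> y \<in> N) \<and> (\<forall>a. \<forall>x\<in>N. a \<odot> x \<in> N)"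
  (is "?L \<longleftrightarrow> ?R")
proof
  assume ?L
  then have "subgroup N (add_monoid M)"
    by (simp add: left_submodule_def additive_subgroup_def)
  then show ?R
    using \<open>?L\<close> subgroup.subset[of N "add_monoid M"] subgroup.m_closed[of N "add_monoid M"]
      subgroup.one_closed[of N "add_monoid M"]
    by (auto simp: left_submodule_def)
next
  assume R: ?R
  have "subgroup N (add_monoid M)"
  proof
    show "inv\<^bsub>add_monoid M\<^esub> x \<in> N" if "x \<in> N" for x
      using R that smult_neg_one[of x] by (metis a_inv_def subsetD)
  qed (use R in auto)
  then show ?L
    using R by (simp add: left_submodule_def additive_subgroup_def)
qed

lemma left_submoduleD:
  assumes "left_submodule N M"
  shows "N \<subseteq> carrier M" "\<zero> \<in> N" "\<lbrakk>x \<in> N; y \<in> N\<rbrakk> \<Longrightarrow> x \<oplus> y \<in> N" "x \<in> N \<Longrightarrow> a \<odot> x \<in> N"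
  using assms by (auto simp: left_submodule_iff)

lemma left_module_sub:
  assumes "left_submodule N M"
  shows "left_module (submod M N)"
proof -
  note N = left_submoduleD[OF assms]
  have "abelian_group (submod M N)"
  proof (rule abelian_groupI)
    fix x assume "x \<in> carrier (submod M N)"
    then have x: "x \<in> N" "x \<in> carrier M" using N by auto
    then show "\<exists>y\<in>carrier (submod M N). y \<oplus>\<^bsub>submod M N\<^esub> x = \<zero>\<^bsub>submod M N\<^esub>"
      using N(4)[of x "-1"] smult_neg_one[of x] l_neg[of x] by (auto intro!: bexI[of _ "\<ominus> x"])
  qed (use N in \<open>auto simp: a_assoc subset_iff intro: a_comm\<close>)
  then show ?thesis
    unfolding left_module_def left_module_axioms_def using N
    by (auto simp: smult_l_distr smult_r_distr smult_assoc smult_one subset_iff)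
qed

end

lemma left_submodule_subset: "left_submodule N M \<Longrightarrow> N \<subseteq> carrier M"
  by (simp add: left_submodule_def additive_subgroup.a_subset)

lemma mod_hom_closed: "\<lbrakk>f \<in> mod_hom M N; x \<in> carrier M\<rbrakk> \<Longrightarrow> f x \<in> carrier N"
  by (auto simp: mod_hom_def)

lemma mod_hom_add:
  "\<lbrakk>f \<in> mod_hom M N; x \<in> carrier M; y \<in> carrier M\<rbrakk> \<Longrightarrow> f (x \<oplus>\<^bsub>M\<^esub> y) = f x \<oplus>\<^bsub>N\<^esub> f y"
  by (auto simp: mod_hom_def)

lemma mod_hom_smult:
  "\<lbrakk>f \<in> mod_hom M N; x \<in> carrier M\<rbrakk> \<Longrightarrow> f (a \<odot>\<^bsub>M\<^esub> x) = a \<odot>\<^bsub>N\<^esub> f x"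
  by (auto simp: mod_hom_def)

lemma mod_homI:
  assumes "\<And>x. x \<in> carrier M \<Longrightarrow> f x \<in> carrier N"
    and "\<And>x y. \<lbrakk>x \<in> carrier M; y \<in> carrier M\<rbrakk> \<Longrightarrow> f (x \<oplus>\<^bsub>M\<^esub> y) = f x \<oplus>\<^bsub>N\<^esub> f y"
    and "\<And>a x. x \<in> carrier M \<Longrightarrow> f (a \<odot>\<^bsub>M\<^esub> x) = a \<odot>\<^bsub>N\<^esub> f x"
  shows "f \<in> mod_hom M N"
  using assms by (auto simp: mod_hom_def)

lemma mod_hom_zero:
  assumes "left_module M" "left_module N" "f \<in> mod_hom M N"
  shows "f \<zero>\<^bsub>M\<^esub> = \<zero>\<^bsub>N\<^esub>"
proof -
  interpret M: left_module M by fact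
  interpret N: left_module N by fact
  show ?thesis
    using mod_hom_smult[OF assms(3) M.zero_closed, of 0] mod_hom_closed[OF assms(3) M.zero_closed]
    by (simp add: M.smult_l_null N.smult_l_null)
qed

lemma mod_hom_minus:
  assumes "left_module M" "left_module N" "f \<in> mod_hom M N" "x \<in> carrier M" "y \<in> carrier M"
  shows "f (x \<ominus>\<^bsub>M\<^esub> y) = f x \<ominus>\<^bsub>N\<^esub> f y"
  using assms
  by (simp add: left_module.minus_eq_smult left_module.smult_closed mod_hom_add mod_hom_smult
      mod_hom_closed)

lemma mod_hom_comp:
  "\<lbrakk>f \<in> mod_hom M N; g \<in> mod_hom N L\<rbrakk> \<Longrightarrow> (\<lambda>x. g (f x)) \<in> mod_hom M L"
  by (auto simp: mod_hom_def Pi_iff)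

lemma mod_hom_id: "(\<lambda>x. x) \<in> mod_hom M M"
  by (auto simp: mod_hom_def)

text \<open>Submodules keep the operations of the ambient record, so restriction, corestriction and
  inclusion leave the function itself unchanged, and inclusion maps need no names.\<close>

lemma mod_hom_sub_dom: "\<lbrakk>f \<in> mod_hom M L; N \<subseteq> carrier M\<rbrakk> \<Longrightarrow> f \<in> mod_hom (submod M N) L"
  by (auto simp: mod_hom_def Pi_iff subset_iff)

lemma mod_hom_sub_cod:
  "\<lbrakk>f \<in> mod_hom M L; \<And>x. x \<in> carrier M \<Longrightarrow> f x \<in> N\<rbrakk> \<Longrightarrow> f \<in> mod_hom M (submod L N)"
  by (auto simp: mod_hom_def Pi_iff)

lemma mod_hom_sub_incl:
  "\<lbrakk>f \<in> mod_hom M (submod L N); N \<subseteq> carrier L\<rbrakk> \<Longrightarrow> f \<in> mod_hom M L"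
  by (auto simp: mod_hom_def Pi_iff)

lemma mod_hom_sum:
  assumes "left_module N" "f \<in> mod_hom M N" "g \<in> mod_hom M N"
  shows "(\<lambda>x. f x \<oplus>\<^bsub>N\<^esub> g x) \<in> mod_hom M N"
proof -
  interpret left_module N by fact
  show ?thesis
    using assms(2,3)
    by (auto intro!: mod_homI simp: mod_hom_closed mod_hom_add mod_hom_smult smult_r_distr a_ac)
qed

lemma mod_hom_diff:
  assumes "left_module N" "f \<in> mod_hom M N" "g \<in> mod_hom M N"
  shows "(\<lambda>x. f x \<ominus>\<^bsub>N\<^esub> g x) \<in> mod_hom M N"
proof -
  interpret left_module N by fact
  show ?thesis
    using assms(2,3)
    by (auto intro!: mod_homI simp: mod_hom_closed mod_hom_add mod_hom_smult smult_r_minus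
        a_minus_def a_ac minus_add)
      (auto simp: a_minus_def[symmetric] smult_r_minus mod_hom_closed)
qed

lemma mod_hom_null: "left_module N \<Longrightarrow> (\<lambda>x. \<zero>\<^bsub>N\<^esub>) \<in> mod_hom M N"
proof -
  assume "left_module N"
  then interpret left_module N .
  show ?thesis by (auto intro!: mod_homI simp: smult_r_null)
qed

lemma mod_epiD: "f \<in> mod_epi M N \<Longrightarrow> f \<in> mod_hom M N" "f \<in> mod_epi M N \<Longrightarrow> f ` carrier M = carrier N"
  by (auto simp: mod_epi_def)

lemma mod_epiE:
  assumes "f \<in> mod_epi M N" "y \<in> carrier N"
  obtains x where "x \<in> carrier M" "f x = y"
proof -
  have "y \<in> f ` carrier M" using assms by (simp add: mod_epi_def)
  then show ?thesis using that by blast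
qed

lemma mod_epi_comp:
  "\<lbrakk>f \<in> mod_epi M N; g \<in> mod_epi N L\<rbrakk> \<Longrightarrow> (\<lambda>x. g (f x)) \<in> mod_epi M L"
  by (auto simp: mod_epi_def mod_hom_comp image_image[symmetric])

lemma mem_a_kernel: "x \<in> a_kernel M N f \<longleftrightarrow> x \<in> carrier M \<and> f x = \<zero>\<^bsub>N\<^esub>"
  by (auto simp: a_kernel_def')

lemma mod_hom_eqI_ker:
  assumes "left_module M" "left_module N" "f \<in> mod_hom M N" "x \<in> carrier M" "y \<in> carrier M"
  shows "f x = f y \<longleftrightarrow> x \<ominus>\<^bsub>M\<^esub> y \<in> a_kernel M N f"
proof -
  interpret M: left_module M by fact
  interpret N: left_module N by fact
  show ?thesis using assms
    by (simp add: mem_a_kernel mod_hom_minus N.minus_eq_zero_iff mod_hom_closed)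
qed

lemma left_submodule_image:
  assumes "left_module M" "left_module L" "f \<in> mod_hom M L" "left_submodule N M"
  shows "left_submodule (f ` N) L"
proof -
  interpret M: left_module M by fact
  interpret L: left_module L by fact
  note N = M.left_submoduleD[OF assms(4)]
  show ?thesis
    unfolding L.left_submodule_iff
  proof (intro conjI ballI allI)
    show "\<zero>\<^bsub>L\<^esub> \<in> f ` N" using mod_hom_zero[OF assms(1-3)] N by (metis image_eqI)
    fix x y assume "x \<in> f ` N" "y \<in> f ` N"
    then obtain u v where "u \<in> N" "v \<in> N" "x = f u" "y = f v" by auto
    then have "x \<oplus>\<^bsub>L\<^esub> y = f (u \<oplus>\<^bsub>M\<^esub> v)" "u \<oplus>\<^bsub>M\<^esub> v \<in> N"
      using N mod_hom_add[OF assms(3)] by (auto simp: subset_iff)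
    then show "x \<oplus>\<^bsub>L\<^esub> y \<in> f ` N" by simp
  next
    fix a x assume "x \<in> f ` N"
    then obtain u where "u \<in> N" "x = f u" by auto
    then have "a \<odot>\<^bsub>L\<^esub> x = f (a \<odot>\<^bsub>M\<^esub> u)" "a \<odot>\<^bsub>M\<^esub> u \<in> N"
      using N mod_hom_smult[OF assms(3)] by (auto simp: subset_iff)
    then show "a \<odot>\<^bsub>L\<^esub> x \<in> f ` N" by simp
  qed (use N mod_hom_closed[OF assms(3)] in auto)
qed

lemma left_submodule_vimage:
  assumes "left_module M" "left_module L" "f \<in> mod_hom M L" "left_submodule N L"
  shows "left_submodule {x \<in> carrier M. f x \<in> N} M"
proof -
  interpret M: left_module M by fact
  interpret L: left_module L by fact
  show ?thesis
    using assms(4) mod_hom_zero[OF assms(1-3)]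
    by (auto simp: M.left_submodule_iff L.left_submodule_iff mod_hom_add[OF assms(3)]
        mod_hom_smult[OF assms(3)] M.smult_closed)
qed

context left_module
begin

lemma left_submodule_zero: "left_submodule {\<zero>} M"
  by (auto simp: left_submodule_iff smult_r_null)

lemma left_submodule_carrier: "left_submodule (carrier M) M"
  by (auto simp: left_submodule_iff smult_closed)

lemma left_submodule_Int: "\<lbrakk>left_submodule N M; left_submodule L M\<rbrakk> \<Longrightarrow> left_submodule (N \<inter> L) M"
  by (auto simp: left_submodule_iff)

lemma left_submodule_sub_iff:
  assumes "left_submodule N M"
  shows "left_submodule L (submod M N) \<longleftrightarrow> left_submodule L M \<and> L \<subseteq> N"
  using assms
    unfolding left_module.left_submodule_iff[OF left_module_sub[OF assms]] left_submodule_iff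
  by auto

lemma submodule_sum:
  assumes "left_submodule N M" "left_submodule L M"
  shows "left_submodule {x \<oplus> y |x y. x \<in> N \<and> y \<in> L} M"
    and "N \<subseteq> {x \<oplus> y |x y. x \<in> N \<and> y \<in> L}" and "L \<subseteq> {x \<oplus> y |x y. x \<in> N \<and> y \<in> L}"
proof -
  note N = left_submoduleD[OF assms(1)]
  note L = left_submoduleD[OF assms(2)]
  show NS: "N \<subseteq> {x \<oplus> y |x y. x \<in> N \<and> y \<in> L}"
  proof
    fix x assume "x \<in> N"
    then have "x = x \<oplus> \<zero>" using N(1) by (simp add: subset_iff)
    then show "x \<in> {x \<oplus> y |x y. x \<in> N \<and> y \<in> L}" using \<open>x \<in> N\<close> L(2) by blast
  qed
  show "L \<subseteq> {x \<oplus> y |x y. x \<in> N \<and> y \<in> L}"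
  proof
    fix x assume "x \<in> L"
    then have "x = \<zero> \<oplus> x" using L(1) by (simp add: subset_iff)
    then show "x \<in> {x \<oplus> y |x y. x \<in> N \<and> y \<in> L}" using \<open>x \<in> L\<close> N(2) by blast
  qed
  show "left_submodule {x \<oplus> y |x y. x \<in> N \<and> y \<in> L} M"
    unfolding left_submodule_iff
  proof (intro conjI ballI allI)
    fix u v assume "u \<in> {x \<oplus> y |x y. x \<in> N \<and> y \<in> L}" "v \<in> {x \<oplus> y |x y. x \<in> N \<and> y \<in> L}"
    then obtain x y x' y' where *: "x \<in> N" "y \<in> L" "u = x \<oplus> y" "x' \<in> N" "y' \<in> L" "v = x' \<oplus> y'"
      by auto
    then have "u \<oplus> v = (x \<oplus> x') \<oplus> (y \<oplus> y')" using N L by (simp add: a_ac subset_iff)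
    then show "u \<oplus> v \<in> {x \<oplus> y |x y. x \<in> N \<and> y \<in> L}" using * N(3) L(3) by blast
  next
    fix a u assume "u \<in> {x \<oplus> y |x y. x \<in> N \<and> y \<in> L}"
    then obtain x y where *: "x \<in> N" "y \<in> L" "u = x \<oplus> y" by auto
    then have "a \<odot> u = a \<odot> x \<oplus> a \<odot> y" using N L by (simp add: smult_r_distr subset_iff)
    then show "a \<odot> u \<in> {x \<oplus> y |x y. x \<in> N \<and> y \<in> L}" using * N(4) L(4) by blast
  next
    show "{x \<oplus> y |x y. x \<in> N \<and> y \<in> L} \<subseteq> carrier M" using N(1) L(1) by blast
    show "\<zero> \<in> {x \<oplus> y |x y. x \<in> N \<and> y \<in> L}" using NS N(2) by blast
  qed
qed

end

lemma left_submodule_kernel: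
  assumes "left_module M" "left_module L" "f \<in> mod_hom M L"
  shows "left_submodule (a_kernel M L f) M"
  using left_submodule_vimage[OF assms left_module.left_submodule_zero[OF assms(2)]]
  by (simp add: a_kernel_def')

text \<open>A preimage under \<open>p\<close> is picked for each element of \<open>Q\<close>; the
  inclusion of kernels makes the value of \<open>h\<close> independent of the pick, hence additive
  and compatible with scalars. Quotients are given by arbitrary epimorphisms, so this universal
  property is how maps out of them are built.\<close>

lemma mod_hom_factor:
  assumes "left_module M" "left_module Q" "left_module L" "p \<in> mod_epi M Q" "h \<in> mod_hom M L"
    and "a_kernel M Q p \<subseteq> a_kernel M L h"
  shows "\<exists>h'\<in>mod_hom Q L. \<forall>x\<in>carrier M. h' (p x) = h x"
proof -
  interpret M: left_module M by fact
  interpret Q: left_module Q by fact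
  have p: "p \<in> mod_hom M Q" using assms by (simp add: mod_epiD)
  define s where "s y = (SOME x. x \<in> carrier M \<and> p x = y)" for y
  have s: "s y \<in> carrier M \<and> p (s y) = y" if "y \<in> carrier Q" for y
  proof -
    obtain x where "x \<in> carrier M" "p x = y" by (rule mod_epiE[OF assms(4) \<open>y \<in> carrier Q\<close>])
    then show ?thesis unfolding s_def by (intro someI[of "\<lambda>x. x \<in> carrier M \<and> p x = y" x] conjI)
  qed
  have hs: "h (s (p x)) = h x" if "x \<in> carrier M" for x
  proof -
    have *: "s (p x) \<in> carrier M" "p (s (p x)) = p x" using s[OF mod_hom_closed[OF p that]]
      by blast+
    then have "s (p x) \<ominus>\<^bsub>M\<^esub> x \<in> a_kernel M L h"
      using mod_hom_eqI_ker[OF assms(1,2) p *(1) that] assms(6) by blast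
    then show ?thesis
      using mod_hom_eqI_ker[OF assms(1,3,5) *(1) that] by blast
  qed
  have "(\<lambda>y. h (s y)) \<in> mod_hom Q L"
  proof (rule mod_homI)
    fix x y assume xy: "x \<in> carrier Q" "y \<in> carrier Q"
    have "h (s (x \<oplus>\<^bsub>Q\<^esub> y)) = h (s (p (s x \<oplus>\<^bsub>M\<^esub> s y)))"
      using s[OF xy(1)] s[OF xy(2)] by (simp add: mod_hom_add[OF p])
    also have "\<dots> = h (s x \<oplus>\<^bsub>M\<^esub> s y)" using s[OF xy(1)] s[OF xy(2)] by (intro hs) simp
    finally show "h (s (x \<oplus>\<^bsub>Q\<^esub> y)) = h (s x) \<oplus>\<^bsub>L\<^esub> h (s y)" using s[OF xy(1)] s[OF xy(2)]
      by (simp add: mod_hom_add[OF assms(5)])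
  next
    fix a x assume x: "x \<in> carrier Q"
    have "h (s (a \<odot>\<^bsub>Q\<^esub> x)) = h (s (p (a \<odot>\<^bsub>M\<^esub> s x)))"
      using s[OF x] by (simp add: mod_hom_smult[OF p])
    also have "\<dots> = h (a \<odot>\<^bsub>M\<^esub> s x)" using s[OF x] by (intro hs) (simp add: M.smult_closed)
    finally show "h (s (a \<odot>\<^bsub>Q\<^esub> x)) = a \<odot>\<^bsub>L\<^esub> h (s x)" using s[OF x]
      by (simp add: mod_hom_smult[OF assms(5)])
  next
    fix x assume x: "x \<in> carrier Q"
    show "h (s x) \<in> carrier L" using s[OF x] mod_hom_closed[OF assms(5)] by blast
  qed
  then show ?thesis by (intro bexI[of _ "\<lambda>y. h (s y)"] ballI hs)
qed

lemma mod_isoI_inj_epi: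
  assumes "left_module M" "left_module N" "f \<in> mod_epi M N" "a_kernel M N f \<subseteq> {\<zero>\<^bsub>M\<^esub>}"
  shows "mod_iso M N"
proof -
  interpret M: left_module M by fact
  have "inj_on f (carrier M)"
    using mod_hom_eqI_ker[OF assms(1,2) mod_epiD(1)[OF assms(3)]] assms(4)
    by (auto intro!: inj_onI simp: subset_iff M.minus_eq_zero_iff)
  then show ?thesis using assms(3) by (auto simp: mod_iso_def mod_epi_def bij_betw_def)
qed

lemma mod_isoE:
  assumes "mod_iso M N"
  obtains f where "f \<in> mod_epi M N" "inj_on f (carrier M)"
  using assms by (auto simp: mod_iso_def mod_epi_def bij_betw_def)

lemma mod_iso_sym:
  assumes "left_module M" "mod_iso M N"
  shows "mod_iso N M"
proof -
  interpret M: left_module M by fact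
  obtain f where f: "f \<in> mod_hom M N" "bij_betw f (carrier M) (carrier N)" using assms(2)
    by (auto simp: mod_iso_def)
  define g where "g = inv_into (carrier M) f"
  have g: "bij_betw g (carrier N) (carrier M)" "\<And>y. y \<in> carrier N \<Longrightarrow> f (g y) = y"
    "\<And>x. x \<in> carrier M \<Longrightarrow> g (f x) = x"
    unfolding g_def using f(2)
      by (auto simp: bij_betw_inv_into bij_betw_inv_into_right bij_betw_inv_into_left)
  have gc: "g y \<in> carrier M" if "y \<in> carrier N" for y using g(1) that by (auto simp: bij_betw_def)
  have "g \<in> mod_hom N M"
  proof (rule mod_homI)
    fix x y assume xy: "x \<in> carrier N" "y \<in> carrier N"
    then show "g (x \<oplus>\<^bsub>N\<^esub> y) = g x \<oplus>\<^bsub>M\<^esub> g y"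
      using g(3)[of "g x \<oplus>\<^bsub>M\<^esub> g y"] by (simp add: gc mod_hom_add[OF f(1)] g(2))
  next
    fix a x assume x: "x \<in> carrier N"
    then show "g (a \<odot>\<^bsub>N\<^esub> x) = a \<odot>\<^bsub>M\<^esub> g x"
      using g(3)[of "a \<odot>\<^bsub>M\<^esub> g x"] by (simp add: gc M.smult_closed mod_hom_smult[OF f(1)] g(2))
  qed (rule gc)
  then show ?thesis using g(1) by (auto simp: mod_iso_def)
qed

section \<open>Modules over a finite dimensional algebra\<close>

definition fscale :: "'k::field \<Rightarrow> ('i \<Rightarrow> 'k) \<Rightarrow> 'i \<Rightarrow> 'k" where
  "fscale c v = (\<lambda>i. c * v i)"

lemma fscale_apply: "fscale c v i = c * v i"
  by (simp add: fscale_def)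

(* As rewrite rules these also match the unapplied operations and expose their lambda terms. *)
declare plus_fun_apply [simp del] zero_fun_apply [simp del] minus_apply [simp del]

lemmas fun_apply_simps = plus_fun_apply zero_fun_apply minus_apply fscale_apply

interpretation fvs: vector_space fscale
  by unfold_locales (auto simp: fun_eq_iff fun_apply_simps algebra_simps)

definition funit :: "'i \<Rightarrow> 'i \<Rightarrow> 'k::field" where
  "funit i = (\<lambda>j. if j = i then 1 else 0)"

lemma in_span_funit:
  fixes v :: "'i \<Rightarrow> 'k::field"
  assumes "finite I" "\<And>i. i \<notin> I \<Longrightarrow> v i = 0"
  shows "v \<in> fvs.span (funit ` I)"
  using assms
proof (induction I arbitrary: v rule: finite_induct)
  case empty
  then have "v = 0" by (simp add: fun_eq_iff fun_apply_simps)
  then show ?case by (simp add: fvs.span_zero)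
next
  case (insert k I)
  define w where "w = v - fscale (v k) (funit k)"
  have "w \<in> fvs.span (funit ` I)"
    using insert.prems insert.hyps by (intro insert.IH) (auto simp: w_def funit_def fun_apply_simps)
  then have "w \<in> fvs.span (funit ` insert k I)"
    using fvs.span_mono[of "funit ` I" "funit ` insert k I"] by blast
  moreover have "fscale (v k) (funit k) \<in> fvs.span (funit ` insert k I)"
    by (intro fvs.span_scale fvs.span_base) simp
  ultimately have "w + fscale (v k) (funit k) \<in> fvs.span (funit ` insert k I)"
    by (rule fvs.span_add)
  then show ?case by (simp add: w_def)
qed

lemma fvs_finite_basis:
  fixes U :: "('i \<Rightarrow> 'k::field) set"
  assumes "finite T" "U \<subseteq> fvs.span T"
  obtains G where "G \<subseteq> U" "finite G" "card G \<le> card T" "fvs.independent G" "U \<subseteq> fvs.span G"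
proof -
  obtain G where G: "G \<subseteq> U" "fvs.independent G" "U \<subseteq> fvs.span G" by (rule fvs.basis_exists)
  then show ?thesis
    using that fvs.independent_span_bound[OF assms(1) G(2)] assms(2) by blast
qed

context finite_dim_algebra
begin

section \<open>Dimension of modules over the ground field\<close>

definition kscale :: "('a, 'm, 'z) module_scheme \<Rightarrow> 'k \<Rightarrow> 'm \<Rightarrow> 'm" where
  "kscale M c x = scale c 1 \<odot>\<^bsub>M\<^esub> x"

text \<open>The coefficients form a total function of which only the first \<open>n\<close> values
  enter. This makes \<open>lincomb\<close> a linear map on a whole function space, where bases and
  spans are available.\<close>

primrec lincomb :: "('a, 'm) module \<Rightarrow> (nat \<Rightarrow> 'm) \<Rightarrow> nat \<Rightarrow> (nat \<Rightarrow> 'k) \<Rightarrow> 'm" where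
  "lincomb M m 0 v = \<zero>\<^bsub>M\<^esub>"
| "lincomb M m (Suc n) v = lincomb M m n v \<oplus>\<^bsub>M\<^esub> kscale M (v n) (m n)"

definition klinear :: "(('i \<Rightarrow> 'k) \<Rightarrow> 'm) \<Rightarrow> ('a, 'm) module \<Rightarrow> bool" where
  "klinear f M \<longleftrightarrow> (\<forall>v. f v \<in> carrier M) \<and> (\<forall>v w. f (v + w) = f v \<oplus>\<^bsub>M\<^esub> f w) \<and>
     (\<forall>c v. f (fscale c v) = kscale M c (f v))"

definition kspanned :: "('a, 'm) module \<Rightarrow> nat \<Rightarrow> bool" where
  "kspanned M n \<longleftrightarrow> (\<exists>m. (\<forall>i<n. m i \<in> carrier M) \<and> carrier M \<subseteq> range (lincomb M m n))"

text \<open>For finitely generated modules this is the dimension over the ground field. Taking the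
  least length of a spanning family avoids any notion of basis of a carrier.\<close>

definition kdim :: "('a, 'm) module \<Rightarrow> nat" where
  "kdim M = (LEAST n. kspanned M n)"

lemma kscale_closed: "\<lbrakk>left_module M; x \<in> carrier M\<rbrakk> \<Longrightarrow> kscale M c x \<in> carrier M"
  by (simp add: kscale_def left_module.smult_closed)

lemma kscale_add:
  "\<lbrakk>left_module M; x \<in> carrier M; y \<in> carrier M\<rbrakk> \<Longrightarrow> kscale M c (x \<oplus>\<^bsub>M\<^esub> y) = kscale M c x \<oplus>\<^bsub>M\<^esub> kscale M c y"
  by (simp add: kscale_def left_module.smult_r_distr)

lemma kscale_add_left:
  "\<lbrakk>left_module M; x \<in> carrier M\<rbrakk> \<Longrightarrow> kscale M (c + d) x = kscale M c x \<oplus>\<^bsub>M\<^esub> kscale M d x"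
  by (simp add: kscale_def left_module.smult_l_distr[symmetric] scale_left_distrib)

lemma kscale_kscale:
  "\<lbrakk>left_module M; x \<in> carrier M\<rbrakk> \<Longrightarrow> kscale M c (kscale M d x) = kscale M (c * d) x"
  by (simp add: kscale_def left_module.smult_assoc[symmetric] scale_mult_left)

lemma kscale_one: "\<lbrakk>left_module M; x \<in> carrier M\<rbrakk> \<Longrightarrow> kscale M 1 x = x"
  by (simp add: kscale_def left_module.smult_one)

lemma kscale_null: "\<lbrakk>left_module M; x \<in> carrier M\<rbrakk> \<Longrightarrow> kscale M 0 x = \<zero>\<^bsub>M\<^esub>"
  by (simp add: kscale_def left_module.smult_l_null)

lemma smult_scale:
  "\<lbrakk>left_module M; x \<in> carrier M\<rbrakk> \<Longrightarrow> scale c a \<odot>\<^bsub>M\<^esub> x = kscale M c (a \<odot>\<^bsub>M\<^esub> x)"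
  by (simp add: kscale_def left_module.smult_assoc[symmetric] scale_mult_left)

lemma smult_kscale:
  "\<lbrakk>left_module M; x \<in> carrier M\<rbrakk> \<Longrightarrow> a \<odot>\<^bsub>M\<^esub> kscale M c x = kscale M c (a \<odot>\<^bsub>M\<^esub> x)"
  by (simp add: kscale_def left_module.smult_assoc[symmetric] scale_mult_left scale_mult_right)

lemma mod_hom_kscale:
  "\<lbrakk>f \<in> mod_hom M N; x \<in> carrier M\<rbrakk> \<Longrightarrow> f (kscale M c x) = kscale N c (f x)"
  by (simp add: kscale_def mod_hom_smult)

lemma kscale_mod_hom:
  "\<lbrakk>left_module N; f \<in> mod_hom M N\<rbrakk> \<Longrightarrow> (\<lambda>x. kscale N c (f x)) \<in> mod_hom M N"
  by (rule mod_homI) (simp_all add: kscale_closed kscale_add smult_kscale mod_hom_closed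
      mod_hom_add mod_hom_smult)

lemma kscale_sub: "kscale (submod M N) c x = kscale M c x"
  by (simp add: kscale_def)

lemma klinear_zero: "\<lbrakk>left_module M; klinear f M\<rbrakk> \<Longrightarrow> f 0 = \<zero>\<^bsub>M\<^esub>"
  using kscale_null[of M "f 0"] unfolding klinear_def by (metis fvs.scale_zero_left)

lemma klinear_lincomb:
  assumes "left_module M" "\<And>i. i < n \<Longrightarrow> m i \<in> carrier M"
  shows "klinear (lincomb M m n) M"
proof -
  interpret left_module M by fact
  have "(\<forall>v. lincomb M m n v \<in> carrier M) \<and>
     (\<forall>v w. lincomb M m n (v + w) = lincomb M m n v \<oplus>\<^bsub>M\<^esub> lincomb M m n w) \<and>
     (\<forall>c v. lincomb M m n (fscale c v) = kscale M c (lincomb M m n v))"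
    using assms(2)
  proof (induction n)
    case 0
    then show ?case by (simp add: kscale_def smult_r_null)
  next
    case (Suc n)
    then have IH: "lincomb M m n v \<in> carrier M"
      "lincomb M m n (v + w) = lincomb M m n v \<oplus>\<^bsub>M\<^esub> lincomb M m n w"
      "lincomb M m n (fscale c v) = kscale M c (lincomb M m n v)" for v w c by simp_all
    have m: "m n \<in> carrier M" using Suc.prems by simp
    have k: "kscale M c (m n) \<in> carrier M" for c using m by (simp add: kscale_closed[OF assms(1)])
    show ?case
      using IH m k
      by (simp add: plus_fun_apply[where x = n] fscale_apply[where i = n] kscale_add[OF assms(1)]
            kscale_add_left[OF assms(1)] kscale_kscale[OF assms(1)] a_ac)
  qed
  then show ?thesis by (simp add: klinear_def)
qed

lemma lincomb_closed:
  "\<lbrakk>left_module M; \<And>i. i < n \<Longrightarrow> m i \<in> carrier M\<rbrakk> \<Longrightarrow> lincomb M m n v \<in> carrier M"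
  using klinear_lincomb[of M n m] by (simp add: klinear_def)

lemma lincomb_cong:
  "(\<And>i. i < n \<Longrightarrow> v i = w i) \<Longrightarrow> (\<And>i. i < n \<Longrightarrow> m i = m' i) \<Longrightarrow> lincomb M m n v = lincomb M m' n w"
  by (induction n) auto

lemma lincomb_funit:
  assumes "left_module M" "\<And>i. i < n \<Longrightarrow> m i \<in> carrier M" "k < n"
  shows "lincomb M m n (funit k) = m k"
  using assms(2,3)
proof (induction n)
  case (Suc n)
  interpret left_module M by fact
  have m: "m n \<in> carrier M" using Suc.prems by simp
  show ?case
  proof (cases "k = n")
    case True
    have "lincomb M m n (funit k) = lincomb M m n (\<lambda>i. 0)"
      using True by (intro lincomb_cong) (auto simp: funit_def)
    moreover have "lincomb M m j (\<lambda>i. 0) = \<zero>\<^bsub>M\<^esub>" if "j \<le> n" for j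
      using that Suc.prems by (induction j) (auto simp: kscale_null[OF assms(1)])
    ultimately show ?thesis using True m by (simp add: funit_def kscale_one[OF assms(1)])
  next
    case False
    then show ?thesis using Suc m by (simp add: funit_def kscale_null[OF assms(1)])
  qed
qed simp

lemma mod_hom_lincomb:
  assumes "left_module M" "left_module N" "f \<in> mod_hom M N" "\<And>i. i < n \<Longrightarrow> m i \<in> carrier M"
  shows "f (lincomb M m n v) = lincomb N (\<lambda>i. f (m i)) n v"
  using assms(4)
proof (induction n)
  case (Suc n)
  then show ?case
    by (simp add: mod_hom_add[OF assms(3)] mod_hom_kscale[OF assms(3)] lincomb_closed[OF assms(1)]
        kscale_closed[OF assms(1)])
qed (simp add: mod_hom_zero[OF assms(1-3)])

text \<open>Counting moves from the carrier to a function space: the images of \<open>G\<close>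
  under \<open>f\<close>, enumerated through \<open>g\<close>, span whatever the span of
  \<open>G\<close> hits. \<open>N\<close> is any subset of the carrier, which serves submodules and,
  with \<open>N\<close> the whole carrier, quotients.\<close>

lemma kspanned_klinear:
  assumes M: "left_module M" and N: "N \<subseteq> carrier M" and f: "klinear f M" and "finite G"
    and G: "f ` G \<subseteq> N" and onto: "\<And>x. x \<in> N \<Longrightarrow> \<exists>w\<in>fvs.span G. f w = x"
  shows "kspanned (submod M N) (card G)"
proof -
  interpret left_module M by fact
  obtain g where g: "bij_betw g {..<card G} G"
    using \<open>finite G\<close> ex_bij_betw_nat_finite atLeast0LessThan by metis
  define m where "m i = f (g i)" for i
  have fc: "f v \<in> carrier M" for v using f by (simp add: klinear_def)
  have m: "m i \<in> carrier M" for i by (simp add: m_def fc)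
  have kl: "klinear (lincomb M m (card G)) M" using M m by (intro klinear_lincomb)
  have "f w \<in> range (lincomb M m (card G))" if "w \<in> fvs.span G" for w
    using that
  proof (induction rule: fvs.span_induct_alt)
    case base
    show ?case using klinear_zero[OF M f] klinear_zero[OF M kl] by (metis rangeI)
  next
    case (step c x y)
    then obtain v where v: "f y = lincomb M m (card G) v" by auto
    have "x \<in> g ` {..<card G}" using g step(1) by (simp add: bij_betw_def)
    then obtain k where k: "k < card G" "g k = x" by auto
    have "f (fscale c x + y) = kscale M c (f x) \<oplus>\<^bsub>M\<^esub> f y" using f by (simp add: klinear_def)
    also have "\<dots> = lincomb M m (card G) (fscale c (funit k) + v)"
      using kl lincomb_funit[of M "card G" m k, OF M m k(1)] v k(2) by (simp add: klinear_def m_def)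
    finally show ?case by blast
  qed
  moreover have "lincomb (submod M N) m j v = lincomb M m j v" for j v
    by (induction j) (simp_all add: kscale_sub)
  moreover have "m i \<in> N" if "i < card G" for i
    using g G that by (auto simp: m_def bij_betw_def)
  ultimately show ?thesis unfolding kspanned_def using onto
    by (intro exI[of _ m]) (auto simp: subset_iff, metis)
qed

lemma kspanned_epi:
  assumes "left_module M" "left_module Q" "p \<in> mod_epi M Q" "kspanned M n"
  shows "kspanned Q n"
proof -
  obtain m where m: "\<And>i. i < n \<Longrightarrow> m i \<in> carrier M" "carrier M \<subseteq> range (lincomb M m n)"
    using assms(4) by (auto simp: kspanned_def)
  have p: "p \<in> mod_hom M Q" "carrier Q = p ` carrier M" using assms(3) by (auto simp: mod_epi_def)
  have "carrier Q \<subseteq> range (lincomb Q (\<lambda>i. p (m i)) n)"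
  proof
    fix y assume "y \<in> carrier Q"
    then obtain v where "y = p (lincomb M m n v)" unfolding p(2) using m(2) by blast
    then show "y \<in> range (lincomb Q (\<lambda>i. p (m i)) n)"
      using mod_hom_lincomb[OF assms(1,2) p(1) m(1), of n] by simp
  qed
  then show ?thesis unfolding kspanned_def
    using m(1) mod_hom_closed[OF p(1)] by (intro exI[of _ "\<lambda>i. p (m i)"]) simp
qed

text \<open>If \<open>B\<close> spans the algebra and \<open>S\<close> generates \<open>M\<close>,
  the products of elements of \<open>B\<close> with elements of \<open>S\<close> span
  \<open>M\<close>: their linear span contains \<open>S\<close> and is stable under every
  \<open>a\<close>, since \<open>a * b\<close> is again a combination of elements of
  \<open>B\<close>. Conversely, a submodule containing a spanning family is everything.\<close>

lemma finitely_generated_iff_kspanned: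
  assumes M: "left_module M"
  shows "finitely_generated M \<longleftrightarrow> (\<exists>n. kspanned M n)"
proof
  interpret left_module M by fact
  assume "finitely_generated M"
  then obtain S where S: "finite S" "S \<subseteq> carrier M"
    "\<And>N. \<lbrakk>left_submodule N M; S \<subseteq> N\<rbrakk> \<Longrightarrow> N = carrier M"
    by (auto simp: finitely_generated_def)
  obtain B where B: "finite B" "span B = UNIV" using finite_dim by blast
  define G where "G = (\<lambda>(b, s). b \<odot>\<^bsub>M\<^esub> s) ` (B \<times> S)"
  have "finite G" using B S by (simp add: G_def)
  then obtain m where m: "bij_betw m {..<card G} G"
    using ex_bij_betw_nat_finite atLeast0LessThan by metis
  have Gc: "G \<subseteq> carrier M" using S(2) by (auto simp: G_def smult_closed subset_iff)
  have mc: "m i \<in> carrier M" if "i < card G" for i using m that Gc by (auto simp: bij_betw_def)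
  define N where "N = range (lincomb M m (card G))"
  have kl: "klinear (lincomb M m (card G)) M" using M mc by (intro klinear_lincomb)
  have Nc: "N \<subseteq> carrier M" using kl by (auto simp: N_def klinear_def)
  have Nadd: "x \<oplus>\<^bsub>M\<^esub> y \<in> N" if xy: "x \<in> N" "y \<in> N" for x y
  proof -
    obtain v w where "x = lincomb M m (card G) v" "y = lincomb M m (card G) w" using xy
      by (auto simp: N_def)
    then have "x \<oplus>\<^bsub>M\<^esub> y = lincomb M m (card G) (v + w)" using kl by (simp add: klinear_def)
    then show ?thesis by (auto simp: N_def)
  qed
  have Nscale: "kscale M c x \<in> N" if x: "x \<in> N" for c x
  proof -
    obtain v where "x = lincomb M m (card G) v" using x by (auto simp: N_def)
    then have "kscale M c x = lincomb M m (card G) (fscale c v)" using kl by (simp add: klinear_def)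
    then show ?thesis by (auto simp: N_def)
  qed
  have NG: "G \<subseteq> N"
  proof
    fix x assume "x \<in> G"
    then have "x \<in> m ` {..<card G}" using m by (simp add: bij_betw_def)
    then obtain k where "k < card G" "m k = x" by auto
    then have "x = lincomb M m (card G) (funit k)" using lincomb_funit[OF M mc] by simp
    then show "x \<in> N" by (simp add: N_def)
  qed
  have N0: "\<zero>\<^bsub>M\<^esub> \<in> N"
  proof -
    have "lincomb M m (card G) 0 \<in> N" by (simp add: N_def)
    then show ?thesis using Nscale[of _ 0] kscale_null[OF M] Nc by (metis subsetD)
  qed
  have NS: "a \<odot>\<^bsub>M\<^esub> s \<in> N" if s: "s \<in> S" for a s
  proof -
    have "s \<in> carrier M" using s S(2) by blast
    have "a \<in> span B" using B by simp
    then show ?thesis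
    proof (induction rule: span_induct_alt)
      case base then show ?case using N0 \<open>s \<in> carrier M\<close> by (simp add: smult_l_null)
    next
      case (step c x y)
      have "x \<odot>\<^bsub>M\<^esub> s \<in> N" using NG step(1) s unfolding G_def by blast
      then show ?case
        using step(2) \<open>s \<in> carrier M\<close> by (simp add: smult_l_distr smult_scale[OF M] Nadd Nscale)
    qed
  qed
  have "a \<odot>\<^bsub>M\<^esub> lincomb M m j v \<in> N" if "j \<le> card G" for a j v
    using that
  proof (induction j)
    case 0 then show ?case using N0 by (simp add: smult_r_null)
  next
    case (Suc j)
    have mj: "m j \<in> carrier M" using mc Suc.prems by simp
    have "m j \<in> G" using m Suc.prems by (auto simp: bij_betw_def)
    then obtain b s where bs: "s \<in> S" "m j = b \<odot>\<^bsub>M\<^esub> s" unfolding G_def by auto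
    have "a \<odot>\<^bsub>M\<^esub> m j = (a * b) \<odot>\<^bsub>M\<^esub> s" using bs S(2) smult_assoc by auto
    then have "a \<odot>\<^bsub>M\<^esub> m j \<in> N" using NS bs(1) by simp
    moreover have "lincomb M m j v \<in> carrier M" using Suc.prems mc
      by (intro lincomb_closed[OF M]) simp
    ultimately show ?case
      using Suc mj by (simp add: smult_r_distr smult_kscale[OF M] kscale_closed[OF M] Nadd Nscale)
  qed
  then have "left_submodule N M"
    unfolding left_submodule_iff using Nc N0 Nadd by (auto simp: N_def)
  moreover have "S \<subseteq> N"
  proof
    fix s assume "s \<in> S"
    then show "s \<in> N" using NS[of s 1] S(2) smult_one[of s] by auto
  qed
  ultimately have "N = carrier M" by (rule S(3))
  then show "\<exists>n. kspanned M n" using mc unfolding kspanned_def N_def by blast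
next
  interpret left_module M by fact
  assume "\<exists>n. kspanned M n"
  then obtain n m where m: "\<And>i. i < n \<Longrightarrow> m i \<in> carrier M" "carrier M \<subseteq> range (lincomb M m n)"
    by (auto simp: kspanned_def)
  show "finitely_generated M"
    unfolding finitely_generated_def
  proof (intro exI[of _ "m ` {..<n}"] conjI allI impI)
    fix N assume N: "left_submodule N M \<and> m ` {..<n} \<subseteq> N"
    then have sN: "left_submodule N M" by blast
    note N' = left_submoduleD[OF sN]
    have "lincomb M m j v \<in> N" if "j \<le> n" for j v
      using that
    proof (induction j)
      case (Suc j)
      then have "m j \<in> N" using N by auto
      then show ?case using Suc N' by (simp add: kscale_def)
    qed (simp add: N')
    then show "N = carrier M" using m(2) N'(1) by blast
  qed (use m in auto)
qed

lemma kspanned_kdim: "kspanned M n \<Longrightarrow> kspanned M (kdim M)"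
  unfolding kdim_def by (rule LeastI)

lemma kdim_le: "kspanned M n \<Longrightarrow> kdim M \<le> n"
  unfolding kdim_def by (rule Least_le)

lemma fgmodD: "M \<in> fgmod \<Longrightarrow> left_module M" "M \<in> fgmod \<Longrightarrow> kspanned M (kdim M)"
  using finitely_generated_iff_kspanned kspanned_kdim by (auto simp: fgmod_def)

lemma fgmodI: "\<lbrakk>left_module M; kspanned M n\<rbrakk> \<Longrightarrow> M \<in> fgmod"
  using finitely_generated_iff_kspanned by (auto simp: fgmod_def)

text \<open>The source of the dimension estimates: a linear surjection onto \<open>M\<close> from a
  space spanned by at most \<open>kdim M\<close> vectors. Independent sets are compared in that
  space instead of in \<open>M\<close>.\<close>

lemma fgmod_presentation:
  assumes "M \<in> fgmod"
  obtains f :: "(nat \<Rightarrow> 'k) \<Rightarrow> 'm" and T where "klinear f M" "finite T" "card T \<le> kdim M"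
    "\<forall>x\<in>carrier M. \<exists>v\<in>fvs.span T. f v = x"
proof -
  note M = fgmodD[OF assms]
  obtain m where m: "\<And>i. i < kdim M \<Longrightarrow> m i \<in> carrier M" "carrier M \<subseteq> range (lincomb M m (kdim M))"
    using M(2) unfolding kspanned_def by blast
  show ?thesis
  proof (rule that[of _ "funit ` {..<kdim M}"])
    show "klinear (lincomb M m (kdim M)) M" using m(1) by (rule klinear_lincomb[OF M(1)])
    show "card (funit ` {..<kdim M} :: (nat \<Rightarrow> 'k) set) \<le> kdim M"
      using card_image_le[of "{..<kdim M}" funit] by simp
    show "\<forall>x\<in>carrier M. \<exists>v\<in>fvs.span (funit ` {..<kdim M}). lincomb M m (kdim M) v = x"
    proof
      fix x assume "x \<in> carrier M"
      then obtain v where "x = lincomb M m (kdim M) v" using m(2) by blast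
      \<comment> \<open>Coefficients beyond \<open>kdim M\<close> do not enter
        \<open>lincomb\<close>, and cutting them off puts the vector into the span of finitely many
        unit vectors.\<close>
      also have "\<dots> = lincomb M m (kdim M) (\<lambda>i. if i < kdim M then v i else 0)"
        by (rule lincomb_cong) auto
      finally show "\<exists>v\<in>fvs.span (funit ` {..<kdim M}). lincomb M m (kdim M) v = x"
        by (intro bexI[of _ "\<lambda>i. if i < kdim M then v i else 0"] in_span_funit) simp_all
    qed
  qed simp
qed

text \<open>A basis \<open>G\<close> of the preimage of \<open>N\<close> maps to a spanning family
  of \<open>N\<close>. If \<open>N\<close> misses some \<open>x\<close>, a preimage \<open>u\<close>
  of \<open>x\<close> lies outside the span of \<open>G\<close>, so \<open>insert u G\<close> is
  still independent and \<open>G\<close> has fewer than \<open>kdim M\<close> elements.\<close>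

lemma fgmod_sub:
  assumes M: "M \<in> fgmod" and N: "left_submodule N M"
  shows "submod M N \<in> fgmod" and "N \<noteq> carrier M \<Longrightarrow> kdim (submod M N) < kdim M"
proof -
  interpret left_module M using M by (rule fgmodD)
  have lM: "left_module M" by unfold_locales
  note N' = left_submoduleD[OF N]
  obtain f :: "(nat \<Rightarrow> 'k) \<Rightarrow> _" and T where f: "klinear f M" and T: "finite T" "card T \<le> kdim M"
    and onto: "\<forall>x\<in>carrier M. \<exists>v\<in>fvs.span T. f v = x"
    by (rule fgmod_presentation[OF M])
  define U where "U = {v \<in> fvs.span T. f v \<in> N}"
  obtain G where G: "G \<subseteq> U" "finite G" "card G \<le> card T" "fvs.independent G" "U \<subseteq> fvs.span G"
    using fvs_finite_basis[OF T(1), of U] unfolding U_def by blast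
  have fG: "f ` G \<subseteq> N" using G(1) by (auto simp: U_def)
  have ontoN: "\<exists>w\<in>fvs.span G. f w = x" if "x \<in> N" for x
  proof -
    obtain w where "w \<in> fvs.span T" "f w = x" using onto N'(1) \<open>x \<in> N\<close> by (meson subsetD)
    then have "w \<in> U" using \<open>x \<in> N\<close> by (simp add: U_def)
    then show ?thesis using G(5) \<open>f w = x\<close> by blast
  qed
  have sp: "kspanned (submod M N) (card G)"
    using kspanned_klinear[OF lM N'(1) f G(2) fG ontoN] .
  show fg: "submod M N \<in> fgmod" using fgmodI[OF left_module_sub[OF N] sp] .
  show "kdim (submod M N) < kdim M" if ne: "N \<noteq> carrier M"
  proof -
    obtain x where x: "x \<in> carrier M" "x \<notin> N" using ne N'(1) by blast
    obtain u where u: "u \<in> fvs.span T" "f u = x" using onto x(1) by blast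
    have "fvs.subspace U"
      unfolding fvs.subspace_def U_def using f N' klinear_zero[OF lM f]
      by (auto simp: klinear_def kscale_def fvs.span_zero fvs.span_add fvs.span_scale)
    then have "fvs.span G \<subseteq> U" using G(1) fvs.span_minimal by blast
    then have "u \<notin> fvs.span G" using u x by (auto simp: U_def)
    then have ind: "fvs.independent (insert u G)" "u \<notin> G"
      using G(4) fvs.independent_insertI[of u G] fvs.span_base[of u G] by blast+
    have "insert u G \<subseteq> fvs.span T" using G(1) u(1) unfolding U_def by blast
    then have "card (insert u G) \<le> card T" using fvs.independent_span_bound[OF T(1) ind(1)] by blast
    then have "card G < kdim M" using ind(2) G(2) T(2) by simp
    then show ?thesis using kdim_le[OF sp] by simp
  qed
qed

lemma fgmod_epi:
  assumes "M \<in> fgmod" "left_module Q" "p \<in> mod_epi M Q"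
  shows "Q \<in> fgmod" and "kdim Q \<le> kdim M"
proof -
  have *: "kspanned Q (kdim M)"
    using kspanned_epi[OF fgmodD(1)[OF assms(1)] assms(2,3) fgmodD(2)[OF assms(1)]] .
  show "Q \<in> fgmod" by (rule fgmodI[OF assms(2) *])
  show "kdim Q \<le> kdim M" by (rule kdim_le[OF *])
qed

text \<open>A nonzero kernel element has a nonzero preimage \<open>u\<close> in the function space.
  For a basis \<open>B\<close> of that space through \<open>u\<close>, the vector \<open>u\<close>
  becomes zero in \<open>Q\<close>, so the images of \<open>B - {u}\<close> already span
  \<open>Q\<close>.\<close>

lemma kdim_epi_less:
  assumes M: "M \<in> fgmod" and Q: "left_module Q" and p: "p \<in> mod_epi M Q"
    and x: "x \<in> a_kernel M Q p" "x \<noteq> \<zero>\<^bsub>M\<^esub>"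
  shows "kdim Q < kdim M"
proof -
  interpret left_module M using M by (rule fgmodD)
  interpret Q: left_module Q by fact
  have lM: "left_module M" by unfold_locales
  have ph: "p \<in> mod_hom M Q" using p by (rule mod_epiD)
  obtain f :: "(nat \<Rightarrow> 'k) \<Rightarrow> _" and T where f: "klinear f M" and T: "finite T" "card T \<le> kdim M"
    and onto: "\<forall>x\<in>carrier M. \<exists>v\<in>fvs.span T. f v = x"
    by (rule fgmod_presentation[OF M])
  have xc: "x \<in> carrier M" "p x = \<zero>\<^bsub>Q\<^esub>" using x by (auto simp: mem_a_kernel)
  obtain u where u: "u \<in> fvs.span T" "f u = x" using onto xc(1) by blast
  have fc: "f v \<in> carrier M" for v using f by (simp add: klinear_def)
  have u0: "u \<noteq> 0" using klinear_zero[OF lM f] u x(2) by auto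
  then have "fvs.independent {u}" by simp
  then obtain B where B: "{u} \<subseteq> B" "B \<subseteq> fvs.span T" "fvs.independent B" "fvs.span T \<subseteq> fvs.span B"
    using fvs.maximal_independent_subset_extend[of "{u}" "fvs.span T"] u(1) by blast
  have Bf: "finite B" "card B \<le> card T"
    using fvs.independent_span_bound[OF T(1) B(3,2)] by auto
  have "\<exists>w\<in>fvs.span (B - {u}). p (f w) = y" if y: "y \<in> carrier Q" for y
  proof -
    obtain z where z: "z \<in> carrier M" "p z = y" by (rule mod_epiE[OF p y])
    obtain v where v: "v \<in> fvs.span T" "f v = z" using onto z(1) by blast
    then obtain k where k: "v - fscale k u \<in> fvs.span (B - {u})"
      using fvs.span_breakdown[of u B v] B by blast
    have "f v = f (v - fscale k u) \<oplus>\<^bsub>M\<^esub> kscale M k x"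
    proof -
      have "f ((v - fscale k u) + fscale k u) = f (v - fscale k u) \<oplus>\<^bsub>M\<^esub> f (fscale k u)"
        using f unfolding klinear_def by blast
      then show ?thesis using f u(2) by (simp add: klinear_def)
    qed
    then have "y = p (f (v - fscale k u)) \<oplus>\<^bsub>Q\<^esub> kscale Q k (p x)"
      using z v fc xc by (simp add: mod_hom_add[OF ph] mod_hom_kscale[OF ph] kscale_closed[OF lM])
    then have "p (f (v - fscale k u)) = y"
      using xc fc mod_hom_closed[OF ph fc] by (simp add: kscale_def Q.smult_r_null)
    then show ?thesis using k by blast
  qed
  moreover have "klinear (\<lambda>v. p (f v)) Q"
    using f fc mod_hom_closed[OF ph fc] unfolding klinear_def
    by (simp add: mod_hom_add[OF ph] mod_hom_kscale[OF ph])
  moreover have "(\<lambda>v. p (f v)) ` (B - {u}) \<subseteq> carrier Q" using mod_hom_closed[OF ph fc] by blast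
  ultimately have "kspanned (submod Q (carrier Q)) (card (B - {u}))"
    using Bf(1) by (intro kspanned_klinear[OF Q, where f = "\<lambda>v. p (f v)"]) auto
  then have "kdim Q \<le> card (B - {u})" by (intro kdim_le) simp
  also have "\<dots> < card B" using B(1) Bf(1) by (intro psubset_card_mono) auto
  finally show ?thesis using Bf(2) T(2) by simp
qed

end

section \<open>Quotients, products and free modules of rank one\<close>

text \<open>Structure transported along \<open>f\<close> to names in another type. An injective
  \<open>f\<close> copies a module, and an \<open>f\<close> that chooses coset representatives forms
  a quotient. Compatibility of \<open>f\<close> with the operations, assumed in the lemma that
  follows, makes the choice of \<open>inv_into\<close> immaterial.\<close>

definition image_module :: "('n \<Rightarrow> 'm) \<Rightarrow> ('a::{ring, monoid_mult}, 'n) module \<Rightarrow> ('a, 'm) module" where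
  "image_module f M =
     \<lparr>carrier = f ` carrier M, monoid.mult = undefined, one = undefined, zero = f \<zero>\<^bsub>M\<^esub>,
      add = (\<lambda>u v. f (inv_into (carrier M) f u \<oplus>\<^bsub>M\<^esub> inv_into (carrier M) f v)),
      module.smult = (\<lambda>a u. f (a \<odot>\<^bsub>M\<^esub> inv_into (carrier M) f u))\<rparr>"

lemma image_module:
  assumes M: "left_module M"
    and add_cong: "\<And>x y x' y'. \<lbrakk>x \<in> carrier M; y \<in> carrier M; x' \<in> carrier M; y' \<in> carrier M;
        f x = f x'; f y = f y'\<rbrakk>
      \<Longrightarrow> f (x \<oplus>\<^bsub>M\<^esub> y) = f (x' \<oplus>\<^bsub>M\<^esub> y')"
    and smult_cong: "\<And>a x x'. \<lbrakk>x \<in> carrier M; x' \<in> carrier M; f x = f x'\<rbrakk> \<Longrightarrow> f (a \<odot>\<^bsub>M\<^esub> x) = f (a \<odot>\<^bsub>M\<^esub> x')"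
  shows "left_module (image_module f M)" and "f \<in> mod_epi M (image_module f M)"
    and "carrier (image_module f M) = f ` carrier M" and "\<zero>\<^bsub>image_module f M\<^esub> = f \<zero>\<^bsub>M\<^esub>"
proof -
  interpret left_module M by fact
  let ?I = "image_module f M"
  have c: "carrier ?I = f ` carrier M" and z: "\<zero>\<^bsub>?I\<^esub> = f \<zero>\<^bsub>M\<^esub>"
    by (simp_all add: image_module_def)
  have inv: "inv_into (carrier M) f (f x) \<in> carrier M" "f (inv_into (carrier M) f (f x)) = f x"
    if "x \<in> carrier M" for x
    using that by (auto intro: inv_into_into f_inv_into_f)
  have a: "f x \<oplus>\<^bsub>?I\<^esub> f y = f (x \<oplus>\<^bsub>M\<^esub> y)" if "x \<in> carrier M" "y \<in> carrier M" for x y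
    unfolding image_module_def using that inv by (simp, intro add_cong) auto
  have s: "b \<odot>\<^bsub>?I\<^esub> f x = f (b \<odot>\<^bsub>M\<^esub> x)" if "x \<in> carrier M" for b x
    unfolding image_module_def using that inv by (simp, intro smult_cong) auto
  show "carrier ?I = f ` carrier M" "\<zero>\<^bsub>?I\<^esub> = f \<zero>\<^bsub>M\<^esub>" by (fact c z)+
  show "f \<in> mod_epi M ?I" by (auto simp: mod_epi_def c a s intro!: mod_homI)
  have "abelian_group ?I"
  proof (rule abelian_groupI)
    fix u assume "u \<in> carrier ?I"
    then obtain x where x: "x \<in> carrier M" "u = f x" by (auto simp: c)
    then show "\<exists>v\<in>carrier ?I. v \<oplus>\<^bsub>?I\<^esub> u = \<zero>\<^bsub>?I\<^esub>"
      by (intro bexI[of _ "f (\<ominus>\<^bsub>M\<^esub> x)"]) (simp_all add: a c z l_neg)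
    show "\<zero>\<^bsub>?I\<^esub> \<oplus>\<^bsub>?I\<^esub> u = u" using x by (simp add: z a)
  next
    fix u v w assume "u \<in> carrier ?I" "v \<in> carrier ?I" "w \<in> carrier ?I"
    then show "u \<oplus>\<^bsub>?I\<^esub> v \<oplus>\<^bsub>?I\<^esub> w = u \<oplus>\<^bsub>?I\<^esub> (v \<oplus>\<^bsub>?I\<^esub> w)" by (auto simp: c a a_assoc)
  next
    fix u v assume "u \<in> carrier ?I" "v \<in> carrier ?I"
    then show "u \<oplus>\<^bsub>?I\<^esub> v \<in> carrier ?I" "u \<oplus>\<^bsub>?I\<^esub> v = v \<oplus>\<^bsub>?I\<^esub> u" by (auto simp: c a a_comm)
  qed (simp add: c z)
  then show "left_module ?I"
    unfolding left_module_def left_module_axioms_def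
    by (auto simp: c a s smult_closed smult_l_distr smult_r_distr smult_assoc smult_one)
qed

text \<open>Coset representatives keep the quotient within the type of the module.\<close>

lemma ex_quotient:
  fixes M :: "('a::{ring, monoid_mult}, 'm) module"
  assumes M: "left_module M" and N: "left_submodule N M"
  shows "\<exists>(Q :: ('a, 'm) module) p. left_module Q \<and> p \<in> mod_epi M Q \<and> a_kernel M Q p = N"
proof -
  interpret left_module M by fact
  note N' = left_submoduleD[OF N]
  define p where "p x = (SOME y. y \<in> carrier M \<and> x \<ominus>\<^bsub>M\<^esub> y \<in> N)" for x
  have p: "p x \<in> carrier M" "x \<ominus>\<^bsub>M\<^esub> p x \<in> N" if "x \<in> carrier M" for x
  proof -
    have "x \<in> carrier M \<and> x \<ominus>\<^bsub>M\<^esub> x \<in> N" using that N'(2) by (simp add: a_minus_def r_neg)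
    then have "p x \<in> carrier M \<and> x \<ominus>\<^bsub>M\<^esub> p x \<in> N" unfolding p_def by (rule someI)
    then show "p x \<in> carrier M" "x \<ominus>\<^bsub>M\<^esub> p x \<in> N" by auto
  qed
  have sym: "y \<ominus>\<^bsub>M\<^esub> x \<in> N" if "x \<in> carrier M" "y \<in> carrier M" "x \<ominus>\<^bsub>M\<^esub> y \<in> N" for x y
  proof -
    have "y \<ominus>\<^bsub>M\<^esub> x = (- 1) \<odot>\<^bsub>M\<^esub> (x \<ominus>\<^bsub>M\<^esub> y)"
      using that by (simp add: smult_neg_one a_minus_def minus_add a_comm)
    then show ?thesis using that N' by simp
  qed
  have tr: "x \<ominus>\<^bsub>M\<^esub> z \<in> N" if "x \<in> carrier M" "y \<in> carrier M" "z \<in> carrier M" "x \<ominus>\<^bsub>M\<^esub> y \<in> N" "y \<ominus>\<^bsub>M\<^esub> z \<in> N"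
    for x y z
  proof -
    have "x \<ominus>\<^bsub>M\<^esub> z = (x \<ominus>\<^bsub>M\<^esub> y) \<oplus>\<^bsub>M\<^esub> (y \<ominus>\<^bsub>M\<^esub> z)"
      using that(1-3) by (simp add: a_minus_def a_assoc) (simp add: a_assoc[symmetric] l_neg)
    then show ?thesis using that N' by simp
  qed
  have peq: "p x = p y \<longleftrightarrow> x \<ominus>\<^bsub>M\<^esub> y \<in> N" if xy: "x \<in> carrier M" "y \<in> carrier M" for x y
  proof
    assume "p x = p y"
    then show "x \<ominus>\<^bsub>M\<^esub> y \<in> N" using p[OF xy(1)] p[OF xy(2)] sym tr xy by metis
  next
    assume *: "x \<ominus>\<^bsub>M\<^esub> y \<in> N"
    \<comment> \<open>Elements of one coset satisfy the same predicate, so the choice operator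
      returns the same representative for both.\<close>
    have "(z \<in> carrier M \<and> x \<ominus>\<^bsub>M\<^esub> z \<in> N) = (z \<in> carrier M \<and> y \<ominus>\<^bsub>M\<^esub> z \<in> N)" for z
      using tr[of x y z] tr[of y x z] sym[OF xy *] xy * by blast
    then show "p x = p y" unfolding p_def by simp
  qed
  have ac: "p (x \<oplus>\<^bsub>M\<^esub> y) = p (x' \<oplus>\<^bsub>M\<^esub> y')"
    if "x \<in> carrier M" "y \<in> carrier M" "x' \<in> carrier M" "y' \<in> carrier M" "p x = p x'" "p y = p y'"
      for x y x' y'
  proof -
    have "(x \<oplus>\<^bsub>M\<^esub> y) \<ominus>\<^bsub>M\<^esub> (x' \<oplus>\<^bsub>M\<^esub> y') = (x \<ominus>\<^bsub>M\<^esub> x') \<oplus>\<^bsub>M\<^esub> (y \<ominus>\<^bsub>M\<^esub> y')"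
      using that(1-4) by (simp add: a_minus_def minus_add a_ac)
    then show ?thesis using that N' by (simp add: peq)
  qed
  have sc: "p (b \<odot>\<^bsub>M\<^esub> x) = p (b \<odot>\<^bsub>M\<^esub> x')" if "x \<in> carrier M" "x' \<in> carrier M" "p x = p x'" for b x x'
    using that N' by (simp add: peq smult_closed smult_r_minus[symmetric])
  note Q = image_module[OF M, of p, OF ac sc]
  have "x \<ominus>\<^bsub>M\<^esub> \<zero>\<^bsub>M\<^esub> = x" if "x \<in> carrier M" for x using that by (simp add: a_minus_def)
  then have "a_kernel M (image_module p M) p = N"
    using N'(1) by (auto simp: mem_a_kernel Q peq)
  then show ?thesis using Q(1,2) by blast
qed

context finite_dim_algebra
begin

lemma ex_fgmod_quotient:
  fixes M :: "('a, 'm) module"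
  assumes M: "M \<in> fgmod" and N: "left_submodule N M"
  obtains Q :: "('a, 'm) module" and p where "Q \<in> fgmod" "p \<in> mod_epi M Q" "a_kernel M Q p = N"
  using ex_quotient[OF fgmodD(1)[OF M] N] fgmod_epi[OF M] by metis

end

section \<open>Copies, products and the regular module inside the type of the objects\<close>

lemma infinite_alg_closed_field: "infinite (UNIV :: 'k::alg_closed_field set)"
proof
  assume fin: "finite (UNIV :: 'k set)"
  \<comment> \<open>Over a finite field the product of all linear factors vanishes everywhere, so
    \<open>q + 1\<close> has positive degree but no root.\<close>
  define q where "q = (\<Prod>a\<in>(UNIV :: 'k set). [:- a, 1:])"
  have "degree q = card (UNIV :: 'k set)"
    unfolding q_def by (subst degree_prod_sum_eq) auto
  moreover have "card (UNIV :: 'k set) > 0" using fin by (simp add: card_gt_0_iff)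
  ultimately have "degree (q + 1) > 0" by (simp add: degree_add_eq_left)
  then obtain x where "poly (q + 1) x = 0" using alg_closed_imp_poly_has_root by blast
  moreover have "poly q x = 0" unfolding q_def poly_prod using fin by (intro prod_zero) auto
  ultimately show False by simp
qed

text \<open>An infinite set contains a copy of its square, so coordinates are absorbed one at a time
  by a pairing \<open>h\<close>. With an infinite field this names the elements of a finite
  dimensional space by single scalars.\<close>

lemma ex_tuple_code:
  assumes "infinite (UNIV :: 'k set)"
  shows "\<exists>c :: (nat \<Rightarrow> 'k) \<Rightarrow> 'k. \<forall>v w. c v = c w \<longrightarrow> (\<forall>i<n. v i = w i)"
proof (induction n)
  case (Suc n)
  then obtain c :: "(nat \<Rightarrow> 'k) \<Rightarrow> 'k" where c: "\<And>v w. c v = c w \<Longrightarrow> \<forall>i<n. v i = w i" by blast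
  have "(card_of ((UNIV :: 'k set) \<times> (UNIV :: 'k set)), card_of (UNIV :: 'k set)) \<in> ordLeq"
    using card_of_Times_same_infinite[OF assms] ordIso_imp_ordLeq by blast
  then obtain h :: "'k \<times> 'k \<Rightarrow> 'k" where h: "inj h"
    unfolding card_of_ordLeq[symmetric] by auto
  show ?case
  proof (intro exI[of _ "\<lambda>v. h (c v, v n)"] allI impI)
    fix v w i assume *: "h (c v, v n) = h (c w, w n)" "i < Suc n"
    have "c v = c w" "v n = w n" using injD[OF h *(1)] by auto
    then show "v i = w i" using c *(2) by (metis less_SucE)
  qed
qed simp

text \<open>The direct sum of two objects, described elementwise: the projections jointly hit every
  pair exactly once. The module on pairs has its elements outside \<open>'m\<close>; only a copy of
  it qualifies.\<close>

definition is_product ::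
    "('a::{ring, monoid_mult}, 'm) module \<Rightarrow> ('a, 'm) module \<Rightarrow> ('a, 'm) module \<Rightarrow>
     ('m \<Rightarrow> 'm) \<Rightarrow> ('m \<Rightarrow> 'm) \<Rightarrow> bool" where
  "is_product X Y P p1 p2 \<longleftrightarrow> P \<in> fgmod \<and> p1 \<in> mod_hom P X \<and> p2 \<in> mod_hom P Y \<and>
     (\<forall>x\<in>carrier X. \<forall>y\<in>carrier Y. \<exists>z\<in>carrier P. p1 z = x \<and> p2 z = y) \<and>
     (\<forall>z\<in>carrier P. \<forall>z'\<in>carrier P. p1 z = p1 z' \<longrightarrow> p2 z = p2 z' \<longrightarrow> z = z')"

lemmas is_productD =
  is_product_def[THEN iffD1, THEN conjunct1]
  is_product_def[THEN iffD1, THEN conjunct2, THEN conjunct1]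
  is_product_def[THEN iffD1, THEN conjunct2, THEN conjunct2, THEN conjunct1]
  is_product_def[THEN iffD1, THEN conjunct2, THEN conjunct2, THEN conjunct2, THEN conjunct1]
  is_product_def[THEN iffD1, THEN conjunct2, THEN conjunct2, THEN conjunct2, THEN conjunct2]

locale algebra_modules = finite_dim_algebra scale
  for scale :: "'k::alg_closed_field \<Rightarrow> 'a::{ring, monoid_mult} \<Rightarrow> 'a" +
  fixes emb :: "'k \<Rightarrow> 'm"
  assumes inj_emb: "inj emb"
begin

text \<open>An element is named by the coefficients of one chosen expansion in a finite spanning
  family, coded as a scalar and sent to \<open>'m\<close> by \<open>emb\<close>. Equal names give
  equal coefficients, hence equal elements.\<close>

lemma ex_copy:
  fixes M :: "('a, 'n) module"
  assumes M: "M \<in> fgmod"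
  obtains M' :: "('a, 'm) module" and j
  where "M' \<in> fgmod" "j \<in> mod_epi M M'" "inj_on j (carrier M)"
proof -
  note lM = fgmodD(1)[OF M]
  obtain m where m: "\<And>i. i < kdim M \<Longrightarrow> m i \<in> carrier M" "carrier M \<subseteq> range (lincomb M m (kdim M))"
    using fgmodD(2)[OF M] unfolding kspanned_def by blast
  obtain c :: "(nat \<Rightarrow> 'k) \<Rightarrow> 'k" where c: "\<And>v w. c v = c w \<Longrightarrow> \<forall>i<kdim M. v i = w i"
    using ex_tuple_code[OF infinite_alg_closed_field] by blast
  define s where "s x = (SOME v. lincomb M m (kdim M) v = x)" for x
  have s: "lincomb M m (kdim M) (s x) = x" if x: "x \<in> carrier M" for x
  proof -
    obtain v where "lincomb M m (kdim M) v = x" using m(2) x by blast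
    then show ?thesis unfolding s_def by (rule someI[of "\<lambda>v. lincomb M m (kdim M) v = x"])
  qed
  define j where "j x = emb (c (s x))" for x
  have inj: "inj_on j (carrier M)"
  proof (rule inj_onI)
    fix x y assume xy: "x \<in> carrier M" "y \<in> carrier M" "j x = j y"
    then have "c (s x) = c (s y)" using inj_emb by (simp add: j_def inj_eq)
    then have "lincomb M m (kdim M) (s x) = lincomb M m (kdim M) (s y)"
      using c by (intro lincomb_cong) auto
    then show "x = y" using s xy by metis
  qed
  have ac: "j (x \<oplus>\<^bsub>M\<^esub> y) = j (x' \<oplus>\<^bsub>M\<^esub> y')"
    if "x \<in> carrier M" "y \<in> carrier M" "x' \<in> carrier M" "y' \<in> carrier M" "j x = j x'" "j y = j y'"
      for x y x' y'
    using inj_onD[OF inj that(5)] inj_onD[OF inj that(6)] that by simp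
  have sc: "j (a \<odot>\<^bsub>M\<^esub> x) = j (a \<odot>\<^bsub>M\<^esub> x')" if "x \<in> carrier M" "x' \<in> carrier M" "j x = j x'" for a x x'
    using inj_onD[OF inj that(3)] that by simp
  note I = image_module[OF lM, of j, OF ac sc]
  show ?thesis using that[OF fgmod_epi(1)[OF M I(1,2)] I(2) inj] by blast
qed

lemma ex_product:
  fixes X Y :: "('a, 'm) module"
  assumes X: "X \<in> fgmod" and Y: "Y \<in> fgmod"
  obtains P :: "('a, 'm) module" and p1 p2
  where "is_product X Y P p1 p2"
proof -
  interpret X: left_module X using X by (rule fgmodD)
  interpret Y: left_module Y using Y by (rule fgmodD)
  define D :: "('a, 'm \<times> 'm) module"
    where "D = \<lparr>carrier = carrier X \<times> carrier Y, monoid.mult = undefined, one = undefined,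
    zero = (\<zero>\<^bsub>X\<^esub>, \<zero>\<^bsub>Y\<^esub>), add = (\<lambda>z w. (fst z \<oplus>\<^bsub>X\<^esub> fst w, snd z \<oplus>\<^bsub>Y\<^esub> snd w)),
    module.smult = (\<lambda>a z. (a \<odot>\<^bsub>X\<^esub> fst z, a \<odot>\<^bsub>Y\<^esub> snd z))\<rparr>"
  have D: "carrier D = carrier X \<times> carrier Y" "\<zero>\<^bsub>D\<^esub> = (\<zero>\<^bsub>X\<^esub>, \<zero>\<^bsub>Y\<^esub>)"
    "z \<oplus>\<^bsub>D\<^esub> w = (fst z \<oplus>\<^bsub>X\<^esub> fst w, snd z \<oplus>\<^bsub>Y\<^esub> snd w)" "a \<odot>\<^bsub>D\<^esub> z = (a \<odot>\<^bsub>X\<^esub> fst z, a \<odot>\<^bsub>Y\<^esub> snd z)" for z w a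
    by (simp_all add: D_def)
  have "abelian_group D"
  proof (rule abelian_groupI)
    fix z assume "z \<in> carrier D"
    then show "\<exists>w\<in>carrier D. w \<oplus>\<^bsub>D\<^esub> z = \<zero>\<^bsub>D\<^esub>"
      by (intro bexI[of _ "(\<ominus>\<^bsub>X\<^esub> fst z, \<ominus>\<^bsub>Y\<^esub> snd z)"]) (auto simp: D X.l_neg Y.l_neg)
  qed (auto simp: D X.a_ac Y.a_ac)
  then interpret D: left_module D
    unfolding left_module_def left_module_axioms_def
    by (auto simp: D X.smult_closed Y.smult_closed X.smult_l_distr Y.smult_l_distr X.smult_r_distr
        Y.smult_r_distr
        X.smult_assoc Y.smult_assoc X.smult_one Y.smult_one)
  have lD: "left_module D" by unfold_locales
  have fst: "fst \<in> mod_hom D X" and snd: "snd \<in> mod_hom D Y" by (auto intro!: mod_homI simp: D)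
  have in1: "(\<lambda>x. (x, \<zero>\<^bsub>Y\<^esub>)) \<in> mod_hom X D" and in2: "(\<lambda>y. (\<zero>\<^bsub>X\<^esub>, y)) \<in> mod_hom Y D"
    by (auto intro!: mod_homI simp: D X.smult_r_null Y.smult_r_null)
  obtain S where S: "finite S" "S \<subseteq> carrier X" "\<And>N. \<lbrakk>left_submodule N X; S \<subseteq> N\<rbrakk> \<Longrightarrow> N = carrier X"
    using X by (auto simp: fgmod_def finitely_generated_def)
  obtain S' where S': "finite S'" "S' \<subseteq> carrier Y"
    "\<And>N. \<lbrakk>left_submodule N Y; S' \<subseteq> N\<rbrakk> \<Longrightarrow> N = carrier Y"
    using Y by (auto simp: fgmod_def finitely_generated_def)
  have "finitely_generated D"
    unfolding finitely_generated_def
  proof (intro exI[of _ "(\<lambda>x. (x, \<zero>\<^bsub>Y\<^esub>)) ` S \<union> (\<lambda>y. (\<zero>\<^bsub>X\<^esub>, y)) ` S'"] conjI allI impI)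
    fix N assume N: "left_submodule N D \<and> (\<lambda>x. (x, \<zero>\<^bsub>Y\<^esub>)) ` S \<union> (\<lambda>y. (\<zero>\<^bsub>X\<^esub>, y)) ` S' \<subseteq> N"
    have 1: "{x \<in> carrier X. (x, \<zero>\<^bsub>Y\<^esub>) \<in> N} = carrier X"
      using N S(2) left_submodule_vimage[OF X.left_module_axioms lD in1] by (intro S(3)) auto
    have 2: "{y \<in> carrier Y. (\<zero>\<^bsub>X\<^esub>, y) \<in> N} = carrier Y"
      using N S'(2) left_submodule_vimage[OF Y.left_module_axioms lD in2] by (intro S'(3)) auto
    show "N = carrier D"
    proof
      show "N \<subseteq> carrier D" using N by (simp add: D.left_submodule_iff)
      show "carrier D \<subseteq> N"
      proof
        fix z assume z: "z \<in> carrier D"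
        then have "(fst z, \<zero>\<^bsub>Y\<^esub>) \<in> N" "(\<zero>\<^bsub>X\<^esub>, snd z) \<in> N" using 1 2 by (auto simp: D)
        then have "(fst z, \<zero>\<^bsub>Y\<^esub>) \<oplus>\<^bsub>D\<^esub> (\<zero>\<^bsub>X\<^esub>, snd z) \<in> N" using N by (simp add: D.left_submodule_iff)
        then show "z \<in> N" using z by (auto simp: D)
      qed
    qed
  qed (use S S' in \<open>auto simp: D\<close>)
  then have "D \<in> fgmod" using lD by (simp add: fgmod_def)
  then obtain P :: "('a, 'm) module" and j where P: "P \<in> fgmod" "j \<in> mod_epi D P"
    "inj_on j (carrier D)"
    by (rule ex_copy)
  have "mod_iso D P" using P by (auto simp: mod_iso_def mod_epi_def bij_betw_def)
  then have "mod_iso P D" by (rule mod_iso_sym[OF lD])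
  then obtain k where k: "k \<in> mod_hom P D" "bij_betw k (carrier P) (carrier D)"
    by (auto simp: mod_iso_def)
  show ?thesis
  proof (rule that[of P "\<lambda>z. fst (k z)" "\<lambda>z. snd (k z)"], unfold is_product_def,
      intro conjI ballI impI P(1) mod_hom_comp[OF k(1) fst] mod_hom_comp[OF k(1) snd])
    fix x y assume "x \<in> carrier X" "y \<in> carrier Y"
    then have "(x, y) \<in> k ` carrier P" using k(2) by (simp add: bij_betw_def D)
    then obtain z where "z \<in> carrier P" "(x, y) = k z" by blast
    then show "\<exists>z\<in>carrier P. fst (k z) = x \<and> snd (k z) = y" by (intro bexI[of _ z]) (auto dest: sym)
  next
    fix z z' assume "z \<in> carrier P" "z' \<in> carrier P" "fst (k z) = fst (k z')"
      "snd (k z) = snd (k z')"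
    then show "z = z'" using k(2) by (auto simp: bij_betw_def inj_on_def prod_eq_iff)
  qed
qed

text \<open>\<open>R\<close> is a copy of the algebra acting on itself by left multiplication, and
  \<open>u\<close> is the copy of \<open>1\<close>. The map sending \<open>u\<close> to
  \<open>x\<close> lets the algebra act on \<open>x\<close>.\<close>

lemma ex_regular:
  obtains R :: "('a, 'm) module" and u where "R \<in> fgmod" "u \<in> carrier R"
    "\<forall>(M :: ('a, 'm) module) x. left_module M \<longrightarrow> x \<in> carrier M \<longrightarrow> (\<exists>h\<in>mod_hom R M. h u = x)"
proof -
  define A :: "('a, 'a) module"
    where "A = \<lparr>carrier = UNIV, monoid.mult = undefined, one = undefined,
    zero = 0, add = (+), module.smult = (*)\<rparr>"
  have A: "carrier A = UNIV" "\<zero>\<^bsub>A\<^esub> = 0" "x \<oplus>\<^bsub>A\<^esub> y = x + y" "a \<odot>\<^bsub>A\<^esub> x = a * x" for x y a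
    by (simp_all add: A_def)
  have "abelian_group A"
    by (rule abelian_groupI) (auto simp: A algebra_simps intro: exI[of _ "- _"])
  then interpret A: left_module A
    unfolding left_module_def left_module_axioms_def by (auto simp: A algebra_simps)
  have lA: "left_module A" by unfold_locales
  have "finitely_generated A"
    unfolding finitely_generated_def
  proof (intro exI[of _ "{1}"] conjI allI impI)
    fix N assume "left_submodule N A \<and> {1} \<subseteq> N"
    then have "a \<odot>\<^bsub>A\<^esub> 1 \<in> N" for a by (simp add: A.left_submodule_iff)
    then show "N = carrier A" by (auto simp: A)
  qed (auto simp: A)
  then have fA: "A \<in> fgmod" using lA by (simp add: fgmod_def)
  obtain R :: "('a, 'm) module" and j where R: "R \<in> fgmod" "j \<in> mod_epi A R" "inj_on j (carrier A)"
    using fA by (rule ex_copy)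
  have "mod_iso A R" using R by (auto simp: mod_iso_def mod_epi_def bij_betw_def)
  then have "mod_iso R A" by (rule mod_iso_sym[OF lA])
  then obtain k where k: "k \<in> mod_hom R A" "bij_betw k (carrier R) (carrier A)"
    by (auto simp: mod_iso_def)
  have "1 \<in> k ` carrier R" using k(2) by (simp add: bij_betw_def A)
  then obtain u where u: "u \<in> carrier R" "k u = 1" by force
  show ?thesis
  proof (rule that[OF R(1) u(1)]; intro allI impI)
    fix M :: "('a, 'm) module" and x assume M: "left_module M" "x \<in> carrier M"
    interpret left_module M by fact
    have "(\<lambda>a. a \<odot>\<^bsub>M\<^esub> x) \<in> mod_hom A M"
      using M(2) by (auto intro!: mod_homI simp: A smult_closed smult_l_distr smult_assoc)
    then have "(\<lambda>r. k r \<odot>\<^bsub>M\<^esub> x) \<in> mod_hom R M" by (rule mod_hom_comp[OF k(1)])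
    then show "\<exists>h\<in>mod_hom R M. h u = x" using u M(2) by (intro bexI) (simp_all add: smult_one)
  qed
qed

end

lemma mod_hom_to_product:
  assumes E: "left_module E" and P: "is_product X Y P p1 p2"
    and f: "f \<in> mod_hom E X" and g: "g \<in> mod_hom E Y"
  shows "\<exists>h\<in>mod_hom E P. \<forall>e\<in>carrier E. p1 (h e) = f e \<and> p2 (h e) = g e"
proof -
  interpret E: left_module E by fact
  note P = is_productD[OF P]
  interpret P: left_module P using P(1) by (simp add: fgmod_def)
  define h where "h e = (SOME z. z \<in> carrier P \<and> p1 z = f e \<and> p2 z = g e)" for e
  have h: "h e \<in> carrier P \<and> p1 (h e) = f e \<and> p2 (h e) = g e" if e: "e \<in> carrier E" for e
  proof -
    obtain z where "z \<in> carrier P \<and> p1 z = f e \<and> p2 z = g e"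
      using P(4) mod_hom_closed[OF f e] mod_hom_closed[OF g e] by blast
    then show ?thesis unfolding h_def by (rule someI)
  qed
  have heq: "h e = z" if "e \<in> carrier E" "z \<in> carrier P" "p1 z = f e" "p2 z = g e" for e z
    by (rule P(5)[rule_format, OF _ that(2)]) (use h[OF that(1)] that(3,4) in simp_all)
  have "h \<in> mod_hom E P"
    unfolding mod_hom_def
  proof (intro CollectI conjI ballI allI Pi_I)
    fix x y assume xy: "x \<in> carrier E" "y \<in> carrier E"
    show "h (x \<oplus>\<^bsub>E\<^esub> y) = h x \<oplus>\<^bsub>P\<^esub> h y"
      using h[OF xy(1)] h[OF xy(2)] xy
      by (intro heq) (simp_all add: mod_hom_add[OF f] mod_hom_add[OF g] mod_hom_add[OF P(2)]
          mod_hom_add[OF P(3)])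
  next
    fix a x assume x: "x \<in> carrier E"
    show "h (a \<odot>\<^bsub>E\<^esub> x) = a \<odot>\<^bsub>P\<^esub> h x"
      using h[OF x] x
      by (intro heq) (simp_all add: mod_hom_smult[OF f] mod_hom_smult[OF g] mod_hom_smult[OF P(2)]
          mod_hom_smult[OF P(3)]
          E.smult_closed P.smult_closed)
  qed (use h in simp)
  then show ?thesis by (rule bexI[rotated]) (use h in \<open>simp\<close>)
qed

context finite_dim_algebra
begin

text \<open>The linear span of \<open>F\<close>, closed in addition under \<open>eq_on\<close>
  because homomorphisms count only on the carrier of their domain. The inductive form lets a
  factorization property be extended from \<open>F\<close> to the whole span.\<close>

inductive_set hom_span ::
    "('a, 'n) module \<Rightarrow> ('a, 'm) module \<Rightarrow> ('n \<Rightarrow> 'm) set \<Rightarrow> ('n \<Rightarrow> 'm) set"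
  for B X F where
  base: "f \<in> F \<Longrightarrow> f \<in> hom_span B X F"
| zero: "(\<lambda>x. \<zero>\<^bsub>X\<^esub>) \<in> hom_span B X F"
| add: "\<lbrakk>f \<in> hom_span B X F; g \<in> hom_span B X F\<rbrakk> \<Longrightarrow> (\<lambda>x. f x \<oplus>\<^bsub>X\<^esub> g x) \<in> hom_span B X F"
| scale: "f \<in> hom_span B X F \<Longrightarrow> (\<lambda>x. kscale X c (f x)) \<in> hom_span B X F"
| eq_on: "\<lbrakk>f \<in> hom_span B X F; \<And>x. x \<in> carrier B \<Longrightarrow> f x = g x\<rbrakk> \<Longrightarrow> g \<in> hom_span B X F"

text \<open>A homomorphism is determined by its values on a spanning family of \<open>B\<close>, and
  these are recorded in a matrix of coefficients over a spanning family of \<open>X\<close>. The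
  matrices that occur lie in a space of finite dimension, so finitely many of them span the
  rest.\<close>

lemma mod_hom_finitely_spanned:
  assumes B: "B \<in> fgmod" and X: "X \<in> fgmod"
  obtains F where "finite F" "F \<subseteq> mod_hom B X"
    "mod_hom B X \<subseteq> hom_span B X F"
proof -
  note lB = fgmodD(1)[OF B] and lX = fgmodD(1)[OF X]
  interpret X: left_module X by (fact lX)
  define r where "r = kdim B"
  obtain m where m: "\<And>i. i < r \<Longrightarrow> m i \<in> carrier B" "carrier B \<subseteq> range (lincomb B m r)"
    using fgmodD(2)[OF B] unfolding kspanned_def r_def by blast
  define n where "n = kdim X"
  obtain y where y: "\<And>i. i < n \<Longrightarrow> y i \<in> carrier X" "carrier X \<subseteq> range (lincomb X y n)"
    using fgmodD(2)[OF X] unfolding kspanned_def n_def by blast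
  define L where "L = lincomb X y n"
  have L: "klinear L X" unfolding L_def using y(1) by (rule klinear_lincomb[OF lX])
  define row where "row w i = (\<lambda>j. w (i, j))" for w :: "nat \<times> nat \<Rightarrow> 'k" and i
  have row: "row (v + w) i = row v i + row w i" "row (fscale c v) i = fscale c (row v i)"
    for v w c i
    by (auto simp: row_def fun_eq_iff fun_apply_simps)
  \<comment> \<open>A relation suffices: a matrix fixes at most one homomorphism on
    \<open>carrier B\<close>, and every homomorphism has some matrix.\<close>
  define rep where "rep w h \<longleftrightarrow> h \<in> mod_hom B X \<and> (\<forall>i<r. h (m i) = L (row w i))" for w h
  define U where "U = {w. (\<forall>p. p \<notin> {..<r} \<times> {..<n} \<longrightarrow> w p = 0) \<and> (\<exists>h. rep w h)}"
  have "finite (funit ` ({..<r} \<times> {..<n}))" by simp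
  moreover have "U \<subseteq> fvs.span (funit ` ({..<r} \<times> {..<n}))"
    by (rule subsetI, rule in_span_funit) (auto simp: U_def)
  ultimately obtain G where G: "G \<subseteq> U" "finite G" "U \<subseteq> fvs.span G"
    by (rule fvs_finite_basis)
  define hh where "hh w = (SOME h. rep w h)" for w
  have hh: "rep w (hh w)" if "w \<in> U" for w using that unfolding hh_def U_def
    by (auto simp: some_eq_ex)
  have rep_ex: "\<exists>w\<in>U. rep w h" if h: "h \<in> mod_hom B X" for h
  proof -
    have "\<forall>i<r. \<exists>v. h (m i) = L v" using y(2) mod_hom_closed[OF h m(1)] unfolding L_def by blast
    then obtain V where V: "\<And>i. i < r \<Longrightarrow> h (m i) = L (V i)" by metis
    define w where "w p = (if p \<in> {..<r} \<times> {..<n} then V (fst p) (snd p) else 0)" for p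
    have "L (V i) = L (row w i)" if "i < r" for i
      unfolding L_def using that by (intro lincomb_cong) (auto simp: row_def w_def)
    then have "rep w h" using V h by (simp add: rep_def)
    then show ?thesis by (intro bexI[of _ w]) (auto simp: U_def w_def)
  qed
  have rep_eq: "h x = h' x" if "rep w h" "rep w h'" "x \<in> carrier B" for w h h' x
  proof -
    note hw = that(1,2)
    obtain v where v: "x = lincomb B m r v" using m(2) \<open>x \<in> carrier B\<close> by blast
    have "lincomb X (\<lambda>i. h (m i)) r v = lincomb X (\<lambda>i. h' (m i)) r v"
      using hw by (intro lincomb_cong) (auto simp: rep_def)
    moreover have "h x = lincomb X (\<lambda>i. h (m i)) r v" "h' x = lincomb X (\<lambda>i. h' (m i)) r v"
      unfolding v using hw by (auto simp: rep_def intro!: mod_hom_lincomb[OF lB lX _ m(1)])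
    ultimately show ?thesis by simp
  qed
  show ?thesis
  proof (rule that[of "hh ` G"])
    show "finite (hh ` G)" using G by simp
    show "hh ` G \<subseteq> mod_hom B X" using G(1) hh by (auto simp: rep_def)
    have span: "\<exists>h\<in>hom_span B X (hh ` G). rep w h" if "w \<in> fvs.span G" for w
      using that
    proof (induction rule: fvs.span_induct_alt)
      case base
      have "L 0 = \<zero>\<^bsub>X\<^esub>" by (rule klinear_zero[OF lX L])
      moreover have "row 0 i = 0" for i by (auto simp: row_def fun_eq_iff fun_apply_simps)
      ultimately have "rep 0 (\<lambda>x. \<zero>\<^bsub>X\<^esub>)" by (simp add: rep_def mod_hom_null[OF lX])
      then show ?case using hom_span.zero by blast
    next
      case (step c v w)
      then obtain h where h: "rep w h" "h \<in> hom_span B X (hh ` G)" by blast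
      have g: "rep v (hh v)" "hh v \<in> hom_span B X (hh ` G)"
        using hh step(1) G(1) by (auto intro: hom_span.base)
      have kg: "(\<lambda>x. kscale X c (hh v x)) \<in> mod_hom B X"
        using g(1) by (auto simp: rep_def intro: kscale_mod_hom[OF lX])
      have "rep (fscale c v + w) (\<lambda>x. kscale X c (hh v x) \<oplus>\<^bsub>X\<^esub> h x)"
        using kg g(1) h(1) L mod_hom_sum[OF lX kg, of h] by (simp add: rep_def row klinear_def)
      then show ?case by (rule bexI[OF _ hom_span.add[OF hom_span.scale[OF g(2)] h(2)]])
    qed
    show "mod_hom B X \<subseteq> hom_span B X (hh ` G)"
    proof
      fix f assume f: "f \<in> mod_hom B X"
      obtain w where w: "w \<in> U" "rep w f" using rep_ex[OF f] by blast
      obtain h where h: "h \<in> hom_span B X (hh ` G)" "rep w h" using span w(1) G(3) by blast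
      show "f \<in> hom_span B X (hh ` G)" by (rule hom_span.eq_on[OF h(1) rep_eq[OF h(2) w(2)]])
    qed
  qed
qed

end

section \<open>Subcategories\<close>

lemma closed_under_extensions_sub:
  assumes C: "closed_under_extensions C" and Y: "Y \<in> fgmod" and N: "left_submodule N Y"
    "submod Y N \<in> C"
    and p: "p \<in> mod_epi Y Z" "a_kernel Y Z p = N" and Z: "Z \<in> C"
  shows "Y \<in> C"
proof -
  interpret left_module Y using Y by (simp add: fgmod_def)
  have "N \<subseteq> carrier Y" using N(1) by (simp add: left_submodule_iff)
  then have "short_exact (submod Y N) (\<lambda>x. x) Y p Z"
    using p mod_hom_sub_dom[OF mod_hom_id, of N Y] by (simp add: short_exact_def)
  then show ?thesis using C Y N(2) Z unfolding closed_under_extensions_def by blast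
qed

context algebra_modules
begin

text \<open>Invariance under isomorphism allows the left term of a short exact sequence to be
  replaced by its image, so only submodules and their quotients have to be treated.\<close>

lemma closed_under_extensionsI:
  fixes C :: "('a, 'm) module set"
  assumes C: "subcategory C"
    and ext: "\<And>Y N p Z. \<lbrakk>Y \<in> fgmod; left_submodule N Y; submod Y N \<in> C; p \<in> mod_epi Y Z; a_kernel Y Z p = N; Z \<in> C\<rbrakk> \<Longrightarrow> Y \<in> C"
  shows "closed_under_extensions C"
  unfolding closed_under_extensions_def
proof (intro ballI allI impI)
  fix X Z Y f g assume XZ: "X \<in> C" "Z \<in> C" "Y \<in> fgmod" "short_exact X f Y g Z"
  then have fg: "X \<in> fgmod" "Z \<in> fgmod" using C by (auto simp: subcategory_def)
  have lm: "left_module X" "left_module Y" "left_module Z" using fg XZ by (auto simp: fgmod_def)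
  have se: "f \<in> mod_hom X Y" "inj_on f (carrier X)" "g \<in> mod_epi Y Z"
    "f ` carrier X = a_kernel Y Z g"
    using XZ(4) by (auto simp: short_exact_def)
  have N: "left_submodule (a_kernel Y Z g) Y" using lm se by (intro left_submodule_kernel mod_epiD)
  have "f \<in> mod_hom X (submod Y (a_kernel Y Z g))" using se by (intro mod_hom_sub_cod) auto
  then have "mod_iso X (submod Y (a_kernel Y Z g))"
    using se by (auto simp: mod_iso_def bij_betw_def)
  then have "submod Y (a_kernel Y Z g) \<in> C" using C XZ(1) fgmod_sub(1)[OF XZ(3) N]
    by (auto simp: subcategory_def)
  then show "Y \<in> C" using ext[OF XZ(3) N _ se(3) refl XZ(2)] by blast
qed

lemma subcategory_iso: "\<lbrakk>subcategory C; X \<in> C; mod_iso X Y; Y \<in> fgmod\<rbrakk> \<Longrightarrow> Y \<in> C"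
  by (auto simp: subcategory_def)

text \<open>The preimage of \<open>L\<close> is an extension of \<open>L\<close> by the kernel of
  \<open>p\<close>. This lifts a submodule of a quotient back to \<open>M\<close> without leaving
  \<open>C\<close>.\<close>

lemma extension_vimage:
  fixes C :: "('a, 'm) module set"
  assumes C: "closed_under_extensions C" and M: "M \<in> fgmod" and Q: "left_module Q"
    and p: "p \<in> mod_epi M Q"
    and K: "submod M (a_kernel M Q p) \<in> C" and L: "left_submodule L Q" "submod Q L \<in> C"
  shows "submod M {x \<in> carrier M. p x \<in> L} \<in> C"
proof -
  interpret M: left_module M using M by (rule fgmodD)
  interpret Q: left_module Q by fact
  have lM: "left_module M" by (rule M.left_module_axioms)
  have ph: "p \<in> mod_hom M Q" using p by (rule mod_epiD)
  let ?V = "{x \<in> carrier M. p x \<in> L}"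
  have V: "left_submodule ?V M" by (rule left_submodule_vimage[OF lM Q ph L(1)])
  have KV: "a_kernel M Q p \<subseteq> ?V" using L(1) by (auto simp: mem_a_kernel Q.left_submodule_iff)
  have Ks: "left_submodule (a_kernel M Q p) M" by (rule left_submodule_kernel[OF lM Q ph])
  show ?thesis
  proof (rule closed_under_extensions_sub[OF C])
    show "submod M ?V \<in> fgmod" by (rule fgmod_sub[OF M V])
    show "left_submodule (a_kernel M Q p) (submod M ?V)"
      using M.left_submodule_sub_iff[OF V] Ks KV by blast
    show "submod (submod M ?V) (a_kernel M Q p) \<in> C" using K by simp
    show "submod Q L \<in> C" by (fact L)
    have "p \<in> mod_hom (submod M ?V) (submod Q L)"
      by (intro mod_hom_sub_cod mod_hom_sub_dom[OF ph]) auto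
    moreover have "p ` ?V = L"
    proof
      show "L \<subseteq> p ` ?V"
      proof
        fix y assume y: "y \<in> L"
        then have "y \<in> carrier Q" using L(1) by (auto simp: Q.left_submodule_iff)
        then obtain x where "x \<in> carrier M" "p x = y" by (rule mod_epiE[OF p])
        then show "y \<in> p ` ?V" using y by blast
      qed
    qed auto
    ultimately show "p \<in> mod_epi (submod M ?V) (submod Q L)" by (simp add: mod_epi_def)
    show "a_kernel (submod M ?V) (submod Q L) p = a_kernel M Q p"
      using KV by (auto simp: mem_a_kernel)
  qed
qed

lemma ex_zero_module: "\<exists>Z :: ('a, 'm) module. Z \<in> fgmod \<and> carrier Z = {\<zero>\<^bsub>Z\<^esub>}"
proof -
  obtain R :: "('a, 'm) module" and u where R: "R \<in> fgmod" by (rule ex_regular)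
  then show ?thesis
    using fgmod_sub(1)[OF R left_module.left_submodule_zero[OF fgmodD(1)[OF R]]]
    by (intro exI[of _ "submod R {\<zero>\<^bsub>R\<^esub>}"]) simp
qed

lemma zero_modules_iso:
  assumes "left_module X" "left_module Y" "carrier X = {\<zero>\<^bsub>X\<^esub>}" "carrier Y = {\<zero>\<^bsub>Y\<^esub>}"
  shows "mod_iso X Y"
  unfolding mod_iso_def using assms mod_hom_null[OF assms(2), of X]
  by (intro bexI[of _ "\<lambda>x. \<zero>\<^bsub>Y\<^esub>"]) (auto simp: bij_betw_def)

section \<open>Torsion classes and torsion parts\<close>

lemma torsion_classD:
  assumes "torsion_class T"
  shows "subcategory T" "closed_under_extensions T" "X \<in> T \<Longrightarrow> X \<in> fgmod" "X \<in> T \<Longrightarrow> left_module X"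
  using assms by (auto simp: torsion_class_def subcategory_def fgmod_def)

lemma torsion_class_epi:
  fixes X Y :: "('a, 'm) module"
  assumes "torsion_class T" "X \<in> T" "left_module Y" "e \<in> mod_epi X Y"
  shows "Y \<in> T"
  using assms fgmod_epi(1)[of X Y e] torsion_classD(3)[of T X]
  by (auto simp: torsion_class_def closed_under_quotients_def)

lemma torsion_class_image:
  fixes X L :: "('a, 'm) module"
  assumes "torsion_class T" "X \<in> T" "left_module L" "f \<in> mod_hom X L"
  shows "submod L (f ` carrier X) \<in> T"
proof -
  note lX = torsion_classD(4)[OF assms(1,2)]
  have "left_submodule (f ` carrier X) L"
    by (rule left_submodule_image[OF lX assms(3,4) left_module.left_submodule_carrier[OF lX]])
  moreover have "f \<in> mod_epi X (submod L (f ` carrier X))"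
    using mod_hom_sub_cod[OF assms(4), of "f ` carrier X"] by (simp add: mod_epi_def)
  ultimately show ?thesis
    using torsion_class_epi[OF assms(1,2)] left_module.left_module_sub[OF assms(3)] by blast
qed

lemma torsion_class_zero:
  fixes Z :: "('a, 'm) module"
  assumes "torsion_class T" "left_module Z" "carrier Z = {\<zero>\<^bsub>Z\<^esub>}"
  shows "Z \<in> T"
proof -
  obtain X where X: "X \<in> T" using assms(1) by (auto simp: torsion_class_def)
  interpret left_module X using torsion_classD(4)[OF assms(1) X] .
  have "(\<lambda>x. \<zero>\<^bsub>Z\<^esub>) \<in> mod_epi X Z" using mod_hom_null[OF assms(2)] assms(3) zero_closed
    by (auto simp: mod_epi_def)
  then show ?thesis using torsion_class_epi[OF assms(1) X assms(2)] by blast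
qed

text \<open>Modulo \<open>N\<close> the sum becomes the image of \<open>L\<close>, which is in
  \<open>T\<close> as a quotient of \<open>submod M L\<close>. So the sum is an extension of an
  object of \<open>T\<close> by \<open>submod M N\<close>.\<close>

lemma torsion_class_sum:
  fixes M :: "('a, 'm) module"
  assumes T: "torsion_class T" and M: "M \<in> fgmod"
    and N: "left_submodule N M" "submod M N \<in> T" and L: "left_submodule L M" "submod M L \<in> T"
  shows "submod M {x \<oplus>\<^bsub>M\<^esub> y |x y. x \<in> N \<and> y \<in> L} \<in> T"
proof -
  interpret M: left_module M using M by (rule fgmodD)
  have lM: "left_module M" by (rule M.left_module_axioms)
  obtain Q :: "('a, 'm) module" and p where Q: "Q \<in> fgmod" "p \<in> mod_epi M Q" "a_kernel M Q p = N"
    by (rule ex_fgmod_quotient[OF M N(1)])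
  note lQ = fgmodD(1)[OF Q(1)] and ph = mod_epiD(1)[OF Q(2)]
  interpret Q: left_module Q by (fact lQ)
  have Lc: "L \<subseteq> carrier M" and Nc: "N \<subseteq> carrier M" using L(1) N(1)
    by (auto simp: M.left_submodule_iff)
  have "p \<in> mod_hom (submod M L) Q" by (rule mod_hom_sub_dom[OF ph Lc])
  then have "submod Q (p ` L) \<in> T" using torsion_class_image[OF T L(2) lQ] by simp
  moreover have "left_submodule (p ` L) Q" by (rule left_submodule_image[OF lM lQ ph L(1)])
  ultimately have "submod M {x \<in> carrier M. p x \<in> p ` L} \<in> T"
    using extension_vimage[OF torsion_classD(2)[OF T] M lQ Q(2)] N(2) Q(3) by simp
  moreover have "{x \<in> carrier M. p x \<in> p ` L} = {x \<oplus>\<^bsub>M\<^esub> y |x y. x \<in> N \<and> y \<in> L}"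
  proof (intro equalityI subsetI)
    fix x assume "x \<in> {x \<in> carrier M. p x \<in> p ` L}"
    then obtain y where y: "x \<in> carrier M" "y \<in> L" "p x = p y" by auto
    then have yc: "y \<in> carrier M" using Lc by blast
    have "x \<ominus>\<^bsub>M\<^esub> y \<in> N" using mod_hom_eqI_ker[OF lM lQ ph y(1) yc] y(3) Q(3) by blast
    moreover have "x = (x \<ominus>\<^bsub>M\<^esub> y) \<oplus>\<^bsub>M\<^esub> y" using y(1) yc M.add_minus_cancel[of x y]
      by (simp add: M.a_comm)
    ultimately show "x \<in> {x \<oplus>\<^bsub>M\<^esub> y |x y. x \<in> N \<and> y \<in> L}" using y(2) by blast
  next
    fix z assume "z \<in> {x \<oplus>\<^bsub>M\<^esub> y |x y. x \<in> N \<and> y \<in> L}"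
    then obtain x y where *: "z = x \<oplus>\<^bsub>M\<^esub> y" "x \<in> N" "y \<in> L" by auto
    then have c: "x \<in> carrier M" "y \<in> carrier M" "p x = \<zero>\<^bsub>Q\<^esub>" using Lc Nc Q(3)
      by (auto simp: mem_a_kernel)
    then have "p z = p y" using * mod_hom_closed[OF ph] by (simp add: mod_hom_add[OF ph])
    then show "z \<in> {x \<in> carrier M. p x \<in> p ` L}" using * c by auto
  qed
  ultimately show ?thesis by simp
qed

text \<open>A submodule in \<open>T\<close> of largest dimension absorbs every other one, because
  their sum is again in \<open>T\<close> and cannot have larger dimension.\<close>

lemma ex_torsion_part:
  fixes M :: "('a, 'm) module"
  assumes T: "torsion_class T" and M: "M \<in> fgmod"
  obtains N where "left_submodule N M" "submod M N \<in> T"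
    "\<forall>L. left_submodule L M \<longrightarrow> submod M L \<in> T \<longrightarrow> L \<subseteq> N"
proof -
  interpret M: left_module M using M by (rule fgmodD)
  let ?P = "\<lambda>N. left_submodule N M \<and> submod M N \<in> T"
  have z: "?P {\<zero>\<^bsub>M\<^esub>}"
    using torsion_class_zero[OF T M.left_module_sub] M.left_submodule_zero by simp
  have bd: "kdim (submod M N) \<le> kdim M" if "left_submodule N M" for N
    using fgmod_sub(2)[OF M that] by (cases "N = carrier M") auto
  have "\<exists>N. ?P N \<and> (\<forall>L. ?P L \<longrightarrow> kdim (submod M L) \<le> kdim (submod M N))"
    using bd by (intro ex_has_greatest_nat[of ?P, OF z, of _ "Suc (kdim M)"]) (auto simp:
        less_Suc_eq_le)
  then obtain N where N: "?P N" "\<forall>L. ?P L \<longrightarrow> kdim (submod M L) \<le> kdim (submod M N)"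
    by (elim exE conjE) simp
  show ?thesis
  proof (rule that; (intro allI impI)?)
    show "left_submodule N M" "submod M N \<in> T" using N(1) by auto
  next
    fix L assume L: "left_submodule L M" "submod M L \<in> T"
    let ?S = "{x \<oplus>\<^bsub>M\<^esub> y |x y. x \<in> N \<and> y \<in> L}"
    have S: "left_submodule ?S M" "N \<subseteq> ?S" "L \<subseteq> ?S" using M.submodule_sum[of N L] N(1) L(1) by auto
    have "?P ?S" using S(1) torsion_class_sum[OF T M] N(1) L by auto
    then have le: "kdim (submod M ?S) \<le> kdim (submod M N)" by (rule N(2)[rule_format])
    have "left_submodule N (submod M ?S)" using M.left_submodule_sub_iff[OF S(1)] N(1) S(2) by blast
    then have "N = ?S" using fgmod_sub(2)[OF fgmod_sub(1)[OF M S(1)], of N] le by fastforce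
    then show "L \<subseteq> N" using S(3) by blast
  qed
qed

end

section \<open>Filtrations and generation\<close>

text \<open>Filtrations in inductive form, with the last factor \<open>Q\<close> on top of a shorter
  filtration of \<open>N\<close>. Statements about \<open>filt\<close> can then be proved by rule
  induction instead of by handling indexed chains.\<close>

inductive_set filtered :: "('a::{ring, monoid_mult}, 'm) module set \<Rightarrow> ('a, 'm) module set"
  for C where
  zero: "\<lbrakk>X \<in> fgmod; carrier X = {\<zero>\<^bsub>X\<^esub>}\<rbrakk> \<Longrightarrow> X \<in> filtered C"
| extend: "\<lbrakk>X \<in> fgmod; left_submodule N X; submod X N \<in> filtered C;
    p \<in> mod_epi X Q; a_kernel X Q p = N; Q \<in> C\<rbrakk> \<Longrightarrow> X \<in> filtered C"

context algebra_modules
begin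

lemma filt_eq_filtered: "filt C = filtered C" for C :: "('a, 'm) module set"
proof (intro equalityI subsetI)
  fix X assume "X \<in> filt C"
  then obtain n F where X: "X \<in> fgmod" and F: "\<forall>i\<le>n. left_submodule (F i) X" "F 0 = {\<zero>\<^bsub>X\<^esub>}"
    "F n = carrier X"
    "\<forall>i<n. F i \<subseteq> F (Suc i) \<and> (\<exists>Q\<in>C. \<exists>p\<in>mod_epi (submod X (F (Suc i))) Q.
              a_kernel (submod X (F (Suc i))) Q p = F i)"
    unfolding filt_def by blast
  then show "X \<in> filtered C"
  proof (induction n arbitrary: X)
    case 0
    then show ?case by (intro filtered.zero) auto
  next
    case (Suc n)
    interpret X: left_module X using Suc.prems(1) by (rule fgmodD)
    have sm: "left_submodule (F n) X" using Suc.prems(2) by simp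
    have mono: "F i \<subseteq> F n" if "i \<le> n" for i
      using that
    proof (induction rule: inc_induct)
      case (step j)
      then show ?case using Suc.prems(5) by (meson less_SucI order_trans)
    qed simp
    obtain Q p where Q: "Q \<in> C" "p \<in> mod_epi (submod X (F (Suc n))) Q"
      "a_kernel (submod X (F (Suc n))) Q p = F n"
      using Suc.prems(5) by blast
    have "submod X (F n) \<in> filtered C"
    proof (rule Suc.IH)
      show "submod X (F n) \<in> fgmod" by (rule fgmod_sub(1)[OF Suc.prems(1) sm])
      show "\<forall>i\<le>n. left_submodule (F i) (submod X (F n))"
        using mono Suc.prems(2) X.left_submodule_sub_iff[OF sm] by simp
      show "F 0 = {\<zero>\<^bsub>submod X (F n)\<^esub>}" using Suc.prems(3) by simp
      show "F n = carrier (submod X (F n))" by simp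
      show "\<forall>i<n. F i \<subseteq> F (Suc i) \<and> (\<exists>Q\<in>C. \<exists>p\<in>mod_epi (submod (submod X (F n)) (F (Suc i))) Q.
              a_kernel (submod (submod X (F n)) (F (Suc i))) Q p = F i)"
        using Suc.prems(5) by simp
    qed
    then show ?case using Q Suc.prems(4)
      by (intro filtered.extend[OF Suc.prems(1) sm, of C p Q]) simp_all
  qed
next
  fix X assume "X \<in> filtered C"
  then show "X \<in> filt C"
  proof induction
    case (zero X)
    then show ?case
      using left_module.left_submodule_carrier[OF fgmodD(1)[OF zero(1)]] unfolding filt_def
      by (intro CollectI conjI exI[of _ 0] exI[of _ "\<lambda>_. carrier X"]) auto
  next
    case (extend X N p Q)
    interpret X: left_module X using extend by (intro fgmodD)
    obtain n F where F: "\<forall>i\<le>n. left_submodule (F i) (submod X N)" "F 0 = {\<zero>\<^bsub>X\<^esub>}" "F n = N"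
      "\<forall>i<n. F i \<subseteq> F (Suc i) \<and> (\<exists>Q\<in>C. \<exists>p\<in>mod_epi (submod X (F (Suc i))) Q.
              a_kernel (submod X (F (Suc i))) Q p = F i)"
      using extend.IH unfolding filt_def by auto
    define F' where "F' = F(Suc n := carrier X)"
    have F': "F' (Suc n) = carrier X" "\<And>i. i \<le> n \<Longrightarrow> F' i = F i" by (auto simp: F'_def)
    show ?case unfolding filt_def
    proof (intro CollectI conjI exI[of _ "Suc n"] exI[of _ F'])
      show "\<forall>i\<le>Suc n. left_submodule (F' i) X"
        using F(1) F' X.left_submodule_carrier X.left_submodule_sub_iff[OF extend.hyps(2)]
          by (simp add: le_Suc_eq)
      show "F' 0 = {\<zero>\<^bsub>X\<^esub>}" "F' (Suc n) = carrier X" using F F' by simp_all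
      show "\<forall>i<Suc n. F' i \<subseteq> F' (Suc i) \<and> (\<exists>Q\<in>C. \<exists>p\<in>mod_epi (submod X (F' (Suc i))) Q.
              a_kernel (submod X (F' (Suc i))) Q p = F' i)"
      proof (intro allI impI)
        fix i assume i: "i < Suc n"
        show "F' i \<subseteq> F' (Suc i) \<and> (\<exists>Q\<in>C. \<exists>p\<in>mod_epi (submod X (F' (Suc i))) Q.
              a_kernel (submod X (F' (Suc i))) Q p = F' i)"
        proof (cases "i = n")
          case True
          have "N \<subseteq> carrier X" using extend.hyps(2) by (simp add: X.left_submodule_iff)
          then show ?thesis using True F' F(3) extend.hyps by auto
        next
          case False
          then have "i < n" using i by simp
          then show ?thesis using F(4) F'(2)[of i] F'(2)[of "Suc i"] by simp
        qed
      qed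
    qed (rule extend.hyps)
  qed
qed

lemma filt_fgmod: "X \<in> filt C \<Longrightarrow> X \<in> fgmod"
  by (simp add: filt_def)

text \<open>The image of a filtration filters \<open>Y\<close>: the quotient of \<open>Y\<close> by
  the image of \<open>N\<close> is an epimorphic image of \<open>Q\<close>, and so stays in
  \<open>C\<close>.\<close>

lemma filt_epi:
  fixes C :: "('a, 'm) module set"
  assumes C: "C \<subseteq> fgmod" "closed_under_quotients C"
    and X: "X \<in> filt C" and Y: "left_module Y" and e: "e \<in> mod_epi X Y"
  shows "Y \<in> filt C"
  using X Y e unfolding filt_eq_filtered
proof (induction arbitrary: Y)
  case (zero X)
  have "carrier Y = {e \<zero>\<^bsub>X\<^esub>}" using zero by (auto simp: mod_epi_def)
  moreover have "e \<zero>\<^bsub>X\<^esub> = \<zero>\<^bsub>Y\<^esub>"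
    using mod_hom_zero[OF fgmodD(1)[OF zero(1)] zero(3) mod_epiD(1)[OF zero(4)]] .
  ultimately show ?case using filtered.zero[OF fgmod_epi(1)[OF zero(1,3,4)]] by simp
next
  case (extend X N p Q)
  note lX = fgmodD(1)[OF extend.hyps(1)] and lY = extend.prems(1)
  have eh: "e \<in> mod_hom X Y" and ph: "p \<in> mod_hom X Q" using extend by (auto dest: mod_epiD)
  have lQ: "left_module Q" using extend.hyps(6) C by (auto simp: fgmod_def)
  have fY: "Y \<in> fgmod" by (rule fgmod_epi(1)[OF extend.hyps(1) extend.prems])
  have Nc: "N \<subseteq> carrier X" by (rule left_submodule_subset[OF extend.hyps(2)])
  have sm: "left_submodule (e ` N) Y" by (rule left_submodule_image[OF lX lY eh extend.hyps(2)])
  have "e \<in> mod_epi (submod X N) (submod Y (e ` N))"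
    using mod_hom_sub_cod[OF mod_hom_sub_dom[OF eh Nc], of "e ` N"] by (simp add: mod_epi_def)
  then have sub: "submod Y (e ` N) \<in> filtered C"
    by (rule extend.IH[OF left_module.left_module_sub[OF lY sm]])
  obtain Q' :: "('a, 'm) module" and q where Q': "Q' \<in> fgmod" "q \<in> mod_epi Y Q'"
    "a_kernel Y Q' q = e ` N"
    by (rule ex_fgmod_quotient[OF fY sm])
  note lQ' = fgmodD(1)[OF Q'(1)]
  have qe: "(\<lambda>x. q (e x)) \<in> mod_epi X Q'" by (rule mod_epi_comp[OF extend.prems(2) Q'(2)])
  have "q (e x) = \<zero>\<^bsub>Q'\<^esub>" if "x \<in> N" for x
    using that mem_a_kernel[of "e x" Y Q' q] unfolding Q'(3) by simp
  then have "a_kernel X Q p \<subseteq> a_kernel X Q' (\<lambda>x. q (e x))"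
    unfolding extend.hyps(5) using Nc by (simp add: mem_a_kernel subset_iff)
  then obtain h where h: "h \<in> mod_hom Q Q'" "\<forall>x\<in>carrier X. h (p x) = q (e x)"
    using mod_hom_factor[OF lX lQ lQ' extend.hyps(4) mod_epiD(1)[OF qe]] by blast
  have "h ` carrier Q = h ` p ` carrier X" using extend.hyps(4) by (simp add: mod_epi_def)
  also have "\<dots> = (\<lambda>x. q (e x)) ` carrier X" using h(2) by (simp add: image_image)
  also have "\<dots> = carrier Q'" using qe by (simp add: mod_epi_def)
  finally have "h ` carrier Q = carrier Q'" .
  then have "h \<in> mod_epi Q Q'" using h(1) by (simp add: mod_epi_def)
  then have "Q' \<in> C" using C(2) extend.hyps(6) Q'(1) unfolding closed_under_quotients_def by blast
  then show ?case by (rule filtered.extend[OF fY sm sub Q'(2,3)])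
qed

text \<open>The filtration of \<open>Z\<close> is pulled back along \<open>g\<close> and put on top
  of that of \<open>N\<close>. Removing the top factor replaces \<open>Y\<close> by the preimage of
  the smaller submodule of \<open>Z\<close>, with the same kernel \<open>N\<close>.\<close>

lemma filt_extension:
  fixes C :: "('a, 'm) module set"
  assumes "Z \<in> filt C" "\<And>Z. Z \<in> C \<Longrightarrow> left_module Z" "Y \<in> fgmod" "left_submodule N Y"
    "submod Y N \<in> filt C"
    "g \<in> mod_epi Y Z" "a_kernel Y Z g = N"
  shows "Y \<in> filt C"
  using assms(1,3-) unfolding filt_eq_filtered
proof (induction arbitrary: Y)
  case (zero Z)
  have "N = carrier Y" using zero mod_epiD[OF zero(6)] mod_hom_closed[of g Y Z]
    by (auto simp: mem_a_kernel)
  then show ?case using zero by simp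
next
  case (extend Z Z' p Q)
  note lY = fgmodD(1)[OF extend.prems(1)] and lZ = fgmodD(1)[OF extend.hyps(1)]
  interpret Y: left_module Y by (fact lY)
  have gh: "g \<in> mod_hom Y Z" using extend.prems by (auto dest: mod_epiD)
  define Y' where "Y' = {y \<in> carrier Y. g y \<in> Z'}"
  have Z': "Z' \<subseteq> carrier Z" "\<zero>\<^bsub>Z\<^esub> \<in> Z'" using extend.hyps(2)
    by (auto simp: left_module.left_submodule_iff[OF lZ])
  have sY': "left_submodule Y' Y" unfolding Y'_def
    by (rule left_submodule_vimage[OF lY lZ gh extend.hyps(2)])
  have NY': "N \<subseteq> Y'" using extend.prems(5) Z'(2) by (auto simp: Y'_def mem_a_kernel)
  have "submod Y Y' \<in> filtered C"
  proof (rule extend.IH)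
    show "submod Y Y' \<in> fgmod" by (rule fgmod_sub(1)[OF extend.prems(1) sY'])
    show "left_submodule N (submod Y Y')" using Y.left_submodule_sub_iff[OF sY'] NY' extend.prems(2)
      by blast
    show "submod (submod Y Y') N \<in> filtered C" using extend.prems(3) by simp
    have "g ` Y' = Z'"
    proof
      show "Z' \<subseteq> g ` Y'"
      proof
        fix z assume z: "z \<in> Z'"
        then have "z \<in> carrier Z" using Z' by blast
        then obtain y where "y \<in> carrier Y" "g y = z" by (rule mod_epiE[OF extend.prems(4)])
        then show "z \<in> g ` Y'" using z by (auto simp: Y'_def)
      qed
    qed (auto simp: Y'_def)
    moreover have "g \<in> mod_hom (submod Y Y') (submod Z Z')"
      by (intro mod_hom_sub_cod mod_hom_sub_dom[OF gh]) (auto simp: Y'_def)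
    ultimately show "g \<in> mod_epi (submod Y Y') (submod Z Z')" by (simp add: mod_epi_def)
    show "a_kernel (submod Y Y') (submod Z Z') g = N"
      using NY' extend.prems(5) by (auto simp: mem_a_kernel Y'_def)
  qed
  moreover have "a_kernel Y Q (\<lambda>y. p (g y)) = Y'"
    using extend.hyps(5) mod_hom_closed[OF gh] by (auto simp: Y'_def mem_a_kernel)
  ultimately show ?case
    by (intro filtered.extend[OF extend.prems(1) sY' _
      mod_epi_comp[OF extend.prems(4) extend.hyps(4)] _ extend.hyps(6)])
qed

lemma torsion_class_filt:
  fixes C :: "('a, 'm) module set"
  assumes C: "C \<subseteq> fgmod" "closed_under_quotients C"
  shows "torsion_class (filt C)"
proof -
  have lC: "left_module Z" if "Z \<in> C" for Z using that C by (auto simp: fgmod_def)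
  have sub: "subcategory (filt C)"
    unfolding subcategory_def
  proof (intro conjI ballI impI subsetI)
    show "X \<in> fgmod" if "X \<in> filt C" for X using that by (rule filt_fgmod)
    fix X Y assume XY: "X \<in> filt C" "Y \<in> (fgmod :: ('a, 'm) module set)" "mod_iso X Y"
    then obtain f where "f \<in> mod_epi X Y" by (auto elim: mod_isoE)
    then show "Y \<in> filt C" using filt_epi[OF C XY(1) fgmodD(1)[OF XY(2)]] by blast
  qed
  obtain Z :: "('a, 'm) module" where Z: "Z \<in> fgmod" "carrier Z = {\<zero>\<^bsub>Z\<^esub>}" using ex_zero_module
    by blast
  then have "Z \<in> filt C" unfolding filt_eq_filtered by (rule filtered.zero)
  moreover have "closed_under_extensions (filt C)"
    by (rule closed_under_extensionsI[OF sub]) (rule filt_extension[OF _ lC])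
  moreover have "closed_under_quotients (filt C)"
    unfolding closed_under_quotients_def using filt_epi[OF C] fgmodD(1) by blast
  ultimately show ?thesis using sub by (auto simp: torsion_class_def)
qed

lemma subset_filt:
  fixes C :: "('a, 'm) module set"
  assumes C: "C \<subseteq> fgmod"
  shows "C \<subseteq> filt C"
proof
  fix X assume X: "X \<in> C"
  then have fX: "X \<in> fgmod" using C by blast
  interpret X: left_module X using fX by (rule fgmodD)
  have "submod X {\<zero>\<^bsub>X\<^esub>} \<in> filtered C"
    using fgmod_sub(1)[OF fX X.left_submodule_zero] by (intro filtered.zero) simp_all
  moreover have "(\<lambda>x. x) \<in> mod_epi X X" by (simp add: mod_epi_def mod_hom_id)
  moreover have "a_kernel X X (\<lambda>x. x) = {\<zero>\<^bsub>X\<^esub>}" by (auto simp: mem_a_kernel)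
  ultimately show "X \<in> filt C" unfolding filt_eq_filtered
    using filtered.extend[OF fX X.left_submodule_zero _ _ _ X] by blast
qed

lemma filt_subset_torsion_class:
  fixes C T :: "('a, 'm) module set"
  assumes T: "torsion_class T" and C: "C \<subseteq> T"
  shows "filt C \<subseteq> T"
proof
  fix X assume "X \<in> filt C"
  then show "X \<in> T" unfolding filt_eq_filtered
  proof induction
    case (zero X)
    then show ?case by (intro torsion_class_zero[OF T] fgmodD(1))
  next
    case (extend X N p Q)
    then show ?case using closed_under_extensions_sub[OF torsion_classD(2)[OF T]] C by blast
  qed
qed

text \<open>Rule induction exposes the top factor of a filtration, whereas the inductions on
  dimension need a nonzero submodule at the bottom. When the part below the top factor is zero, the
  module is isomorphic to that factor.\<close>

lemma filt_bottom:
  fixes C :: "('a, 'm) module set"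
  assumes C: "subcategory C" and X: "X \<in> filt C" "carrier X \<noteq> {\<zero>\<^bsub>X\<^esub>}"
  shows "\<exists>N. left_submodule N X \<and> N \<noteq> {\<zero>\<^bsub>X\<^esub>} \<and> submod X N \<in> C"
  using X unfolding filt_eq_filtered
proof induction
  case (extend X N p Q)
  note lX = fgmodD(1)[OF extend.hyps(1)]
  interpret X: left_module X by (fact lX)
  have lQ: "left_module Q" using extend.hyps(6) C by (auto simp: subcategory_def fgmod_def)
  show ?case
  proof (cases "N = {\<zero>\<^bsub>X\<^esub>}")
    case True
    then have "mod_iso X Q" using extend.hyps by (intro mod_isoI_inj_epi[OF lX lQ, of p]) auto
    then have "X \<in> C" using mod_iso_sym[OF lX] subcategory_iso[OF C extend.hyps(6)] extend.hyps(1)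
      by blast
    then show ?thesis using X.left_submodule_carrier extend.prems
      by (intro exI[of _ "carrier X"]) simp
  next
    case False
    then obtain L where L: "left_submodule L (submod X N)" "L \<noteq> {\<zero>\<^bsub>X\<^esub>}" "submod X L \<in> C"
      using extend.IH by auto
    then show ?thesis using X.left_submodule_sub_iff[OF extend.hyps(2)] by blast
  qed
qed simp

text \<open>The kernel of \<open>p2\<close> is mapped isomorphically to \<open>X\<close> by
  \<open>p1\<close>, so the product is an extension of \<open>Y\<close> by \<open>X\<close>.\<close>

lemma extension_closed_product:
  fixes C :: "('a, 'm) module set"
  assumes C: "subcategory C" "closed_under_extensions C" and X: "X \<in> C" and Y: "Y \<in> C"
    and prod: "is_product X Y P p1 p2"
  shows "P \<in> C"
proof -
  note P = is_productD(1)[OF prod] and p1 = is_productD(2)[OF prod] and p2 = is_productD(3)[OF prod]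
    and ex = is_productD(4)[OF prod] and uniq = is_productD(5)[OF prod]
  have fX: "X \<in> fgmod" and fY: "Y \<in> fgmod" using C X Y by (auto simp: subcategory_def)
  interpret X: left_module X using fX by (rule fgmodD)
  interpret Y: left_module Y using fY by (rule fgmodD)
  interpret P: left_module P using P by (rule fgmodD)
  have lX: "left_module X" and lY: "left_module Y" and lP: "left_module P" by unfold_locales
  define K where "K = a_kernel P Y p2"
  have sK: "left_submodule K P" unfolding K_def by (rule left_submodule_kernel[OF lP lY p2])
  have Kc: "K \<subseteq> carrier P" by (rule left_submodule_subset[OF sK])
  have p1K: "p1 \<in> mod_hom (submod P K) X" by (rule mod_hom_sub_dom[OF p1 Kc])
  have "inj_on p1 K"
    using uniq Kc by (intro inj_onI) (auto simp: K_def mem_a_kernel)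
  moreover have "p1 ` K = carrier X"
  proof
    show "carrier X \<subseteq> p1 ` K"
    proof
      fix x assume "x \<in> carrier X"
      then obtain z where "z \<in> carrier P" "p1 z = x" "p2 z = \<zero>\<^bsub>Y\<^esub>" using ex Y.zero_closed by blast
      then show "x \<in> p1 ` K" by (auto simp: K_def mem_a_kernel)
    qed
  qed (use mod_hom_closed[OF p1] Kc in blast)
  ultimately have "mod_iso (submod P K) X" using p1K by (auto simp: mod_iso_def bij_betw_def)
  then have "mod_iso X (submod P K)" by (rule mod_iso_sym[OF P.left_module_sub[OF sK]])
  then have KC: "submod P K \<in> C" by (rule subcategory_iso[OF C(1) X _ fgmod_sub(1)[OF P sK]])
  have "p2 ` carrier P = carrier Y"
  proof
    show "carrier Y \<subseteq> p2 ` carrier P"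
    proof
      fix y assume "y \<in> carrier Y"
      then obtain z where "z \<in> carrier P" "p2 z = y" using ex X.zero_closed by blast
      then show "y \<in> p2 ` carrier P" by blast
    qed
  qed (use mod_hom_closed[OF p2] in blast)
  then have "p2 \<in> mod_epi P Y" using p2 by (simp add: mod_epi_def)
  then show ?thesis using closed_under_extensions_sub[OF C(2) P sK KC _ K_def[symmetric] Y] by blast
qed

section \<open>Wide subcategories and the modules they generate\<close>

lemma wideD:
  assumes "wide C"
  shows "subcategory C" "closed_under_kernels C" "closed_under_cokernels C"
    "closed_under_extensions C"
    "X \<in> C \<Longrightarrow> X \<in> fgmod"
  using assms by (auto simp: wide_def subcategory_def)

lemma wide_kernel:
  "\<lbrakk>wide W; X \<in> W; Y \<in> W; f \<in> mod_hom X Y\<rbrakk> \<Longrightarrow> submod X (a_kernel X Y f) \<in> W"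
  by (auto simp: wide_def closed_under_kernels_def ker_module_def)

lemma wide_cokernel:
  assumes "wide W" "X \<in> W" "Y \<in> W" "f \<in> mod_hom X Y" "Z \<in> fgmod" "g \<in> mod_epi Y Z"
    and "a_kernel Y Z g = f ` carrier X"
  shows "Z \<in> W"
  by (rule wideD(3)[OF assms(1), unfolded closed_under_cokernels_def, rule_format, OF assms(2-7)])

text \<open>The image is the kernel of the cokernel.\<close>

lemma wide_image:
  fixes W :: "('a, 'm) module set"
  assumes W: "wide W" and XY: "X \<in> W" "Y \<in> W" "f \<in> mod_hom X Y"
  shows "submod Y (f ` carrier X) \<in> W"
proof -
  have fX: "X \<in> fgmod" and fY: "Y \<in> fgmod" using wideD[OF W] XY by auto
  have "left_submodule (f ` carrier X) Y"
    by (rule left_submodule_image[OF fgmodD(1)[OF fX] fgmodD(1)[OF fY] XY(3)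
      left_module.left_submodule_carrier[OF fgmodD(1)[OF fX]]])
  then obtain Q :: "('a, 'm) module" and q where Q: "Q \<in> fgmod" "q \<in> mod_epi Y Q"
    "a_kernel Y Q q = f ` carrier X"
    by (rule ex_fgmod_quotient[OF fY])
  then have "Q \<in> W" by (intro wide_cokernel[OF W XY])
  then show ?thesis using wide_kernel[OF W XY(2) _ mod_epiD(1)[OF Q(2)]] Q(3) by simp
qed

lemma wide_zero:
  fixes W :: "('a, 'm) module set"
  assumes W: "wide W" and X: "X \<in> fgmod" "carrier X = {\<zero>\<^bsub>X\<^esub>}"
  shows "X \<in> W"
proof -
  obtain Z where Z: "Z \<in> W" "carrier Z = {\<zero>\<^bsub>Z\<^esub>}" using W by (auto simp: wide_def)
  have "mod_iso Z X" using Z X wideD(5)[OF W] by (intro zero_modules_iso fgmodD(1))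
  then show ?thesis by (rule subcategory_iso[OF wideD(1)[OF W] Z(1) _ X(1)])
qed

lemma genI:
  fixes C :: "('a, 'm) module set"
  assumes "E \<in> C" "left_module E" "X \<in> fgmod" "e \<in> mod_epi E X"
  shows "X \<in> gen C"
proof -
  interpret E: left_module E by fact
  let ?D = "direct_sum 1 (\<lambda>_. E)"
  have c: "x 0 \<in> carrier E" if "x \<in> carrier ?D" for x using that
    by (auto simp: direct_sum_def PiE_def)
  have "(\<lambda>x. e (x 0)) \<in> mod_hom ?D X"
    using c mod_epiD(1)[OF assms(4)]
    by (intro mod_homI) (simp_all add: direct_sum_def mod_hom_closed mod_hom_add mod_hom_smult)
  moreover have "carrier X \<subseteq> (\<lambda>x. e (x 0)) ` carrier ?D"
  proof
    fix y assume "y \<in> carrier X"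
    then obtain x where "x \<in> carrier E" "e x = y" by (rule mod_epiE[OF assms(4)])
    then show "y \<in> (\<lambda>x. e (x 0)) ` carrier ?D"
      by (intro image_eqI[of _ _ "\<lambda>i\<in>{..<1}. x"]) (auto simp: direct_sum_def)
  qed
  moreover have "(\<lambda>x. e (x 0)) ` carrier ?D \<subseteq> carrier X"
    using c mod_hom_closed[OF mod_epiD(1)[OF assms(4)]] by blast
  ultimately have "(\<lambda>x. e (x 0)) \<in> mod_epi ?D X" by (simp add: mod_epi_def subset_antisym)
  then show ?thesis using assms(1,3) unfolding gen_def
    by (intro CollectI conjI exI[of _ 1] exI[of _ "\<lambda>_. E"]) auto
qed

text \<open>A direct sum of \<open>n\<close> objects has its elements outside \<open>'m\<close>.
  Binary products within \<open>C\<close> are accumulated instead, one summand at a time, until a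
  single object \<open>E\<close> maps onto \<open>X\<close>; \<open>Z\<close> covers the empty
  sum.\<close>

lemma gen_epi_from:
  fixes C :: "('a, 'm) module set"
  assumes C: "subcategory C" "closed_under_extensions C" and Z: "Z \<in> C" "carrier Z = {\<zero>\<^bsub>Z\<^esub>}"
    and X: "X \<in> gen C"
  shows "\<exists>E\<in>C. \<exists>e. e \<in> mod_epi E X"
proof -
  obtain n M p where M: "X \<in> fgmod" "\<forall>i<n. M i \<in> C" "p \<in> mod_epi (direct_sum n M) X"
    using X by (auto simp: gen_def)
  interpret X: left_module X using M(1) by (rule fgmodD)
  have lX: "left_module X" by unfold_locales
  note ph = mod_epiD(1)[OF M(3)]
  let ?D = "direct_sum n M"
  have lM: "left_module (M i)" if "i < n" for i using M(2) C(1) that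
    by (auto simp: subcategory_def fgmod_def)
  have z: "\<zero>\<^bsub>M i\<^esub> \<in> carrier (M i)" if "i < n" for i using lM[OF that]
    by (simp add: left_module_def abelian_group_def abelian_monoid.zero_closed)
  define inc where "inc i x = (\<lambda>j\<in>{..<n}. if j = i then x else \<zero>\<^bsub>M j\<^esub>)" for i x
  have inc: "inc i x \<in> carrier ?D" if "i < n" "x \<in> carrier (M i)" for i x
    using that z by (auto simp: inc_def direct_sum_def)
  have "(\<lambda>x. p (inc i x)) \<in> mod_hom (M i) X" if i: "i < n" for i
  proof (rule mod_homI)
    interpret Mi: left_module "M i" using lM i by simp
    fix x assume x: "x \<in> carrier (M i)"
    show "p (inc i x) \<in> carrier X" using inc[OF i x] by (rule mod_hom_closed[OF ph])
    fix a
    have "inc i (a \<odot>\<^bsub>M i\<^esub> x) = a \<odot>\<^bsub>?D\<^esub> inc i x"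
      using i lM by (auto simp: inc_def direct_sum_def fun_eq_iff left_module.smult_r_null)
    then show "p (inc i (a \<odot>\<^bsub>M i\<^esub> x)) = a \<odot>\<^bsub>X\<^esub> p (inc i x)" using inc[OF i x]
      by (simp add: mod_hom_smult[OF ph])
  next
    fix x y assume xy: "x \<in> carrier (M i)" "y \<in> carrier (M i)"
    have "\<zero>\<^bsub>M j\<^esub> \<oplus>\<^bsub>M j\<^esub> \<zero>\<^bsub>M j\<^esub> = \<zero>\<^bsub>M j\<^esub>" if "j < n" for j
      using lM[OF that] z[OF that]
        by (simp add: left_module_def abelian_group_def abelian_monoid.l_zero)
    then have "inc i (x \<oplus>\<^bsub>M i\<^esub> y) = inc i x \<oplus>\<^bsub>?D\<^esub> inc i y"
      using i by (auto simp: inc_def direct_sum_def fun_eq_iff)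
    then show "p (inc i (x \<oplus>\<^bsub>M i\<^esub> y)) = p (inc i x) \<oplus>\<^bsub>X\<^esub> p (inc i y)"
      using inc[OF i xy(1)] inc[OF i xy(2)] by (simp add: mod_hom_add[OF ph])
  qed
  note hom_i = this
  \<comment> \<open>\<open>cut k x\<close> keeps the first \<open>k\<close> components of
    \<open>x\<close>. The induction on \<open>k\<close> makes the image of \<open>E\<close> contain
    the values of \<open>p\<close> on all such truncations, and \<open>cut n x\<close> is
    \<open>x\<close> itself.\<close>
  define cut where "cut k x = (\<lambda>j\<in>{..<n}. if j < k then x j else \<zero>\<^bsub>M j\<^esub>)" for k and x :: "nat \<Rightarrow> 'm"
  have cut_closed: "cut k x \<in> carrier ?D" if "x \<in> carrier ?D" for k x
    using that z by (auto simp: cut_def direct_sum_def PiE_def Pi_def)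
  have "\<exists>E\<in>C. \<exists>e\<in>mod_hom E X. \<forall>x\<in>carrier ?D. p (cut k x) \<in> e ` carrier E" if "k \<le> n" for k
    using that
  proof (induction k)
    case 0
    have "p (cut 0 x) = \<zero>\<^bsub>X\<^esub>" if x: "x \<in> carrier ?D" for x
    proof -
      \<comment> \<open>Written as \<open>0\<close> times \<open>x\<close>, the zero tuple goes to
        zero by compatibility with scalars alone, without the module axioms for the direct
        sum.\<close>
      have "cut 0 x = 0 \<odot>\<^bsub>?D\<^esub> x"
        using x lM by (auto simp: cut_def direct_sum_def fun_eq_iff left_module.smult_l_null
            PiE_def Pi_def)
      then show ?thesis using mod_hom_smult[OF ph x, of 0] mod_hom_closed[OF ph x]
        by (simp add: X.smult_l_null)
    qed
    then show ?case using Z mod_hom_null[OF lX, of Z]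
      by (intro bexI[of _ Z] bexI[of _ "\<lambda>x. \<zero>\<^bsub>X\<^esub>"]) auto
  next
    case (Suc k)
    then obtain E e where E: "E \<in> C" "e \<in> mod_hom E X" "\<forall>x\<in>carrier ?D. p (cut k x) \<in> e ` carrier E"
      by auto
    have k: "k < n" using Suc.prems by simp
    then have Mk: "M k \<in> C" using M(2) by blast
    have fE: "E \<in> fgmod" "M k \<in> fgmod" using E(1) Mk C(1) by (auto simp: subcategory_def)
    obtain P :: "('a, 'm) module" and p1 p2 where prod: "is_product E (M k) P p1 p2"
      by (rule ex_product[OF fE])
    note P = is_productD[OF prod]
    have PC: "P \<in> C" by (rule extension_closed_product[OF C E(1) Mk prod])
    let ?f = "\<lambda>z. e (p1 z) \<oplus>\<^bsub>X\<^esub> p (inc k (p2 z))"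
    have f: "?f \<in> mod_hom P X"
      by (intro mod_hom_sum[OF lX] mod_hom_comp[OF P(2) E(2)] mod_hom_comp[OF P(3) hom_i[OF k]])
    have "p (cut (Suc k) x) \<in> ?f ` carrier P" if x: "x \<in> carrier ?D" for x
    proof -
      have xk: "x k \<in> carrier (M k)" using x k by (auto simp: direct_sum_def)
      obtain w where w: "w \<in> carrier E" "p (cut k x) = e w" using E(3) x by auto
      then obtain v where v: "v \<in> carrier P" "p1 v = w" "p2 v = x k" using P(4) xk by blast
      have "cut (Suc k) x = cut k x \<oplus>\<^bsub>?D\<^esub> inc k (x k)"
      proof
        fix j
        show "cut (Suc k) x j = (cut k x \<oplus>\<^bsub>?D\<^esub> inc k (x k)) j"
        proof (cases "j < n")
          case True
          interpret Mj: left_module "M j" using lM True by simp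
          have "x j \<in> carrier (M j)" using x True by (auto simp: direct_sum_def)
          then have "x j \<oplus>\<^bsub>M j\<^esub> \<zero>\<^bsub>M j\<^esub> = x j" "\<zero>\<^bsub>M j\<^esub> \<oplus>\<^bsub>M j\<^esub> x j = x j" by simp_all
          then show ?thesis using True by (auto simp: cut_def inc_def direct_sum_def)
        qed (simp add: cut_def direct_sum_def)
      qed
      then have "p (cut (Suc k) x) = p (cut k x) \<oplus>\<^bsub>X\<^esub> p (inc k (x k))"
        using cut_closed[OF x] inc[OF k xk] by (simp add: mod_hom_add[OF ph])
      then show ?thesis using v w by (intro image_eqI[of _ _ v]) auto
    qed
    then show ?case using PC f by blast
  qed
  then obtain E e where E: "E \<in> C" "e \<in> mod_hom E X" "\<forall>x\<in>carrier ?D. p (cut n x) \<in> e ` carrier E"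
    by blast
  have "carrier X \<subseteq> e ` carrier E"
  proof
    fix y assume "y \<in> carrier X"
    then obtain x where x: "x \<in> carrier ?D" "p x = y" by (rule mod_epiE[OF M(3)])
    then have "cut n x = x"
      by (auto simp: cut_def direct_sum_def fun_eq_iff PiE_def extensional_def)
    then show "y \<in> e ` carrier E" using E(3) x by metis
  qed
  moreover have "e ` carrier E \<subseteq> carrier X" using mod_hom_closed[OF E(2)] by blast
  ultimately have "e \<in> mod_epi E X" using E(2) by (simp add: mod_epi_def subset_antisym)
  then show ?thesis using E(1) by blast
qed

lemma gen_wide:
  fixes W :: "('a, 'm) module set"
  assumes W: "wide W"
  shows "gen W = {X \<in> fgmod. \<exists>E\<in>W. \<exists>e. e \<in> mod_epi E X}" (is "_ = ?R")
proof (intro equalityI subsetI)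
  fix X assume X: "X \<in> gen W"
  obtain Z where Z: "Z \<in> W" "carrier Z = {\<zero>\<^bsub>Z\<^esub>}" using W by (auto simp: wide_def)
  then show "X \<in> ?R" using X gen_epi_from[OF wideD(1,4)[OF W] Z X] by (simp add: gen_def)
next
  fix X assume "X \<in> ?R"
  then show "X \<in> gen W" using genI wideD(5)[OF W] fgmodD(1) by blast
qed

lemma gen_wide_closed:
  fixes W :: "('a, 'm) module set"
  assumes W: "wide W"
  shows "gen W \<subseteq> fgmod" "closed_under_quotients (gen W)" "subcategory (gen W)" "W \<subseteq> gen W"
proof -
  show "gen W \<subseteq> fgmod" by (auto simp: gen_def)
  have epi: "Y \<in> gen W" if "X \<in> gen W" "Y \<in> fgmod" "f \<in> mod_epi X Y" for X Y f
    using that mod_epi_comp[OF _ that(3)] unfolding gen_wide[OF W] by blast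
  then show "closed_under_quotients (gen W)" by (auto simp: closed_under_quotients_def)
  show "subcategory (gen W)"
    unfolding subcategory_def
  proof (intro conjI ballI impI)
    fix X Y assume XY: "X \<in> gen W" "Y \<in> (fgmod :: ('a, 'm) module set)" "mod_iso X Y"
    then obtain f where "f \<in> mod_epi X Y" by (auto elim: mod_isoE)
    then show "Y \<in> gen W" by (rule epi[OF XY(1,2)])
  qed (auto simp: gen_def)
  show "W \<subseteq> gen W"
  proof
    fix X assume "X \<in> W"
    moreover have "(\<lambda>x. x) \<in> mod_epi X X" by (simp add: mod_epi_def mod_hom_id)
    ultimately show "X \<in> gen W" using wideD(5)[OF W] unfolding gen_wide[OF W] by blast
  qed
qed

lemma torsion_class_filt_gen:
  fixes W :: "('a, 'm) module set"
  shows "wide W \<Longrightarrow> torsion_class (filt (gen W))"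
  by (intro torsion_class_filt gen_wide_closed)

lemma gen_subset_torsion_class:
  fixes C T :: "('a, 'm) module set"
  assumes T: "torsion_class T" and C: "C \<subseteq> T"
  shows "gen C \<subseteq> T"
proof
  fix X assume X: "X \<in> gen C"
  obtain Z :: "('a, 'm) module" where Z: "Z \<in> fgmod" "carrier Z = {\<zero>\<^bsub>Z\<^esub>}" using ex_zero_module
    by blast
  then have "Z \<in> T" using torsion_class_zero[OF T] fgmodD(1) by blast
  moreover have "X \<in> gen T" using X C unfolding gen_def by blast
  ultimately obtain E e where "E \<in> T" "e \<in> mod_epi E X"
    using gen_epi_from[OF torsion_classD(1,2)[OF T] _ Z(2)] by blast
  moreover have "left_module X" using X by (auto simp: gen_def fgmod_def)
  ultimately show "X \<in> T" using torsion_class_epi[OF T] by blast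
qed

section \<open>The wide subcategory of a torsion class\<close>

lemma alphaD:
  assumes "X \<in> alpha T"
  shows "X \<in> T" "\<lbrakk>Y \<in> T; g \<in> mod_hom Y X\<rbrakk> \<Longrightarrow> submod Y (a_kernel Y X g) \<in> T"
  using assms by (auto simp: alpha_def ker_module_def)

lemma alphaI:
  assumes "X \<in> T" "\<And>Y g. \<lbrakk>Y \<in> T; g \<in> mod_hom Y X\<rbrakk> \<Longrightarrow> submod Y (a_kernel Y X g) \<in> T"
  shows "X \<in> alpha T"
  using assms by (auto simp: alpha_def ker_module_def)

lemma subcategory_alpha:
  fixes T :: "('a, 'm) module set"
  assumes T: "torsion_class T"
  shows "subcategory (alpha T)"
  unfolding subcategory_def
proof (intro conjI ballI impI subsetI)
  show "X \<in> fgmod" if "X \<in> alpha T" for X using that torsion_classD(3)[OF T]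
    by (auto simp: alpha_def)
  fix X Y assume X: "X \<in> alpha T" and Y: "Y \<in> (fgmod :: ('a, 'm) module set)" and iso: "mod_iso X Y"
  note XT = alphaD(1)[OF X]
  note lX = torsion_classD(4)[OF T XT] and lY = fgmodD(1)[OF Y]
  obtain k where k: "k \<in> mod_epi Y X" "inj_on k (carrier Y)"
    by (rule mod_isoE[OF mod_iso_sym[OF lX iso]])
  note kh = mod_epiD(1)[OF k(1)]
  interpret Y: left_module Y by (fact lY)
  show "Y \<in> alpha T"
  proof (rule alphaI)
    show "Y \<in> T" using subcategory_iso[OF torsion_classD(1)[OF T] XT iso Y] .
    fix V g assume V: "V \<in> T" "g \<in> mod_hom V Y"
    have "g v = \<zero>\<^bsub>Y\<^esub>" if "v \<in> carrier V" "k (g v) = \<zero>\<^bsub>X\<^esub>" for v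
      using that k(2) mod_hom_zero[OF lY lX kh] mod_hom_closed[OF V(2)] by (auto simp: inj_on_def)
    then have "a_kernel V X (\<lambda>v. k (g v)) = a_kernel V Y g"
      using mod_hom_zero[OF lY lX kh] by (auto simp: mem_a_kernel)
    then show "submod V (a_kernel V Y g) \<in> T" using alphaD(2)[OF X V(1) mod_hom_comp[OF V(2) kh]]
      by simp
  qed
qed

text \<open>A test map \<open>g\<close> from \<open>V\<close> to \<open>Z\<close> is moved to
  \<open>Y\<close> by the fibre product of \<open>g\<close> and \<open>p\<close>. The fibre product
  is an extension of \<open>V\<close> by the kernel of \<open>p\<close>, hence in \<open>T\<close>.
  Its projection to \<open>Y\<close> has kernel in \<open>T\<close> because \<open>Y\<close> is in
  \<open>alpha T\<close>, and this kernel maps onto the kernel of \<open>g\<close>.\<close>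

lemma alpha_quotient:
  fixes T :: "('a, 'm) module set" and Y Z :: "('a, 'm) module"
  assumes T: "torsion_class T" and Y: "Y \<in> alpha T" and p: "p \<in> mod_epi Y Z" and Z: "Z \<in> fgmod"
    and K: "submod Y (a_kernel Y Z p) \<in> T"
  shows "Z \<in> alpha T"
proof (rule alphaI)
  note YT = alphaD(1)[OF Y] and lZ = fgmodD(1)[OF Z] and ph = mod_epiD(1)[OF p]
  note fY = torsion_classD(3)[OF T YT]
  note lY = fgmodD(1)[OF fY]
  interpret Y: left_module Y by (fact lY)
  interpret Z: left_module Z by (fact lZ)
  show "Z \<in> T" by (rule torsion_class_epi[OF T YT lZ p])
  fix V g assume V: "V \<in> T" "g \<in> mod_hom V Z"
  note fV = torsion_classD(3)[OF T V(1)]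
  note lV = fgmodD(1)[OF fV]
  interpret V: left_module V by (fact lV)
  obtain D :: "('a, 'm) module" and p1 p2 where prod: "is_product V Y D p1 p2"
    by (rule ex_product[OF fV fY])
  note D = is_productD[OF prod]
  note lD = fgmodD(1)[OF D(1)]
  interpret D: left_module D by (fact lD)
  let ?d = "\<lambda>z. g (p1 z) \<ominus>\<^bsub>Z\<^esub> p (p2 z)"
  have d: "?d \<in> mod_hom D Z"
    by (intro mod_hom_diff[OF lZ] mod_hom_comp[OF D(2) V(2)] mod_hom_comp[OF D(3) ph])
  define U where "U = {z \<in> carrier D. g (p1 z) = p (p2 z)}"
  have "U = a_kernel D Z ?d"
    using mod_hom_closed[OF V(2)] mod_hom_closed[OF ph] mod_hom_closed[OF D(2)]
        mod_hom_closed[OF D(3)]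
    by (auto simp: U_def mem_a_kernel Z.minus_eq_zero_iff)
  then have sU: "left_submodule U D" using left_submodule_kernel[OF lD lZ d] by simp
  have Uc: "U \<subseteq> carrier D" by (auto simp: U_def)
  let ?P = "submod D U"
  have fP: "?P \<in> fgmod" by (rule fgmod_sub(1)[OF D(1) sU])
  note lP = fgmodD(1)[OF fP]
  interpret P: left_module ?P by (fact lP)
  have q1: "p1 \<in> mod_hom ?P V" and q2: "p2 \<in> mod_hom ?P Y" by (rule mod_hom_sub_dom[OF _ Uc] D)+
  have q1e: "p1 \<in> mod_epi ?P V"
  proof -
    have "v \<in> p1 ` U" if v: "v \<in> carrier V" for v
    proof -
      obtain y where y: "y \<in> carrier Y" "p y = g v"
        by (rule mod_epiE[OF p mod_hom_closed[OF V(2) v]])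
      then obtain z where "z \<in> carrier D" "p1 z = v" "p2 z = y" using D(4) v by blast
      then show ?thesis using y by (auto simp: U_def)
    qed
    then have "p1 ` U = carrier V" using mod_hom_closed[OF D(2)] Uc by blast
    then show ?thesis using q1 by (simp add: mod_epi_def)
  qed
  define L where "L = a_kernel ?P V p1"
  have L: "L = {z \<in> carrier D. p1 z = \<zero>\<^bsub>V\<^esub> \<and> p (p2 z) = \<zero>\<^bsub>Z\<^esub>}"
    using mod_hom_zero[OF lV lZ V(2)] by (auto simp: L_def U_def mem_a_kernel)
  have sL: "left_submodule L ?P" unfolding L_def by (rule left_submodule_kernel[OF lP lV q1])
  have "submod ?P L \<in> T"
  proof -
    have "mod_iso (submod ?P L) (submod Y (a_kernel Y Z p))"
      unfolding mod_iso_def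
    proof (intro bexI[of _ p2])
      show "p2 \<in> mod_hom (submod ?P L) (submod Y (a_kernel Y Z p))"
        using left_submodule_subset[OF sL] mod_hom_closed[OF D(3)]
        by (intro mod_hom_sub_cod mod_hom_sub_dom[OF q2]) (auto simp: L mem_a_kernel)
      have "inj_on p2 L" using D(5) by (intro inj_onI) (simp add: L)
      moreover have "p2 ` L = a_kernel Y Z p"
      proof
        show "p2 ` L \<subseteq> a_kernel Y Z p" using mod_hom_closed[OF D(3)] by (auto simp: L mem_a_kernel)
        show "a_kernel Y Z p \<subseteq> p2 ` L"
        proof
          fix y assume y: "y \<in> a_kernel Y Z p"
          then obtain z where "z \<in> carrier D" "p1 z = \<zero>\<^bsub>V\<^esub>" "p2 z = y"
            using D(4) V.zero_closed unfolding mem_a_kernel by blast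
          then show "y \<in> p2 ` L" using y by (auto simp: L mem_a_kernel)
        qed
      qed
      ultimately show "bij_betw p2 (carrier (submod ?P L)) (carrier (submod Y (a_kernel Y Z p)))"
        by (simp add: bij_betw_def)
    qed
    then have "mod_iso (submod Y (a_kernel Y Z p)) (submod ?P L)"
      by (rule mod_iso_sym[OF P.left_module_sub[OF sL]])
    then show ?thesis
      by (rule subcategory_iso[OF torsion_classD(1)[OF T] K _ fgmod_sub(1)[OF fP sL]])
  qed
  then have "?P \<in> T"
    by (rule closed_under_extensions_sub[OF torsion_classD(2)[OF T] fP sL _
      q1e L_def[symmetric] V(1)])
  then have KT: "submod ?P (a_kernel ?P Y p2) \<in> T" by (rule alphaD(2)[OF Y _ q2])
  have "p1 ` a_kernel ?P Y p2 = a_kernel V Z g"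
  proof
    show "p1 ` a_kernel ?P Y p2 \<subseteq> a_kernel V Z g"
      using mod_hom_closed[OF D(2)] mod_hom_zero[OF lY lZ ph] by (auto simp: mem_a_kernel U_def)
    show "a_kernel V Z g \<subseteq> p1 ` a_kernel ?P Y p2"
    proof
      fix v assume v: "v \<in> a_kernel V Z g"
      then obtain z where "z \<in> carrier D" "p1 z = v" "p2 z = \<zero>\<^bsub>Y\<^esub>"
        using D(4) Y.zero_closed unfolding mem_a_kernel by blast
      then show "v \<in> p1 ` a_kernel ?P Y p2"
        using v mod_hom_zero[OF lY lZ ph] by (auto simp: mem_a_kernel U_def)
    qed
  qed
  moreover have "p1 \<in> mod_hom (submod ?P (a_kernel ?P Y p2)) V"
    by (rule mod_hom_sub_dom[OF q1]) (auto simp: mem_a_kernel)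
  ultimately show "submod V (a_kernel V Z g) \<in> T"
    using torsion_class_image[OF T KT lV, of p1] by simp
qed

text \<open>For cokernels, the image of \<open>f\<close> is a quotient of \<open>X\<close> and so in
  \<open>T\<close>, which is what \<open>alpha_quotient\<close> asks of the kernel of
  \<open>g\<close>. For extensions, the kernel of a test map to \<open>Y\<close> is taken in two
  stages: first that of the composite to \<open>Z\<close>, then the kernel of the map this induces
  into \<open>N\<close>.\<close>

lemma wide_alpha:
  fixes T :: "('a, 'm) module set"
  assumes T: "torsion_class T"
  shows "wide (alpha T)"
proof -
  note sub = subcategory_alpha[OF T]
  have fg: "X \<in> fgmod" if "X \<in> alpha T" for X using that sub by (auto simp: subcategory_def)
  have zero: "\<exists>X\<in>alpha T. carrier X = {\<zero>\<^bsub>X\<^esub>}"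
  proof -
    obtain Z :: "('a, 'm) module" where Z: "Z \<in> fgmod" "carrier Z = {\<zero>\<^bsub>Z\<^esub>}" using ex_zero_module
      by blast
    have "Z \<in> alpha T"
    proof (rule alphaI)
      show "Z \<in> T" by (rule torsion_class_zero[OF T fgmodD(1)[OF Z(1)] Z(2)])
      fix Y g assume Y: "Y \<in> T" "g \<in> mod_hom Y Z"
      have "a_kernel Y Z g = carrier Y" using mod_hom_closed[OF Y(2)] Z(2)
        by (auto simp: mem_a_kernel)
      then show "submod Y (a_kernel Y Z g) \<in> T" using Y(1) by simp
    qed
    then show ?thesis using Z(2) by blast
  qed
  have ker: "closed_under_kernels (alpha T)"
    unfolding closed_under_kernels_def ker_module_def
  proof (intro ballI)
    fix X Y f assume X: "X \<in> alpha T" and Y: "Y \<in> alpha T" and f: "f \<in> mod_hom X Y"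
    show "submod X (a_kernel X Y f) \<in> alpha T"
    proof (rule alphaI)
      show "submod X (a_kernel X Y f) \<in> T" by (rule alphaD(2)[OF Y alphaD(1)[OF X] f])
      fix V g assume V: "V \<in> T" "g \<in> mod_hom V (submod X (a_kernel X Y f))"
      then have "g \<in> mod_hom V X" by (intro mod_hom_sub_incl[OF V(2)]) (auto simp: mem_a_kernel)
      then have "submod V (a_kernel V X g) \<in> T" by (rule alphaD(2)[OF X V(1)])
      then show "submod V (a_kernel V (submod X (a_kernel X Y f)) g) \<in> T"
        by (simp add: a_kernel_def')
    qed
  qed
  have coker: "closed_under_cokernels (alpha T)"
    unfolding closed_under_cokernels_def
  proof (intro ballI impI)
    fix X Y f g and Z :: "('a, 'm) module" assume *: "X \<in> alpha T" "Y \<in> alpha T" "f \<in> mod_hom X Y"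
      "Z \<in> fgmod" "g \<in> mod_epi Y Z"
      "a_kernel Y Z g = f ` carrier X"
    have "submod Y (a_kernel Y Z g) \<in> T"
      unfolding *(6)
        by (rule torsion_class_image[OF T alphaD(1)[OF *(1)] fgmodD(1)[OF fg[OF *(2)]] *(3)])
    then show "Z \<in> alpha T" by (rule alpha_quotient[OF T *(2,5,4)])
  qed
  have "closed_under_extensions (alpha T)"
  proof (rule closed_under_extensionsI[OF sub])
    fix N p and Y Z :: "('a, 'm) module" assume Y: "Y \<in> fgmod" and N: "left_submodule N Y"
      "submod Y N \<in> alpha T"
      and p: "p \<in> mod_epi Y Z" "a_kernel Y Z p = N" and Z: "Z \<in> alpha T"
    note ph = mod_epiD(1)[OF p(1)] and lY = fgmodD(1)[OF Y] and lZ = fgmodD(1)[OF fg[OF Z]]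
    show "Y \<in> alpha T"
    proof (rule alphaI)
      show "Y \<in> T"
        by (rule closed_under_extensions_sub[OF torsion_classD(2)[OF T] Y N(1)
            alphaD(1)[OF N(2)] p alphaD(1)[OF Z]])
      fix V g assume V: "V \<in> T" "g \<in> mod_hom V Y"
      let ?V = "submod V (a_kernel V Z (\<lambda>v. p (g v)))"
      have V': "?V \<in> T" by (rule alphaD(2)[OF Z V(1) mod_hom_comp[OF V(2) ph]])
      have "g \<in> mod_hom ?V (submod Y N)"
        using mod_hom_closed[OF V(2)] unfolding p(2)[symmetric]
        by (intro mod_hom_sub_cod mod_hom_sub_dom[OF V(2)]) (auto simp: mem_a_kernel)
      then have "submod ?V (a_kernel ?V (submod Y (N)) g) \<in> T" by (rule alphaD(2)[OF N(2) V'])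
      moreover have "a_kernel ?V (submod Y N) g = a_kernel V Y g"
        using mod_hom_zero[OF lY lZ ph] by (auto simp: mem_a_kernel)
      ultimately show "submod V (a_kernel V Y g) \<in> T" by simp
    qed
  qed
  then show ?thesis using sub zero ker coker by (simp add: wide_def)
qed

text \<open>Induction on the dimension of \<open>Y\<close> removes a bottom factor \<open>F\<close>,
  a quotient of some \<open>E\<close> in \<open>W\<close>. The image of \<open>F\<close> in
  \<open>X\<close> is the image of a map from \<open>E\<close>, so it and the quotient
  \<open>X'\<close> of \<open>X\<close> by it stay in \<open>W\<close>, and the hypothesis applies
  to the induced map \<open>g'\<close> from the quotient of \<open>Y\<close> by \<open>F\<close> to
  \<open>X'\<close>. The image of \<open>g\<close> is an extension of that of \<open>g'\<close> by
  the image of \<open>F\<close>; the kernel of \<open>g\<close> is an extension of that of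
  \<open>g'\<close> by the intersection of the kernel of \<open>g\<close> with
  \<open>F\<close>.\<close>

lemma wide_hom_filt_gen:
  fixes W :: "('a, 'm) module set"
  assumes W: "wide W"
  shows "\<lbrakk>Y \<in> filt (gen W); X \<in> W; g \<in> mod_hom Y X\<rbrakk> \<Longrightarrow>
    submod X (g ` carrier Y) \<in> W \<and> submod Y (a_kernel Y X g) \<in> filt (gen W)"
proof (induction "kdim Y" arbitrary: Y X g rule: less_induct)
  case less
  note T = torsion_class_filt_gen[OF W]
  have fY: "Y \<in> fgmod" and fX: "X \<in> fgmod" using less.prems wideD(5)[OF W] filt_fgmod by auto
  note lY = fgmodD(1)[OF fY] and lX = fgmodD(1)[OF fX] and g = less.prems(3)
  interpret Y: left_module Y by (fact lY)
  interpret X: left_module X by (fact lX)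
  show ?case
  proof (cases "carrier Y = {\<zero>\<^bsub>Y\<^esub>}")
    case True
    have g0: "g \<zero>\<^bsub>Y\<^esub> = \<zero>\<^bsub>X\<^esub>" by (rule mod_hom_zero[OF lY lX g])
    have "submod X {\<zero>\<^bsub>X\<^esub>} \<in> W"
      using fgmod_sub(1)[OF fX X.left_submodule_zero] by (intro wide_zero[OF W]) simp_all
    moreover have "g ` carrier Y = {\<zero>\<^bsub>X\<^esub>}" unfolding True using g0 by simp
    moreover have "a_kernel Y X g = carrier Y" unfolding a_kernel_def' True using g0 by blast
    then have "submod Y (a_kernel Y X g) = Y" by simp
    ultimately show ?thesis using less.prems(1) by simp
  next
    case False
    then obtain F where F: "left_submodule F Y" "F \<noteq> {\<zero>\<^bsub>Y\<^esub>}" "submod Y F \<in> gen W"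
      using filt_bottom[OF gen_wide_closed(3)[OF W] less.prems(1)] by blast
    have Fc: "F \<subseteq> carrier Y" by (rule left_submodule_subset[OF F(1)])
    obtain E e where E: "E \<in> W" "e \<in> mod_epi E (submod Y F)" using F(3) unfolding gen_wide[OF W]
      by auto
    have fE: "E \<in> fgmod" using E(1) wideD(5)[OF W] by blast
    note lE = fgmodD(1)[OF fE]
    have eF: "e ` carrier E = F" using E(2) by (simp add: mod_epi_def)
    have eY: "e \<in> mod_hom E Y" by (rule mod_hom_sub_incl[OF mod_epiD(1)[OF E(2)] Fc])
    have ge: "(\<lambda>x. g (e x)) \<in> mod_hom E X" by (rule mod_hom_comp[OF eY g])
    have geF: "(\<lambda>x. g (e x)) ` carrier E = g ` F" using eF by (auto simp: image_image[symmetric])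
    have sJ: "left_submodule (g ` F) X" by (rule left_submodule_image[OF lY lX g F(1)])
    have JW: "submod X (g ` F) \<in> W" using wide_image[OF W E(1) less.prems(2) ge] geF by simp
    obtain X' :: "('a, 'm) module" and q where q: "X' \<in> fgmod" "q \<in> mod_epi X X'"
      "a_kernel X X' q = g ` F"
      by (rule ex_fgmod_quotient[OF fX sJ])
    obtain Y' :: "('a, 'm) module" and r where r: "Y' \<in> fgmod" "r \<in> mod_epi Y Y'"
      "a_kernel Y Y' r = F"
      by (rule ex_fgmod_quotient[OF fY F(1)])
    note lX' = fgmodD(1)[OF q(1)] and lY' = fgmodD(1)[OF r(1)] and qh = mod_epiD(1)[OF q(2)]
      and rh = mod_epiD(1)[OF r(2)]
    interpret X': left_module X' by (fact lX')
    have X'W: "X' \<in> W"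
      by (rule wide_cokernel[OF W E(1) less.prems(2) ge q(1,2)]) (simp add: q(3) geF)
    have Y'T: "Y' \<in> filt (gen W)" by (rule torsion_class_epi[OF T less.prems(1) lY' r(2)])
    obtain x where x: "x \<in> F" "x \<noteq> \<zero>\<^bsub>Y\<^esub>" using F(1,2) by (auto simp: Y.left_submodule_iff)
    then have kd: "kdim Y' < kdim Y" using kdim_epi_less[OF fY lY' r(2), of x] r(3) by simp
    have qg: "(\<lambda>y. q (g y)) \<in> mod_hom Y X'" by (rule mod_hom_comp[OF g qh])
    have qgF: "q (g y) = \<zero>\<^bsub>X'\<^esub>" if "y \<in> F" for y
      using that mem_a_kernel[of "g y" X X' q] unfolding q(3) by simp
    then have "a_kernel Y Y' r \<subseteq> a_kernel Y X' (\<lambda>y. q (g y))"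
      unfolding r(3) using Fc by (simp add: mem_a_kernel subset_iff)
    then obtain g' where g': "g' \<in> mod_hom Y' X'" "\<forall>y\<in>carrier Y. g' (r y) = q (g y)"
      using mod_hom_factor[OF lY lY' lX' r(2) qg] by blast
    have IH: "submod X' (g' ` carrier Y') \<in> W" "submod Y' (a_kernel Y' X' g') \<in> filt (gen W)"
      using less.hyps[OF kd Y'T X'W g'(1)] by auto
    \<comment> \<open>A difference in the image of \<open>F\<close> is repaired by adding an element
      of \<open>F\<close> to \<open>y\<close>. Taking \<open>x\<close> zero shows that the kernel of
      \<open>g\<close> maps onto that of \<open>g'\<close>.\<close>
    have lift: "\<exists>f\<in>F. x = g (y \<oplus>\<^bsub>Y\<^esub> f)" if x: "x \<in> carrier X" and y: "y \<in> carrier Y"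
      and eq: "q x = q (g y)" for x y
    proof -
      have gy: "g y \<in> carrier X" by (rule mod_hom_closed[OF g y])
      have "x \<ominus>\<^bsub>X\<^esub> g y \<in> g ` F" using mod_hom_eqI_ker[OF lX lX' qh x gy] eq q(3) by simp
      then obtain f where f: "f \<in> F" "x \<ominus>\<^bsub>X\<^esub> g y = g f" by auto
      then have "x = g y \<oplus>\<^bsub>X\<^esub> g f" using X.add_minus_cancel[OF x gy] by simp
      also have "\<dots> = g (y \<oplus>\<^bsub>Y\<^esub> f)" using f(1) Fc y by (simp add: mod_hom_add[OF g] subset_iff)
      finally show ?thesis using f(1) by blast
    qed
    have g'Y': "g' ` carrier Y' = (\<lambda>y. q (g y)) ` carrier Y"
    proof -
      have "g' ` carrier Y' = g' ` r ` carrier Y" using r(2) by (simp add: mod_epi_def)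
      then show ?thesis using g'(2) by (simp add: image_image)
    qed
    have "{x \<in> carrier X. q x \<in> g' ` carrier Y'} = g ` carrier Y"
    proof
      show "{x \<in> carrier X. q x \<in> g' ` carrier Y'} \<subseteq> g ` carrier Y"
      proof
        fix x assume "x \<in> {x \<in> carrier X. q x \<in> g' ` carrier Y'}"
        then obtain y where y: "x \<in> carrier X" "y \<in> carrier Y" "q x = q (g y)" unfolding g'Y'
          by auto
        then obtain f where "f \<in> F" "x = g (y \<oplus>\<^bsub>Y\<^esub> f)" using lift by blast
        then show "x \<in> g ` carrier Y" using y(2) Fc by (simp add: subset_iff)
      qed
      show "g ` carrier Y \<subseteq> {x \<in> carrier X. q x \<in> g' ` carrier Y'}"
        unfolding g'Y' using mod_hom_closed[OF g] by auto
    qed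
    moreover have "submod X {x \<in> carrier X. q x \<in> g' ` carrier Y'} \<in> W"
      using JW q(3) IH(1)
          left_submodule_image[OF lY' lX' g'(1) left_module.left_submodule_carrier[OF lY']]
      by (intro extension_vimage[OF wideD(4)[OF W] fX lX' q(2)]) simp_all
    ultimately have imW: "submod X (g ` carrier Y) \<in> W" by simp
    let ?K = "a_kernel Y X g"
    let ?N = "?K \<inter> F"
    have sK: "left_submodule ?K Y" by (rule left_submodule_kernel[OF lY lX g])
    have sN: "left_submodule ?N Y" by (rule Y.left_submodule_Int[OF sK F(1)])
    \<comment> \<open>The kernel of the composite from \<open>E\<close> to \<open>X\<close> is in
      \<open>W\<close> and maps onto this intersection, which is therefore in
      \<open>gen W\<close>.\<close>
    have NT: "submod Y ?N \<in> filt (gen W)"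
    proof -
      let ?E = "submod E (a_kernel E X (\<lambda>x. g (e x)))"
      have EW: "?E \<in> W" by (rule wide_kernel[OF W E(1) less.prems(2) ge])
      have "e ` a_kernel E X (\<lambda>x. g (e x)) = ?N"
        unfolding eF[symmetric] using mod_hom_closed[OF eY] unfolding a_kernel_def' by blast
      moreover have "e \<in> mod_hom ?E Y" by (rule mod_hom_sub_dom[OF eY]) (auto simp: mem_a_kernel)
      ultimately have "e \<in> mod_epi ?E (submod Y ?N)"
        using mod_hom_sub_cod[of e ?E Y ?N] by (auto simp: mod_epi_def)
      then have "submod Y ?N \<in> gen W"
        using EW fgmod_sub(1)[OF fY sN] unfolding gen_wide[OF W] by blast
      then show ?thesis using subset_filt gen_wide_closed(1)[OF W] by blast
    qed
    have "submod Y ?K \<in> filt (gen W)"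
    proof (rule closed_under_extensions_sub[OF torsion_classD(2)[OF T] fgmod_sub(1)[OF fY sK] _ _ _ _ IH(2)])
      show "left_submodule ?N (submod Y ?K)" using Y.left_submodule_sub_iff[OF sK] sN by blast
      show "submod (submod Y ?K) ?N \<in> filt (gen W)" using NT by simp
      have Kc: "?K \<subseteq> carrier Y" by (rule left_submodule_subset[OF sK])
      have "r ` ?K = a_kernel Y' X' g'"
      proof
        show "r ` ?K \<subseteq> a_kernel Y' X' g'"
          using g'(2) mod_hom_closed[OF rh] mod_hom_zero[OF lX lX' qh] by (auto simp: mem_a_kernel)
        show "a_kernel Y' X' g' \<subseteq> r ` ?K"
        proof
          fix z assume "z \<in> a_kernel Y' X' g'"
          then have z: "z \<in> carrier Y'" "g' z = \<zero>\<^bsub>X'\<^esub>" by (auto simp: mem_a_kernel)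
          obtain y where y: "y \<in> carrier Y" "r y = z" by (rule mod_epiE[OF r(2) z(1)])
          have "q \<zero>\<^bsub>X\<^esub> = q (g y)" using g'(2) y z mod_hom_zero[OF lX lX' qh] by auto
          then obtain f where f: "f \<in> F" "\<zero>\<^bsub>X\<^esub> = g (y \<oplus>\<^bsub>Y\<^esub> f)" using lift[OF X.zero_closed y(1)]
            by blast
          have fc: "f \<in> carrier Y" "r f = \<zero>\<^bsub>Y'\<^esub>" using f(1) r(3) Fc by (auto simp: mem_a_kernel)
          have "r (y \<oplus>\<^bsub>Y\<^esub> f) = z"
            using y fc z(1) left_module.axioms(1)[OF lY']
            by (simp add: mod_hom_add[OF rh] abelian_group_def abelian_monoid.r_zero)
          moreover have "y \<oplus>\<^bsub>Y\<^esub> f \<in> ?K" using y fc f(2) by (simp add: mem_a_kernel)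
          ultimately show "z \<in> r ` ?K" by blast
        qed
      qed
      moreover have "r \<in> mod_hom (submod Y ?K) Y'" by (rule mod_hom_sub_dom[OF rh Kc])
      ultimately show "r \<in> mod_epi (submod Y ?K) (submod Y' (a_kernel Y' X' g'))"
        using mod_hom_sub_cod[of r "submod Y ?K" Y' "a_kernel Y' X' g'"] by (auto simp: mod_epi_def)
      show "a_kernel (submod Y ?K) (submod Y' (a_kernel Y' X' g')) r = ?N"
        using r(3) Kc by (auto simp: mem_a_kernel)
    qed
    then show ?thesis using imW by blast
  qed
qed

text \<open>For the inclusion from left to right, \<open>X\<close> is cut at a bottom factor
  \<open>F\<close>, a quotient of some \<open>E\<close> in \<open>W\<close>. The quotient of
  \<open>X\<close> by \<open>F\<close> is a cokernel in the wide subcategory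
  \<open>alpha ?T\<close>, so induction on dimension puts it in \<open>W\<close>. It remains to move
  \<open>F\<close> from \<open>gen W\<close> into \<open>W\<close>.\<close>

lemma alpha_filt_gen:
  fixes W :: "('a, 'm) module set"
  assumes W: "wide W"
  shows "alpha (filt (gen W)) = W"
proof
  let ?T = "filt (gen W)"
  note T = torsion_class_filt_gen[OF W]
  show WA: "W \<subseteq> alpha ?T"
  proof
    fix X assume X: "X \<in> W"
    then have "X \<in> ?T" using gen_wide_closed(1,4)[OF W] subset_filt by blast
    then show "X \<in> alpha ?T" using wide_hom_filt_gen[OF W _ X] by (intro alphaI) auto
  qed
  have "X \<in> W" if "X \<in> alpha ?T" for X
    using that
  proof (induction "kdim X" arbitrary: X rule: less_induct)
    case less
    note XT = alphaD(1)[OF less.prems]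
    have fX: "X \<in> fgmod" using XT by (rule filt_fgmod)
    note lX = fgmodD(1)[OF fX]
    interpret X: left_module X by (fact lX)
    show ?case
    proof (cases "carrier X = {\<zero>\<^bsub>X\<^esub>}")
      case True
      then show ?thesis by (rule wide_zero[OF W fX])
    next
      case False
      then obtain F where F: "left_submodule F X" "F \<noteq> {\<zero>\<^bsub>X\<^esub>}" "submod X F \<in> gen W"
        using filt_bottom[OF gen_wide_closed(3)[OF W] XT] by blast
      have Fc: "F \<subseteq> carrier X" by (rule left_submodule_subset[OF F(1)])
      obtain E e where E: "E \<in> W" "e \<in> mod_epi E (submod X F)" using F(3) unfolding gen_wide[OF W]
        by auto
      have fE: "E \<in> fgmod" using E(1) wideD(5)[OF W] by blast
      note lE = fgmodD(1)[OF fE]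
      have eF: "e ` carrier E = F" using E(2) by (simp add: mod_epi_def)
      have eX: "e \<in> mod_hom E X" by (rule mod_hom_sub_incl[OF mod_epiD(1)[OF E(2)] Fc])
      have EA: "E \<in> alpha ?T" using E(1) WA by blast
      obtain X' :: "('a, 'm) module" and q where q: "X' \<in> fgmod" "q \<in> mod_epi X X'"
        "a_kernel X X' q = F"
        by (rule ex_fgmod_quotient[OF fX F(1)])
      obtain x where x: "x \<in> F" "x \<noteq> \<zero>\<^bsub>X\<^esub>" using F(1,2) by (auto simp: X.left_submodule_iff)
      then have kd: "kdim X' < kdim X" using kdim_epi_less[OF fX fgmodD(1)[OF q(1)] q(2), of x] q(3)
        by simp
      have "X' \<in> alpha ?T"
        by (rule wide_cokernel[OF wide_alpha[OF T] EA less.prems eX q(1,2)]) (simp add: q(3) eF)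
      then have X'W: "X' \<in> W" by (rule less.hyps[OF kd])
      \<comment> \<open>The kernel of \<open>e\<close> lies in the torsion class because
        \<open>X\<close> is in \<open>alpha ?T\<close>. As the image of its own inclusion into
        \<open>E\<close> it is in \<open>W\<close>, and \<open>F\<close> is the cokernel of that
        inclusion.\<close>
      let ?K = "a_kernel E X e"
      have KT: "submod E ?K \<in> ?T" by (rule alphaD(2)[OF less.prems alphaD(1)[OF EA] eX])
      have id: "(\<lambda>x. x) \<in> mod_hom (submod E ?K) E"
        by (rule mod_hom_sub_dom[OF mod_hom_id]) (auto simp: mem_a_kernel)
      have KW: "submod E ?K \<in> W" using wide_hom_filt_gen[OF W KT E(1) id] by simp
      have "submod X F \<in> W"
        by (rule wide_cokernel[OF W KW E(1) id fgmod_sub(1)[OF fX F(1)] E(2)]) (auto simp: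
            mem_a_kernel)
      then show ?thesis
        by (rule closed_under_extensions_sub[OF wideD(4)[OF W] fX F(1) _ q(2,3) X'W])
    qed
  qed
  then show "alpha ?T \<subseteq> W" by blast
qed

section \<open>Functorially finite torsion classes\<close>

text \<open>The torsion part of \<open>M\<close> contains the image of every map from an object of
  \<open>T\<close>, so generation element by element suffices and no finite sum of generators has to
  be formed.\<close>

lemma torsion_class_generated:
  fixes T :: "('a, 'm) module set"
  assumes T: "torsion_class T" and M: "M \<in> fgmod"
    and gen: "\<And>x. x \<in> carrier M \<Longrightarrow> \<exists>E\<in>T. \<exists>f\<in>mod_hom E M. x \<in> f ` carrier E"
  shows "M \<in> T"
proof -
  note lM = fgmodD(1)[OF M]
  obtain N where N: "left_submodule N M" "submod M N \<in> T"
    "\<forall>L. left_submodule L M \<longrightarrow> submod M L \<in> T \<longrightarrow> L \<subseteq> N"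
    by (rule ex_torsion_part[OF T M])
  have "carrier M \<subseteq> N"
  proof
    fix x assume "x \<in> carrier M"
    then obtain E f where E: "E \<in> T" "f \<in> mod_hom E M" "x \<in> f ` carrier E" using gen by blast
    note lE = torsion_classD(4)[OF T E(1)]
    have "left_submodule (f ` carrier E) M"
      by (rule left_submodule_image[OF lE lM E(2) left_module.left_submodule_carrier[OF lE]])
    then have "f ` carrier E \<subseteq> N" using N(3) torsion_class_image[OF T E(1) lM E(2)] by blast
    then show "x \<in> N" using E(3) by blast
  qed
  then have "N = carrier M" using left_submodule_subset[OF N(1)] by blast
  then show ?thesis using N(2) by simp
qed

text \<open>\<open>t\<close> stands for the map to \<open>G\<close> that sends the generator of the
  free module of rank one to \<open>t\<close>. Least dimension is recorded through its consequence
  that no proper submodule in \<open>T\<close> contains \<open>t\<close>.\<close>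

definition minimal_generator :: "('a, 'm) module set \<Rightarrow> ('a, 'm) module \<Rightarrow> 'm \<Rightarrow> bool" where
  "minimal_generator T G t \<longleftrightarrow> G \<in> T \<and> t \<in> carrier G \<and>
     (\<forall>M\<in>T. \<forall>x\<in>carrier M. \<exists>h\<in>mod_hom G M. h t = x) \<and>
     (\<forall>N. left_submodule N G \<longrightarrow> submod G N \<in> T \<longrightarrow> t \<in> N \<longrightarrow> N = carrier G)"

lemmas minimal_generatorD =
  minimal_generator_def[THEN iffD1, THEN conjunct1]
  minimal_generator_def[THEN iffD1, THEN conjunct2, THEN conjunct1]
  minimal_generator_def[THEN iffD1, THEN conjunct2, THEN conjunct2, THEN conjunct1]
  minimal_generator_def[THEN iffD1, THEN conjunct2, THEN conjunct2, THEN conjunct2]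

text \<open>A left approximation of the regular module takes \<open>u\<close> to an element that can
  be mapped anywhere in \<open>T\<close>. By restriction of maps, a submodule of \<open>G\<close>
  that lies in \<open>T\<close> and contains \<open>t\<close> has the same property, so least
  dimension excludes proper ones.\<close>

lemma ex_minimal_generator:
  fixes T :: "('a, 'm) module set"
  assumes T: "torsion_class T" and ff: "functorially_finite T"
  obtains G t where "minimal_generator T G t"
proof -
  obtain R :: "('a, 'm) module" and u where R: "R \<in> fgmod" "u \<in> carrier R"
    "\<forall>(M :: ('a, 'm) module) x. left_module M \<longrightarrow> x \<in> carrier M \<longrightarrow> (\<exists>h\<in>mod_hom R M. h u = x)"
    by (rule ex_regular)
  define P where "P = (\<lambda>(G, t). G \<in> T \<and> t \<in> carrier G \<and> (\<forall>M\<in>T. \<forall>x\<in>carrier M. \<exists>h\<in>mod_hom G M. h t = x))"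
  obtain C g where C: "C \<in> T" "g \<in> mod_hom R C"
    "\<forall>D\<in>T. \<forall>h\<in>mod_hom R D. \<exists>h'\<in>mod_hom C D. \<forall>x\<in>carrier R. h' (g x) = h x"
    using ff[unfolded functorially_finite_def, rule_format, OF R(1)] by auto
  have "\<exists>h\<in>mod_hom C M. h (g u) = x" if M: "M \<in> T" "x \<in> carrier M" for M x
  proof -
    obtain h where "h \<in> mod_hom R M" "h u = x" using R(3) M torsion_classD(4)[OF T] by blast
    then show ?thesis using C(3) \<open>M \<in> T\<close> R(2) by metis
  qed
  then have "P (C, g u)" using C mod_hom_closed[OF C(2) R(2)] by (simp add: P_def)
  then obtain Gt where Gt: "P Gt" "\<forall>y. P y \<longrightarrow> kdim (fst Gt) \<le> kdim (fst y)"
    using ex_has_least_nat[of P "(C, g u)" "\<lambda>y. kdim (fst y)"] by blast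
  obtain G t where "Gt = (G, t)" by force
  with Gt have G: "G \<in> T" "t \<in> carrier G" "\<forall>M\<in>T. \<forall>x\<in>carrier M. \<exists>h\<in>mod_hom G M. h t = x"
    and min: "\<And>G' t'. P (G', t') \<Longrightarrow> kdim G \<le> kdim G'" by (auto simp: P_def)
  have unique: "N = carrier G" if N: "left_submodule N G" "submod G N \<in> T" "t \<in> N" for N
  proof (rule ccontr)
    assume "N \<noteq> carrier G"
    then have "kdim (submod G N) < kdim G"
      by (rule fgmod_sub(2)[OF torsion_classD(3)[OF T G(1)] N(1)])
    moreover have "\<exists>h\<in>mod_hom (submod G N) M. h t = x" if "M \<in> T" "x \<in> carrier M" for M x
      using G(3) that mod_hom_sub_dom[OF _ left_submodule_subset[OF N(1)]] by blast
    then have "P (submod G N, t)" using N by (simp add: P_def)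
    then have "kdim G \<le> kdim (submod G N)" by (rule min)
    ultimately show False by simp
  qed
  show ?thesis
    by (rule that[of G t], unfold minimal_generator_def, intro conjI G allI impI unique)
qed

text \<open>If \<open>X\<close> is in \<open>alpha T\<close>, the kernel of \<open>h\<close> is a
  submodule of \<open>G\<close> in \<open>T\<close> containing \<open>t\<close>, so it is all of
  \<open>G\<close>. Conversely, each \<open>x\<close> in the kernel of a test map \<open>g\<close>
  is \<open>h t\<close> for some \<open>h\<close>; as \<open>g\<close> after \<open>h\<close> kills
  \<open>t\<close>, it vanishes, so \<open>h\<close> lands in the kernel, which is thus generated by
  \<open>G\<close>.\<close>

lemma alpha_iff:
  fixes T :: "('a, 'm) module set"
  assumes T: "torsion_class T" and Gt: "minimal_generator T G t"
  shows "X \<in> alpha T \<longleftrightarrow> X \<in> T \<and> (\<forall>h\<in>mod_hom G X. h t = \<zero>\<^bsub>X\<^esub> \<longrightarrow> (\<forall>s\<in>carrier G. h s = \<zero>\<^bsub>X\<^esub>))"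
proof -
  note G = minimal_generatorD(1,2)[OF Gt] and gen = minimal_generatorD(3)[OF Gt]
    and min = minimal_generatorD(4)[OF Gt]
  show ?thesis
  proof
    note lG = torsion_classD(4)[OF T G(1)]
    assume X: "X \<in> alpha T"
    note lX = torsion_classD(4)[OF T alphaD(1)[OF X]]
    have "h s = \<zero>\<^bsub>X\<^esub>" if h: "h \<in> mod_hom G X" "h t = \<zero>\<^bsub>X\<^esub>" and s: "s \<in> carrier G" for h s
    proof -
      have "t \<in> a_kernel G X h" using h(2) G(2) by (simp add: mem_a_kernel)
      then have "a_kernel G X h = carrier G"
        by (rule min[rule_format, OF left_submodule_kernel[OF lG lX h(1)] alphaD(2)[OF X G(1) h(1)]])
      then show ?thesis using s mem_a_kernel[of s G X h] by simp
    qed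
    then show "X \<in> T \<and> (\<forall>h\<in>mod_hom G X. h t = \<zero>\<^bsub>X\<^esub> \<longrightarrow> (\<forall>s\<in>carrier G. h s = \<zero>\<^bsub>X\<^esub>))"
      using alphaD(1)[OF X] by blast
  next
    assume X: "X \<in> T \<and> (\<forall>h\<in>mod_hom G X. h t = \<zero>\<^bsub>X\<^esub> \<longrightarrow> (\<forall>s\<in>carrier G. h s = \<zero>\<^bsub>X\<^esub>))"
    then have XT: "X \<in> T" by blast
    note lX = torsion_classD(4)[OF T XT]
    show "X \<in> alpha T"
    proof (rule alphaI[OF XT])
      fix Y g assume Y: "Y \<in> T" "g \<in> mod_hom Y X"
      note fY = torsion_classD(3)[OF T Y(1)]
      note lY = fgmodD(1)[OF fY]
      show "submod Y (a_kernel Y X g) \<in> T"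
      proof (rule torsion_class_generated[OF T fgmod_sub(1)[OF fY left_submodule_kernel[OF lY lX Y(2)]]])
        fix x assume "x \<in> carrier (submod Y (a_kernel Y X g))"
        then have x: "x \<in> carrier Y" "g x = \<zero>\<^bsub>X\<^esub>" by (simp_all add: mem_a_kernel)
        obtain h where h: "h \<in> mod_hom G Y" "h t = x" using gen Y(1) x(1) by blast
        have "g (h t) = \<zero>\<^bsub>X\<^esub>" using h(2) x(2) by simp
        then have "\<forall>s\<in>carrier G. g (h s) = \<zero>\<^bsub>X\<^esub>"
          by (intro X[THEN conjunct2, THEN bspec, OF mod_hom_comp[OF h(1) Y(2)], THEN mp])
        then have "h \<in> mod_hom G (submod Y (a_kernel Y X g))"
          using mod_hom_closed[OF h(1)] by (intro mod_hom_sub_cod[OF h(1)]) (simp add: mem_a_kernel)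
        then show "\<exists>E\<in>T. \<exists>f\<in>mod_hom E (submod Y (a_kernel Y X g)). x \<in> f ` carrier E"
          using G h(2) by blast
      qed
    qed
  qed
qed

text \<open>
  Zorn's lemma applies because a torsion class generated by one object is not the union of a chain
  of proper torsion subclasses.
\<close>

lemma ex_maximal_torsion_subclass:
  fixes T U :: "('a, 'm) module set"
  assumes T: "torsion_class T" and U: "torsion_class U" "U \<subseteq> T" "U \<noteq> T" and G: "G \<in> T"
    "t \<in> carrier G"
    and gen: "\<forall>M\<in>T. \<forall>x\<in>carrier M. \<exists>h\<in>mod_hom G M. h t = x"
  obtains S where "torsion_class S" "U \<subseteq> S" "S \<subseteq> T" "S \<noteq> T"
    "\<forall>V. torsion_class V \<longrightarrow> S \<subseteq> V \<longrightarrow> V \<subseteq> T \<longrightarrow> V = S \<or> V = T"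
proof -
  \<comment> \<open>A torsion subclass of \<open>T\<close> is proper exactly if it misses the one
    object \<open>G\<close>, and a union of classes missing \<open>G\<close> still misses
    it.\<close>
  have all: "T \<subseteq> V" if V: "torsion_class V" "G \<in> V" for V :: "('a, 'm) module set"
  proof
    fix M assume M: "M \<in> T"
    show "M \<in> V"
    proof (rule torsion_class_generated[OF V(1) torsion_classD(3)[OF T M]])
      fix x assume "x \<in> carrier M"
      then obtain h where "h \<in> mod_hom G M" "h t = x" using gen M by blast
      then show "\<exists>E\<in>V. \<exists>f\<in>mod_hom E M. x \<in> f ` carrier E" using V(2) G(2) by blast
    qed
  qed
  let ?A = "{V. torsion_class V \<and> U \<subseteq> V \<and> V \<subseteq> T \<and> G \<notin> V}"
  have "U \<in> ?A" using U all[OF U(1)] by blast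
  then have ne: "?A \<noteq> {}" by blast
  have "\<Union>C \<in> ?A" if C: "C \<noteq> {}" "subset.chain ?A C" for C
  proof -
    have CA: "C \<subseteq> ?A" and ch: "\<And>X Y. \<lbrakk>X \<in> C; Y \<in> C\<rbrakk> \<Longrightarrow> X \<subseteq> Y \<or> Y \<subseteq> X"
      using C(2) by (auto simp: subset_chain_def)
    obtain V0 where V0: "V0 \<in> C" using C(1) by blast
    have tC: "torsion_class V" if "V \<in> C" for V using CA that by blast
    have "torsion_class (\<Union>C)"
      unfolding torsion_class_def
    proof (intro conjI)
      show "subcategory (\<Union>C)"
        unfolding subcategory_def
      proof (intro conjI ballI impI subsetI)
        show "X \<in> fgmod" if "X \<in> \<Union>C" for X using that torsion_classD(3) tC by blast
        fix X Y assume "X \<in> \<Union>C" "Y \<in> (fgmod :: ('a, 'm) module set)" "mod_iso X Y"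
        then show "Y \<in> \<Union>C" using subcategory_iso torsion_classD(1) tC by (meson UnionE UnionI)
      qed
      show "\<Union>C \<noteq> {}" using V0 tC by (auto simp: torsion_class_def)
      show "closed_under_quotients (\<Union>C)"
        unfolding closed_under_quotients_def
      proof (intro ballI impI)
        fix X and Y :: "('a, 'm) module" assume "X \<in> \<Union>C" "Y \<in> fgmod" "mod_epi X Y \<noteq> {}"
        then show "Y \<in> \<Union>C" using torsion_class_epi[OF tC] fgmodD(1) by blast
      qed
      show "closed_under_extensions (\<Union>C)"
        unfolding closed_under_extensions_def
      proof (intro ballI allI impI)
        fix X Z Y f g assume *: "X \<in> \<Union>C" "Z \<in> \<Union>C" "Y \<in> fgmod" "short_exact X f Y g Z"
        then obtain V V' where V: "V \<in> C" "X \<in> V" "V' \<in> C" "Z \<in> V'" by blast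
        obtain V'' where V'': "V'' \<in> C" "X \<in> V''" "Z \<in> V''" using ch[OF V(1,3)] V by blast
        have "Y \<in> V''"
          using torsion_classD(2)[OF tC[OF V''(1)], unfolded closed_under_extensions_def, rule_format,
            OF V''(2,3) *(3,4)] .
        then show "Y \<in> \<Union>C" using V''(1) by blast
      qed
    qed
    moreover have "U \<subseteq> \<Union>C" using V0 CA by blast
    ultimately show ?thesis using CA by blast
  qed
  then obtain S where S: "S \<in> ?A" "\<forall>X\<in>?A. S \<subseteq> X \<longrightarrow> X = S"
    using subset_Zorn_nonempty[of ?A, OF ne] by blast
  show ?thesis
  proof (rule that[of S])
    show "torsion_class S" "U \<subseteq> S" "S \<subseteq> T" "S \<noteq> T" using S(1) G(1) by auto
    show "\<forall>V. torsion_class V \<longrightarrow> S \<subseteq> V \<longrightarrow> V \<subseteq> T \<longrightarrow> V = S \<or> V = T"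
    proof (intro allI impI)
      fix V assume V: "torsion_class V" "S \<subseteq> V" "V \<subseteq> T"
      show "V = S \<or> V = T"
      proof (cases "G \<in> V")
        case True
        then show ?thesis using all[OF V(1)] V(3) by blast
      next
        case False
        then have "V \<in> ?A" using V S(1) by auto
        then show ?thesis using S(2) V(2) by blast
      qed
    qed
  qed
qed

text \<open>
  The witness is a module of minimal dimension in \<open>T\<close> outside \<open>S\<close>: every object of \<open>T\<close> is filtered
  by objects of \<open>S\<close> and copies of it.
\<close>

lemma alpha_not_subset_maximal:
  fixes T S :: "('a, 'm) module set"
  assumes T: "torsion_class T" and S: "torsion_class S" "S \<subseteq> T" "S \<noteq> T"
    and max: "\<forall>V. torsion_class V \<longrightarrow> S \<subseteq> V \<longrightarrow> V \<subseteq> T \<longrightarrow> V = S \<or> V = T"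
  shows "\<not> alpha T \<subseteq> S"
proof -
  obtain M0 where M0: "M0 \<in> T \<and> M0 \<notin> S" using S by blast
  obtain M where M: "M \<in> T \<and> M \<notin> S" and min': "\<forall>X. X \<in> T \<and> X \<notin> S \<longrightarrow> kdim M \<le> kdim X"
    using ex_has_least_nat[of "\<lambda>X. X \<in> T \<and> X \<notin> S" M0 kdim] M0 by blast
  have MT: "M \<in> T" and MS: "M \<notin> S" using M by auto
  have min: "X \<in> S" if "X \<in> T" "kdim X < kdim M" for X using min' that by force
  note fM = torsion_classD(3)[OF T MT]
  note lM = fgmodD(1)[OF fM]
  interpret M: left_module M by (fact lM)
  \<comment> \<open>A nonzero submodule in \<open>S\<close> would leave a quotient of smaller
    dimension, hence in \<open>S\<close>, and \<open>M\<close> would be an extension of two objects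
    of \<open>S\<close>.\<close>
  have free: "L = {\<zero>\<^bsub>M\<^esub>}" if L: "left_submodule L M" "submod M L \<in> S" for L
  proof (rule ccontr)
    assume "L \<noteq> {\<zero>\<^bsub>M\<^esub>}"
    then obtain x where x: "x \<in> L" "x \<noteq> \<zero>\<^bsub>M\<^esub>" using L(1) by (auto simp: M.left_submodule_iff)
    obtain Q :: "('a, 'm) module" and q where Q: "Q \<in> fgmod" "q \<in> mod_epi M Q" "a_kernel M Q q = L"
      by (rule ex_fgmod_quotient[OF fM L(1)])
    have "kdim Q < kdim M" using kdim_epi_less[OF fM fgmodD(1)[OF Q(1)] Q(2), of x] x Q(3) by simp
    then have "Q \<in> S" using min torsion_class_epi[OF T MT fgmodD(1)[OF Q(1)] Q(2)] by blast
    then have "M \<in> S"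
      by (rule closed_under_extensions_sub[OF torsion_classD(2)[OF S(1)] fM L Q(2,3)])
    then show False using MS by blast
  qed
  \<comment> \<open>Adding the copies of \<open>M\<close> keeps closure under quotients, because a
    proper quotient of \<open>M\<close> has smaller dimension and so lies in \<open>S\<close>. Hence
    \<open>filt C\<close> is a torsion class strictly above \<open>S\<close>, and maximality makes
    it \<open>T\<close>.\<close>
  define C where "C = S \<union> {X \<in> fgmod. mod_iso M X}"
  have CT: "C \<subseteq> T" using S(2) subcategory_iso[OF torsion_classD(1)[OF T] MT] by (auto simp: C_def)
  have Cf: "C \<subseteq> fgmod" using CT torsion_classD(3)[OF T] by blast
  have Cq: "closed_under_quotients C"
    unfolding closed_under_quotients_def
  proof (intro ballI impI)
    fix X and Y :: "('a, 'm) module" assume X: "X \<in> C" and Y: "Y \<in> fgmod" and e': "mod_epi X Y \<noteq> {}"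
    obtain e where e: "e \<in> mod_epi X Y" using e' by blast
    note lY = fgmodD(1)[OF Y]
    show "Y \<in> C"
    proof (cases "X \<in> S")
      case True
      then show ?thesis using torsion_class_epi[OF S(1) True lY e] by (simp add: C_def)
    next
      case False
      then have "mod_iso M X" using X by (simp add: C_def)
      then obtain f where f: "f \<in> mod_epi M X" by (rule mod_isoE)
      have ef: "(\<lambda>x. e (f x)) \<in> mod_epi M Y" by (rule mod_epi_comp[OF f e])
      show ?thesis
      proof (cases "a_kernel M Y (\<lambda>x. e (f x)) \<subseteq> {\<zero>\<^bsub>M\<^esub>}")
        case True
        then have "mod_iso M Y" by (rule mod_isoI_inj_epi[OF lM lY ef])
        then show ?thesis using Y by (simp add: C_def)
      next
        case False
        then obtain x where "x \<in> a_kernel M Y (\<lambda>x. e (f x))" "x \<noteq> \<zero>\<^bsub>M\<^esub>" by blast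
        then have "kdim Y < kdim M" by (rule kdim_epi_less[OF fM lY ef])
        then show ?thesis using min torsion_class_epi[OF T MT lY ef] by (simp add: C_def)
      qed
    qed
  qed
  have Cs: "subcategory C"
    unfolding subcategory_def
  proof (intro conjI ballI impI)
    fix X Y assume XY: "X \<in> C" "Y \<in> (fgmod :: ('a, 'm) module set)" "mod_iso X Y"
    then obtain f where "f \<in> mod_epi X Y" by (auto elim: mod_isoE)
    then show "Y \<in> C" using Cq XY(1,2) unfolding closed_under_quotients_def by blast
  qed (rule Cf)
  have "mod_iso M M" unfolding mod_iso_def by (intro bexI[OF _ mod_hom_id]) (simp add: bij_betw_def)
  then have "M \<in> filt C" using subset_filt[OF Cf] fM by (auto simp: C_def)
  moreover have "S \<subseteq> filt C" using subset_filt[OF Cf] by (auto simp: C_def)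
  moreover have "filt C \<subseteq> T" by (rule filt_subset_torsion_class[OF T CT])
  ultimately have TC: "filt C = T" using max torsion_class_filt[OF Cf Cq] MS by blast
  \<comment> \<open>The claim is that \<open>g\<close> is injective once its kernel has no nonzero
    submodule in \<open>T\<close>. A bottom factor of \<open>Y\<close> is then not inside the
    kernel, which will make it a copy of \<open>M\<close> that \<open>g\<close> maps isomorphically
    onto \<open>M\<close>.\<close>
  have key: "K = {\<zero>\<^bsub>Y\<^esub>}"
    if Y: "Y \<in> T" and g: "g \<in> mod_hom Y M" and K: "K = a_kernel Y M g"
    and Kfree: "\<And>L. \<lbrakk>left_submodule L Y; L \<subseteq> K; submod Y L \<in> T\<rbrakk> \<Longrightarrow> L = {\<zero>\<^bsub>Y\<^esub>}" for Y g K
  proof -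
    note fY = torsion_classD(3)[OF T Y]
    note lY = fgmodD(1)[OF fY]
    interpret Y: left_module Y by (fact lY)
    have sK: "left_submodule K Y" unfolding K by (rule left_submodule_kernel[OF lY lM g])
    show ?thesis
    proof (cases "carrier Y = {\<zero>\<^bsub>Y\<^esub>}")
      case True
      then show ?thesis using sK by (auto simp: Y.left_submodule_iff)
    next
      case False
      then obtain F where F: "left_submodule F Y" "F \<noteq> {\<zero>\<^bsub>Y\<^esub>}" "submod Y F \<in> C"
        using filt_bottom[OF Cs, of Y] Y TC by blast
      let ?F = "submod Y F"
      have Fc: "F \<subseteq> carrier Y" by (rule left_submodule_subset[OF F(1)])
      have FT: "?F \<in> T" using F(3) CT by blast
      note lF = torsion_classD(4)[OF T FT]
      have gF: "g \<in> mod_hom ?F M" by (rule mod_hom_sub_dom[OF g Fc])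
      have sI: "left_submodule (g ` F) M" by (rule left_submodule_image[OF lY lM g F(1)])
      have IT: "submod M (g ` F) \<in> T" using torsion_class_image[OF T FT lM gF] by simp
      have "\<not> F \<subseteq> K" using Kfree[OF F(1) _ FT] F(2) by blast
      then obtain y where "y \<in> F" "g y \<noteq> \<zero>\<^bsub>M\<^esub>" using Fc unfolding K a_kernel_def' by blast
      then have I0: "g ` F \<noteq> {\<zero>\<^bsub>M\<^esub>}" by blast
      then have IS: "submod M (g ` F) \<notin> S" using free[OF sI] by blast
      have "?F \<notin> S" using torsion_class_image[OF S(1) _ lM gF] IS by auto
      then have iso: "mod_iso M ?F" using F(3) by (simp add: C_def)
      have I: "g ` F = carrier M"
      proof (rule ccontr)
        assume "g ` F \<noteq> carrier M"
        then have "kdim (submod M (g ` F)) < kdim M" by (rule fgmod_sub(2)[OF fM sI])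
        then show False using min[OF IT] IS by blast
      qed
      have ge: "g \<in> mod_epi ?F M" using gF I by (simp add: mod_epi_def)
      \<comment> \<open>\<open>?F\<close> is also a quotient of \<open>M\<close>, so its dimension
        is not larger than that of \<open>M\<close>, and a surjection from it onto \<open>M\<close>
        cannot kill anything.\<close>
      have "a_kernel ?F M g \<subseteq> {\<zero>\<^bsub>?F\<^esub>}"
      proof (rule ccontr)
        assume "\<not> a_kernel ?F M g \<subseteq> {\<zero>\<^bsub>?F\<^esub>}"
        then obtain x where "x \<in> a_kernel ?F M g" "x \<noteq> \<zero>\<^bsub>?F\<^esub>" by blast
        then have "kdim M < kdim ?F" by (rule kdim_epi_less[OF fgmod_sub(1)[OF fY F(1)] lM ge])
        moreover obtain f where "f \<in> mod_epi M ?F" using iso by (rule mod_isoE)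
        then have "kdim ?F \<le> kdim M" by (rule fgmod_epi(2)[OF fM lF])
        ultimately show False by simp
      qed
      then have "a_kernel ?F M g \<subseteq> a_kernel ?F ?F (\<lambda>x. x)" by (auto simp: mem_a_kernel)
      then obtain s where s: "s \<in> mod_hom M ?F" "\<forall>x\<in>F. s (g x) = x"
        using mod_hom_factor[OF lF lM lF ge mod_hom_id] by auto
      have sY: "s \<in> mod_hom M Y" by (rule mod_hom_sub_incl[OF s(1) Fc])
      have gs: "g (s x) = x" if "x \<in> carrier M" for x
      proof -
        have "x \<in> g ` F" using that I by simp
        then obtain f where f: "f \<in> F" "x = g f" by blast
        then show ?thesis using s(2) by simp
      qed
      \<comment> \<open>With \<open>s\<close> a section of \<open>g\<close>, this is a projection of
        \<open>Y\<close> onto the kernel \<open>K\<close>. As an image of \<open>Y\<close>,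
        \<open>K\<close> lies in \<open>T\<close>, and the assumption on its submodules makes it
        zero.\<close>
      let ?r = "\<lambda>y. y \<ominus>\<^bsub>Y\<^esub> s (g y)"
      have r: "?r \<in> mod_hom Y Y" by (rule mod_hom_diff[OF lY mod_hom_id mod_hom_comp[OF g sY]])
      have "?r ` carrier Y = K"
      proof
        show "?r ` carrier Y \<subseteq> K"
        proof
          fix k assume "k \<in> ?r ` carrier Y"
          then obtain y where y: "y \<in> carrier Y" "k = ?r y" by blast
          note gy = mod_hom_closed[OF g y(1)]
          have "g k = g y \<ominus>\<^bsub>M\<^esub> g (s (g y))"
            unfolding y(2) by (rule mod_hom_minus[OF lY lM g y(1) mod_hom_closed[OF sY gy]])
          also have "\<dots> = \<zero>\<^bsub>M\<^esub>" using gs[OF gy] gy by (simp add: M.minus_eq_zero_iff)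
          finally show "k \<in> K" using y mod_hom_closed[OF r y(1)] by (simp add: K mem_a_kernel)
        qed
        show "K \<subseteq> ?r ` carrier Y"
        proof
          fix k assume "k \<in> K"
          then have k: "k \<in> carrier Y" "g k = \<zero>\<^bsub>M\<^esub>" by (simp_all add: K mem_a_kernel)
          then have "?r k = k" using mod_hom_zero[OF lM lY sY] by (simp add: a_minus_def)
          then show "k \<in> ?r ` carrier Y" using k(1) by force
        qed
      qed
      then have "submod Y K \<in> T" using torsion_class_image[OF T Y lY r] by simp
      then show ?thesis using Kfree[OF sK] by blast
    qed
  qed
  have "M \<in> alpha T"
  proof (rule alphaI[OF MT])
    fix Y g assume Y: "Y \<in> T" and g: "g \<in> mod_hom Y M"
    note fY = torsion_classD(3)[OF T Y]
    note lY = fgmodD(1)[OF fY]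
    interpret Y: left_module Y by (fact lY)
    define K where "K = a_kernel Y M g"
    have sK: "left_submodule K Y" unfolding K_def by (rule left_submodule_kernel[OF lY lM g])
    note Kc = left_submodule_subset[OF sK]
    \<comment> \<open>After division by the torsion part \<open>N\<close> of the kernel,
      \<open>key\<close> applies to the induced map \<open>g'\<close>: a submodule in
      \<open>T\<close> of its kernel pulls back to a submodule of \<open>K\<close> in
      \<open>T\<close>, hence into \<open>N\<close>. Injectivity of \<open>g'\<close> then says that
      \<open>K\<close> equals \<open>N\<close>.\<close>
    obtain N where N: "left_submodule N (submod Y K)" "submod (submod Y K) N \<in> T"
      "\<forall>L. left_submodule L (submod Y K) \<longrightarrow> submod (submod Y K) L \<in> T \<longrightarrow> L \<subseteq> N"
      by (rule ex_torsion_part[OF T fgmod_sub(1)[OF fY sK]])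
    have sN: "left_submodule N Y" and NK: "N \<subseteq> K" using N(1) Y.left_submodule_sub_iff[OF sK] by auto
    have NT: "submod Y N \<in> T" using N(2) by simp
    have Nmax: "L \<subseteq> N" if "left_submodule L Y" "L \<subseteq> K" "submod Y L \<in> T" for L
      using N(3) that Y.left_submodule_sub_iff[OF sK] by simp
    obtain Q :: "('a, 'm) module" and r where Q: "Q \<in> fgmod" "r \<in> mod_epi Y Q" "a_kernel Y Q r = N"
      by (rule ex_fgmod_quotient[OF fY sN])
    note lQ = fgmodD(1)[OF Q(1)] and rh = mod_epiD(1)[OF Q(2)]
    interpret Q: left_module Q by (fact lQ)
    have QT: "Q \<in> T" by (rule torsion_class_epi[OF T Y lQ Q(2)])
    have "a_kernel Y Q r \<subseteq> a_kernel Y M g" using NK Q(3) by (simp add: K_def)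
    then obtain g' where g': "g' \<in> mod_hom Q M" "\<forall>y\<in>carrier Y. g' (r y) = g y"
      using mod_hom_factor[OF lY lQ lM Q(2) g] by blast
    have "a_kernel Q M g' = {\<zero>\<^bsub>Q\<^esub>}"
    proof (rule key[OF QT g'(1) refl])
      fix L assume L: "left_submodule L Q" "L \<subseteq> a_kernel Q M g'" "submod Q L \<in> T"
      let ?V = "{y \<in> carrier Y. r y \<in> L}"
      have "submod Y ?V \<in> T"
        using extension_vimage[OF torsion_classD(2)[OF T] fY lQ Q(2) _ L(1,3)] NT Q(3) by simp
      moreover have "?V \<subseteq> K"
      proof
        fix y assume "y \<in> ?V"
        then have "y \<in> carrier Y" "r y \<in> a_kernel Q M g'" using L(2) by auto
        then show "y \<in> K" using g'(2) by (simp add: K_def mem_a_kernel)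
      qed
      ultimately have V: "?V \<subseteq> N" using Nmax left_submodule_vimage[OF lY lQ rh L(1)] by blast
      show "L = {\<zero>\<^bsub>Q\<^esub>}"
      proof
        show "{\<zero>\<^bsub>Q\<^esub>} \<subseteq> L" using L(1) by (simp add: Q.left_submodule_iff)
        show "L \<subseteq> {\<zero>\<^bsub>Q\<^esub>}"
        proof
          fix z assume z: "z \<in> L"
          then have "z \<in> carrier Q" using left_submodule_subset[OF L(1)] by blast
          then obtain y where y: "y \<in> carrier Y" "r y = z" by (rule mod_epiE[OF Q(2)])
          then have "y \<in> a_kernel Y Q r" using V z Q(3) by blast
          then show "z \<in> {\<zero>\<^bsub>Q\<^esub>}" using y by (simp add: mem_a_kernel)
        qed
      qed
    qed
    then have "K \<subseteq> N"
    proof -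
      assume *: "a_kernel Q M g' = {\<zero>\<^bsub>Q\<^esub>}"
      show "K \<subseteq> N"
      proof
        fix y assume "y \<in> K"
        then have y: "y \<in> carrier Y" "g y = \<zero>\<^bsub>M\<^esub>" by (simp_all add: K_def mem_a_kernel)
        then have "r y \<in> a_kernel Q M g'" using g'(2) mod_hom_closed[OF rh]
          by (simp add: mem_a_kernel)
        then have "r y = \<zero>\<^bsub>Q\<^esub>" using * by simp
        then show "y \<in> N" using y(1) unfolding Q(3)[symmetric] by (simp add: mem_a_kernel)
      qed
    qed
    then have "K = N" using NK by blast
    then show "submod Y (a_kernel Y M g) \<in> T" using NT by (simp add: K_def)
  qed
  then show ?thesis using MS by blast
qed

lemma filt_gen_alpha:
  fixes T :: "('a, 'm) module set"
  assumes T: "torsion_class T" and ff: "functorially_finite T"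
  shows "filt (gen (alpha T)) = T"
proof (rule ccontr)
  let ?U = "filt (gen (alpha T))"
  note W = wide_alpha[OF T]
  assume ne: "?U \<noteq> T"
  have UT: "?U \<subseteq> T"
    by (intro filt_subset_torsion_class[OF T] gen_subset_torsion_class[OF T]) (auto simp: alpha_def)
  obtain G t where Gt: "minimal_generator T G t" by (rule ex_minimal_generator[OF T ff])
  obtain S where S: "torsion_class S" "?U \<subseteq> S" "S \<subseteq> T" "S \<noteq> T"
    "\<forall>V. torsion_class V \<longrightarrow> S \<subseteq> V \<longrightarrow> V \<subseteq> T \<longrightarrow> V = S \<or> V = T"
    by (rule ex_maximal_torsion_subclass[OF T torsion_class_filt_gen[OF W] UT ne
        minimal_generatorD(1,2,3)[OF Gt]])
  have "alpha T \<subseteq> S" using gen_wide_closed(1,4)[OF W] subset_filt S(2) by blast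
  then show False using alpha_not_subset_maximal[OF T S(1,3,4,5)] by blast
qed

text \<open>Among the kernels of epimorphisms from \<open>M\<close> to objects of
  \<open>alpha T\<close>, one of least dimension is contained in the kernel of every
  \<open>f\<close> from \<open>M\<close> to an object \<open>D\<close> of \<open>alpha T\<close>.
  The quotient of \<open>M\<close> by the intersection \<open>?L\<close> of the two maps jointly
  injectively to \<open>Q\<close> and \<open>D\<close>, so a map from \<open>G\<close> to it that
  kills \<open>t\<close> vanishes, and the quotient is again in \<open>alpha T\<close>.\<close>

lemma ex_alpha_reflection:
  fixes T :: "('a, 'm) module set"
  assumes T: "torsion_class T" and Gt: "minimal_generator T G t" and M: "M \<in> T"
  obtains Q p where "Q \<in> alpha T" "p \<in> mod_epi M Q"
    "\<forall>D\<in>alpha T. \<forall>f\<in>mod_hom M D. \<exists>f'\<in>mod_hom Q D. \<forall>x\<in>carrier M. f' (p x) = f x"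
proof -
  note iff = alpha_iff[OF T Gt]
  note W = wide_alpha[OF T]
  note fM = torsion_classD(3)[OF T M]
  note lM = fgmodD(1)[OF fM]
  interpret M: left_module M by (fact lM)
  define P where "P N \<longleftrightarrow> left_submodule N M \<and>
    (\<exists>Q\<in>alpha T. \<exists>p\<in>mod_epi M Q. a_kernel M Q p = N)" for N
  have "P (carrier M)"
  proof -
    obtain Z where Z: "Z \<in> alpha T" "carrier Z = {\<zero>\<^bsub>Z\<^esub>}" using W by (auto simp: wide_def)
    note lZ = fgmodD(1)[OF wideD(5)[OF W Z(1)]]
    have "(\<lambda>x. \<zero>\<^bsub>Z\<^esub>) \<in> mod_epi M Z" using mod_hom_null[OF lZ, of M] Z(2) M.zero_closed
      by (auto simp: mod_epi_def)
    moreover have "a_kernel M Z (\<lambda>x. \<zero>\<^bsub>Z\<^esub>) = carrier M" by (auto simp: mem_a_kernel)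
    ultimately show ?thesis using Z(1) M.left_submodule_carrier by (auto simp: P_def)
  qed
  then obtain N where N: "P N" "\<forall>L. P L \<longrightarrow> kdim (submod M N) \<le> kdim (submod M L)"
    using ex_has_least_nat[of P "carrier M" "\<lambda>N. kdim (submod M N)"] by blast
  then obtain Q p where Q: "Q \<in> alpha T" "p \<in> mod_epi M Q" "a_kernel M Q p = N"
    and sN: "left_submodule N M"
    unfolding P_def by blast
  note ph = mod_epiD(1)[OF Q(2)] and lQ = fgmodD(1)[OF wideD(5)[OF W Q(1)]]
  show ?thesis
  proof (rule that[OF Q(1,2)]; intro ballI)
    fix D f assume D: "D \<in> alpha T" and f: "f \<in> mod_hom M D"
    note lD = fgmodD(1)[OF wideD(5)[OF W D]]
    let ?K = "a_kernel M D f"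
    let ?L = "N \<inter> ?K"
    have sL: "left_submodule ?L M"
      by (rule M.left_submodule_Int[OF sN left_submodule_kernel[OF lM lD f]])
    obtain E :: "('a, 'm) module" and q where E: "E \<in> fgmod" "q \<in> mod_epi M E" "a_kernel M E q = ?L"
      by (rule ex_fgmod_quotient[OF fM sL])
    note lE = fgmodD(1)[OF E(1)]
    obtain p' where p': "p' \<in> mod_hom E Q" "\<forall>x\<in>carrier M. p' (q x) = p x"
      using mod_hom_factor[OF lM lE lQ E(2) ph] E(3) Q(3) by auto
    obtain f' where f': "f' \<in> mod_hom E D" "\<forall>x\<in>carrier M. f' (q x) = f x"
      using mod_hom_factor[OF lM lE lD E(2) f] E(3) by auto
    have "E \<in> alpha T"
      unfolding iff
    proof (intro conjI ballI impI)
      show "E \<in> T" by (rule torsion_class_epi[OF T M lE E(2)])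
      fix h s assume h: "h \<in> mod_hom G E" "h t = \<zero>\<^bsub>E\<^esub>" and s: "s \<in> carrier G"
      have "p' (h t) = \<zero>\<^bsub>Q\<^esub>" "f' (h t) = \<zero>\<^bsub>D\<^esub>"
        using h(2) mod_hom_zero[OF lE lQ p'(1)] mod_hom_zero[OF lE lD f'(1)] by simp_all
      then have 0: "p' (h s) = \<zero>\<^bsub>Q\<^esub>" "f' (h s) = \<zero>\<^bsub>D\<^esub>"
        using Q(1)[unfolded iff, THEN conjunct2, THEN bspec, OF mod_hom_comp[OF h(1) p'(1)]]
          D[unfolded iff, THEN conjunct2, THEN bspec, OF mod_hom_comp[OF h(1) f'(1)]] s by simp_all
      obtain x where x: "x \<in> carrier M" "q x = h s"
        by (rule mod_epiE[OF E(2) mod_hom_closed[OF h(1) s]])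
      have "p x = \<zero>\<^bsub>Q\<^esub>" "f x = \<zero>\<^bsub>D\<^esub>" using 0 p'(2) f'(2) x by auto
      then have "x \<in> a_kernel M E q" unfolding E(3) Q(3)[symmetric] using x(1)
        by (simp add: mem_a_kernel)
      then show "h s = \<zero>\<^bsub>E\<^esub>" using x(2) by (simp add: mem_a_kernel)
    qed
    then have "P ?L" unfolding P_def using sL E by blast
    then have le: "kdim (submod M N) \<le> kdim (submod M ?L)" using N(2) by blast
    have "?L = N"
    proof (rule ccontr)
      assume "?L \<noteq> N"
      moreover have "left_submodule ?L (submod M N)" using M.left_submodule_sub_iff[OF sN] sL
        by blast
      ultimately have "kdim (submod M ?L) < kdim (submod M N)"
        using fgmod_sub(2)[OF fgmod_sub(1)[OF fM sN], of ?L] by simp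
      then show False using le by simp
    qed
    then have "a_kernel M Q p \<subseteq> a_kernel M D f" using Q(3) by blast
    then show "\<exists>f'\<in>mod_hom Q D. \<forall>x\<in>carrier M. f' (p x) = f x"
      by (rule mod_hom_factor[OF lM lQ lD Q(2) f])
  qed
qed

text \<open>\<open>C\<close> is built from an arbitrary object of \<open>W\<close>, mapped by zero,
  by adding one copy of \<open>B\<close> for each map in a finite set spanning all maps from
  \<open>B\<close> to \<open>X\<close>. Factoring through \<open>g\<close> is stable under linear
  combinations, so it passes from the finite set to all maps.\<close>

lemma mod_hom_precover:
  fixes W :: "('a, 'm) module set"
  assumes W: "wide W" and B: "B \<in> W" and X: "X \<in> fgmod"
  obtains C g where "C \<in> W" "g \<in> mod_hom C X"
    "\<forall>f\<in>mod_hom B X. \<exists>h\<in>mod_hom B C. \<forall>y\<in>carrier B. g (h y) = f y"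
proof -
  have fB: "B \<in> fgmod" using wideD(5)[OF W B] .
  note lB = fgmodD(1)[OF fB] and lX = fgmodD(1)[OF X]
  interpret X: left_module X by (fact lX)
  obtain F where F: "finite F" "F \<subseteq> mod_hom B X"
    and span: "mod_hom B X \<subseteq> hom_span B X F"
    by (rule mod_hom_finitely_spanned[OF fB X])
  have "\<exists>C\<in>W. \<exists>g\<in>mod_hom C X. \<forall>f\<in>F. \<exists>h\<in>mod_hom B C. \<forall>y\<in>carrier B. g (h y) = f y"
    using F
  proof (induction F rule: finite_induct)
    case empty
    obtain Z where "Z \<in> W" using W by (auto simp: wide_def)
    then show ?case using mod_hom_null[OF lX, of Z]
      by (intro bexI[of _ Z] bexI[of _ "\<lambda>x. \<zero>\<^bsub>X\<^esub>"]) simp_all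
  next
    case (insert f F)
    then obtain C g where C: "C \<in> W" "g \<in> mod_hom C X"
      "\<forall>f\<in>F. \<exists>h\<in>mod_hom B C. \<forall>y\<in>carrier B. g (h y) = f y" by auto
    have f: "f \<in> mod_hom B X" using insert.prems by simp
    have fC: "C \<in> fgmod" using wideD(5)[OF W C(1)] .
    note lC = fgmodD(1)[OF fC]
    obtain P :: "('a, 'm) module" and p1 p2 where prod: "is_product C B P p1 p2"
      by (rule ex_product[OF fC fB])
    note P = is_productD[OF prod]
    note lP = fgmodD(1)[OF P(1)]
    have PW: "P \<in> W" by (rule extension_closed_product[OF wideD(1,4)[OF W] C(1) B prod])
    let ?g = "\<lambda>z. g (p1 z) \<oplus>\<^bsub>X\<^esub> f (p2 z)"
    have g: "?g \<in> mod_hom P X"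
      by (intro mod_hom_sum[OF lX] mod_hom_comp[OF P(2) C(2)] mod_hom_comp[OF P(3) f])
    have lift: "\<exists>h\<in>mod_hom B P. \<forall>y\<in>carrier B. ?g (h y) = f' y" if f': "f' \<in> insert f F" for f'
    proof (cases "f' = f")
      case True
      obtain h where h: "h \<in> mod_hom B P" "\<forall>y\<in>carrier B. p1 (h y) = \<zero>\<^bsub>C\<^esub> \<and> p2 (h y) = y"
        by (rule bexE[OF mod_hom_to_product[OF lB prod mod_hom_null[OF lC] mod_hom_id]])
      have "?g (h y) = f y" if "y \<in> carrier B" for y
        using h(2) that mod_hom_zero[OF lC lX C(2)] mod_hom_closed[OF f] by simp
      then show ?thesis using h(1) True by blast
    next
      case False
      then obtain k where k: "k \<in> mod_hom B C" "\<forall>y\<in>carrier B. g (k y) = f' y" using C(3) f' by blast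
      obtain h where h: "h \<in> mod_hom B P" "\<forall>y\<in>carrier B. p1 (h y) = k y \<and> p2 (h y) = \<zero>\<^bsub>B\<^esub>"
        by (rule bexE[OF mod_hom_to_product[OF lB prod k(1) mod_hom_null[OF lB]]])
      have "?g (h y) = f' y" if y: "y \<in> carrier B" for y
        using h(2) k(2) y mod_hom_zero[OF lB lX f] mod_hom_closed[OF C(2) mod_hom_closed[OF k(1) y]]
          by simp
      then show ?thesis using h(1) by blast
    qed
    show ?case by (rule bexI[OF _ PW], rule bexI[OF _ g], rule ballI, rule lift)
  qed
  then obtain C g where C: "C \<in> W" "g \<in> mod_hom C X"
    "\<forall>f\<in>F. \<exists>h\<in>mod_hom B C. \<forall>y\<in>carrier B. g (h y) = f y" by blast
  have lC: "left_module C" using fgmodD(1)[OF wideD(5)[OF W C(1)]] .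
  have "\<exists>h\<in>mod_hom B C. \<forall>y\<in>carrier B. g (h y) = f y" if "f \<in> hom_span B X F" for f
    using that
  proof induction
    case (base f)
    then show ?case using C(3) by blast
  next
    case zero
    show ?case
      using mod_hom_null[OF lC] mod_hom_zero[OF lC lX C(2)] by (intro bexI[of _ "\<lambda>y. \<zero>\<^bsub>C\<^esub>"]) simp_all
  next
    case (add f f')
    then obtain h h' where h: "h \<in> mod_hom B C" "\<forall>y\<in>carrier B. g (h y) = f y"
      "h' \<in> mod_hom B C" "\<forall>y\<in>carrier B. g (h' y) = f' y" by blast
    then show ?case
      by (intro bexI[OF _ mod_hom_sum[OF lC h(1,3)]])
        (simp add: mod_hom_add[OF C(2)] mod_hom_closed[OF h(1)] mod_hom_closed[OF h(3)])
  next
    case (scale f c)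
    then obtain h where h: "h \<in> mod_hom B C" "\<forall>y\<in>carrier B. g (h y) = f y" by blast
    then show ?case
      by (intro bexI[OF _ kscale_mod_hom[OF lC h(1), of c]])
        (simp add: mod_hom_kscale[OF C(2)] mod_hom_closed[OF h(1)])
  qed simp
  then have "\<forall>f\<in>mod_hom B X. \<exists>h\<in>mod_hom B C. \<forall>y\<in>carrier B. g (h y) = f y" using span by blast
  then show ?thesis by (rule that[OF C(1,2)])
qed

text \<open>
  The object \<open>B\<close> plays the role of the free module of rank one of \<open>W\<close>. Among the objects \<open>C\<close> over
  \<open>X\<close> through which all maps \<open>B \<rightarrow> X\<close> factor, one of minimal dimension is a coreflection of \<open>X\<close>.
\<close>

lemma ex_right_approximation:
  fixes W :: "('a, 'm) module set"
  assumes W: "wide W" and B: "B \<in> W" "b \<in> carrier B"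
    and gen: "\<forall>D\<in>W. \<forall>d\<in>carrier D. \<exists>h\<in>mod_hom B D. h b = d"
    and uniq: "\<forall>D\<in>W. \<forall>h\<in>mod_hom B D. h b = \<zero>\<^bsub>D\<^esub> \<longrightarrow> (\<forall>y\<in>carrier B. h y = \<zero>\<^bsub>D\<^esub>)"
    and X: "X \<in> fgmod"
  obtains C g where "C \<in> W" "g \<in> mod_hom C X"
    "\<forall>D\<in>W. \<forall>f\<in>mod_hom D X. \<exists>f'\<in>mod_hom D C. \<forall>x\<in>carrier D. g (f' x) = f x"
proof -
  have fB: "B \<in> fgmod" using wideD(5)[OF W B(1)] .
  note lB = fgmodD(1)[OF fB] and lX = fgmodD(1)[OF X]
  interpret B: left_module B by (fact lB)
  interpret X: left_module X by (fact lX)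
  define P where "P = (\<lambda>(C, g). C \<in> W \<and> g \<in> mod_hom C X \<and>
    (\<forall>f\<in>mod_hom B X. \<exists>h\<in>mod_hom B C. \<forall>y\<in>carrier B. g (h y) = f y))"
  obtain C0 g0 where "C0 \<in> W" "g0 \<in> mod_hom C0 X"
    "\<forall>f\<in>mod_hom B X. \<exists>h\<in>mod_hom B C0. \<forall>y\<in>carrier B. g0 (h y) = f y"
    by (rule mod_hom_precover[OF W B(1) X])
  then have "P (C0, g0)" by (simp add: P_def)
  then obtain Cg where Cg: "P Cg" "\<forall>y. P y \<longrightarrow> kdim (fst Cg) \<le> kdim (fst y)"
    using ex_has_least_nat[of P "(C0, g0)" "\<lambda>y. kdim (fst y)"] by blast
  obtain C g where "Cg = (C, g)" by force
  with Cg have C: "C \<in> W" "g \<in> mod_hom C X"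
    "\<forall>f\<in>mod_hom B X. \<exists>h\<in>mod_hom B C. \<forall>y\<in>carrier B. g (h y) = f y"
    and min: "\<And>C' g'. P (C', g') \<Longrightarrow> kdim C \<le> kdim C'" by (auto simp: P_def)
  have fC: "C \<in> fgmod" using wideD(5)[OF W C(1)] .
  note lC = fgmodD(1)[OF fC]
  interpret C: left_module C by (fact lC)
  \<comment> \<open>If \<open>h\<close> were nonzero, dividing \<open>C\<close> by its image would
    keep the factorization property, as \<open>g\<close> kills that image, and would lower the
    dimension. Factorizations of maps from \<open>B\<close> through \<open>g\<close> are therefore
    unique.\<close>
  have inj: "h y = \<zero>\<^bsub>C\<^esub>" if h: "h \<in> mod_hom B C" "\<And>y. y \<in> carrier B \<Longrightarrow> g (h y) = \<zero>\<^bsub>X\<^esub>"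
    and y: "y \<in> carrier B" for h y
  proof (rule ccontr)
    assume ne: "h y \<noteq> \<zero>\<^bsub>C\<^esub>"
    have "left_submodule (h ` carrier B) C"
      by (rule left_submodule_image[OF lB lC h(1) B.left_submodule_carrier])
    then obtain Q :: "('a, 'm) module" and q where Q: "Q \<in> fgmod" "q \<in> mod_epi C Q"
      "a_kernel C Q q = h ` carrier B"
      by (rule ex_fgmod_quotient[OF fC])
    note lQ = fgmodD(1)[OF Q(1)] and qh = mod_epiD(1)[OF Q(2)]
    have QW: "Q \<in> W" by (rule wide_cokernel[OF W B(1) C(1) h(1) Q])
    have "a_kernel C Q q \<subseteq> a_kernel C X g"
      unfolding Q(3) using h mod_hom_closed[OF h(1)] by (auto simp: mem_a_kernel)
    then obtain g' where g': "g' \<in> mod_hom Q X" "\<forall>x\<in>carrier C. g' (q x) = g x"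
      using mod_hom_factor[OF lC lQ lX Q(2) C(2)] by blast
    have "\<exists>k\<in>mod_hom B Q. \<forall>y\<in>carrier B. g' (k y) = f y" if f: "f \<in> mod_hom B X" for f
    proof -
      obtain k where k: "k \<in> mod_hom B C" "\<forall>y\<in>carrier B. g (k y) = f y" using C(3) f by blast
      then show ?thesis
        using g'(2) mod_hom_closed[OF k(1)] by (intro bexI[OF _ mod_hom_comp[OF k(1) qh]]) simp
    qed
    then have "P (Q, g')" using QW g'(1) by (simp add: P_def)
    then have "kdim C \<le> kdim Q" by (rule min)
    moreover have "h y \<in> a_kernel C Q q" unfolding Q(3) using y by blast
    then have "kdim Q < kdim C" using ne by (rule kdim_epi_less[OF fC lQ Q(2)])
    ultimately show False by simp
  qed
  show ?thesis
  proof (rule that[OF C(1,2)]; intro ballI)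
    fix D f assume D: "D \<in> W" and f: "f \<in> mod_hom D X"
    have fD: "D \<in> fgmod" using wideD(5)[OF W D] .
    note lD = fgmodD(1)[OF fD]
    interpret D: left_module D by (fact lD)
    \<comment> \<open>The graph of the desired map: \<open>d\<close> is the value at
      \<open>b\<close> of some \<open>h\<close>, and \<open>c\<close> is the value at
      \<open>b\<close> of a lift \<open>k\<close> of \<open>f\<close> after \<open>h\<close>. It is
      single valued because \<open>d\<close> determines \<open>h\<close>, and \<open>h\<close>
      determines \<open>k\<close>.\<close>
    define R where "R d c \<longleftrightarrow> (\<exists>h\<in>mod_hom B D. \<exists>k\<in>mod_hom B C.
      h b = d \<and> k b = c \<and> (\<forall>y\<in>carrier B. f (h y) = g (k y)))" for d c
    have R_ex: "\<exists>c. R d c" if "d \<in> carrier D" for d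
    proof -
      obtain h where h: "h \<in> mod_hom B D" "h b = d" using gen[rule_format, OF D \<open>d \<in> carrier D\<close>]
        by blast
      obtain k where "k \<in> mod_hom B C" "\<forall>y\<in>carrier B. g (k y) = f (h y)"
        using C(3)[rule_format, OF mod_hom_comp[OF h(1) f]] by blast
      then show ?thesis using h unfolding R_def
        by (intro exI[of _ "k b"] bexI[of _ h] bexI[of _ k]) simp_all
    qed
    have R_closed: "c \<in> carrier C" "g c = f d" if "R d c" for d c
      using that B(2) by (auto simp: R_def mod_hom_closed)
    have R_uniq: "c = c'" if "R d c" "R d c'" for d c c'
    proof -
      obtain h k where h: "h \<in> mod_hom B D" "k \<in> mod_hom B C" "h b = d" "k b = c"
        "\<forall>y\<in>carrier B. f (h y) = g (k y)" using \<open>R d c\<close> unfolding R_def by blast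
      obtain h' k' where h': "h' \<in> mod_hom B D" "k' \<in> mod_hom B C" "h' b = d" "k' b = c'"
        "\<forall>y\<in>carrier B. f (h' y) = g (k' y)" using \<open>R d c'\<close> unfolding R_def by blast
      have hh: "h y = h' y" if y: "y \<in> carrier B" for y
      proof -
        have "h b \<ominus>\<^bsub>D\<^esub> h' b = \<zero>\<^bsub>D\<^esub>" using h(3) h'(3) mod_hom_closed[OF h(1) B(2)]
          by (simp add: D.minus_eq_zero_iff)
        then have "h y \<ominus>\<^bsub>D\<^esub> h' y = \<zero>\<^bsub>D\<^esub>"
          by (rule uniq[rule_format, OF D mod_hom_diff[OF lD h(1) h'(1)] _ y])
        then show ?thesis using mod_hom_closed[OF h(1) y] mod_hom_closed[OF h'(1) y]
          by (simp add: D.minus_eq_zero_iff)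
      qed
      have "g (k y \<ominus>\<^bsub>C\<^esub> k' y) = \<zero>\<^bsub>X\<^esub>" if y: "y \<in> carrier B" for y
      proof -
        have "g (k y) = g (k' y)" using h(5) h'(5) hh[OF y] y by metis
        then show ?thesis
          using mod_hom_closed[OF h(2) y] mod_hom_closed[OF h'(2) y] mod_hom_closed[OF C(2)]
          by (simp add: mod_hom_minus[OF lC lX C(2)] X.minus_eq_zero_iff)
      qed
      then have "k b \<ominus>\<^bsub>C\<^esub> k' b = \<zero>\<^bsub>C\<^esub>" by (rule inj[OF mod_hom_diff[OF lC h(2) h'(2)] _ B(2)])
      then show ?thesis
        using h(4) h'(4) mod_hom_closed[OF h(2) B(2)] mod_hom_closed[OF h'(2) B(2)]
          by (simp add: C.minus_eq_zero_iff)
    qed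
    have R_add: "R (d \<oplus>\<^bsub>D\<^esub> d') (c \<oplus>\<^bsub>C\<^esub> c')" if "R d c" "R d' c'" for d c d' c'
    proof -
      obtain h k where h: "h \<in> mod_hom B D" "k \<in> mod_hom B C" "h b = d" "k b = c"
        "\<forall>y\<in>carrier B. f (h y) = g (k y)" using \<open>R d c\<close> unfolding R_def by blast
      obtain h' k' where h': "h' \<in> mod_hom B D" "k' \<in> mod_hom B C" "h' b = d'" "k' b = c'"
        "\<forall>y\<in>carrier B. f (h' y) = g (k' y)" using \<open>R d' c'\<close> unfolding R_def by blast
      show ?thesis unfolding R_def
        using h h'
        by (intro bexI[OF _ mod_hom_sum[OF lD h(1) h'(1)]] bexI[OF _ mod_hom_sum[OF lC h(2) h'(2)]])
          (simp add: mod_hom_add[OF f] mod_hom_add[OF C(2)] mod_hom_closed[OF h(1)]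
              mod_hom_closed[OF h'(1)]
            mod_hom_closed[OF h(2)] mod_hom_closed[OF h'(2)])
    qed
    have R_smult: "R (a \<odot>\<^bsub>D\<^esub> d) (a \<odot>\<^bsub>C\<^esub> c)" if "R d c" for a d c
    proof -
      obtain h k where h: "h \<in> mod_hom B D" "k \<in> mod_hom B C" "h b = d" "k b = c"
        "\<forall>y\<in>carrier B. f (h y) = g (k y)" using \<open>R d c\<close> unfolding R_def by blast
      \<comment> \<open>\<open>r\<close> plays the role of right multiplication by \<open>a\<close>
        on a free module with generator \<open>b\<close>: precomposition with it multiplies the
        value at \<open>b\<close> by \<open>a\<close>.\<close>
      obtain r where r: "r \<in> mod_hom B B" "r b = a \<odot>\<^bsub>B\<^esub> b"
        using gen[rule_format, OF B(1) B.smult_closed[OF B(2)]] by blast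
      show ?thesis unfolding R_def
        using h r B(2)
        by (intro bexI[OF _ mod_hom_comp[OF r(1) h(1)]] bexI[OF _ mod_hom_comp[OF r(1) h(2)]])
          (simp add: mod_hom_smult[OF h(1)] mod_hom_smult[OF h(2)] mod_hom_closed[OF r(1)])
    qed
    define f' where "f' d = (SOME c. R d c)" for d
    have Rf: "R d (f' d)" if "d \<in> carrier D" for d
      unfolding f'_def by (rule someI_ex[OF R_ex[OF that]])
    have "f' \<in> mod_hom D C"
    proof (rule mod_homI)
      fix x y assume xy: "x \<in> carrier D" "y \<in> carrier D"
      show "f' x \<in> carrier C" by (rule R_closed(1)[OF Rf[OF xy(1)]])
      show "f' (x \<oplus>\<^bsub>D\<^esub> y) = f' x \<oplus>\<^bsub>C\<^esub> f' y"
        by (rule R_uniq[OF Rf[OF D.a_closed[OF xy]] R_add[OF Rf[OF xy(1)] Rf[OF xy(2)]]])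
      fix a
      show "f' (a \<odot>\<^bsub>D\<^esub> x) = a \<odot>\<^bsub>C\<^esub> f' x"
        by (rule R_uniq[OF Rf[OF D.smult_closed[OF xy(1)]] R_smult[OF Rf[OF xy(1)]]])
    qed
    then show "\<exists>f'\<in>mod_hom D C. \<forall>x\<in>carrier D. g (f' x) = f x"
      using R_closed(2)[OF Rf] by blast
  qed
qed

text \<open>A left approximation is one in \<open>T\<close> followed by the reflection into
  \<open>alpha T\<close>. For right approximations, the reflection \<open>B\<close> of
  \<open>G\<close> inherits from \<open>G\<close> that maps can be prescribed at a distinguished
  element, the image of \<open>t\<close>.\<close>

lemma functorially_finite_alpha:
  fixes T :: "('a, 'm) module set"
  assumes T: "torsion_class T" and ff: "functorially_finite T"
  shows "functorially_finite (alpha T)"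
proof -
  obtain G t where Gt: "minimal_generator T G t" by (rule ex_minimal_generator[OF T ff])
  note G = minimal_generatorD[OF Gt] and iff = alpha_iff[OF T Gt] and W = wide_alpha[OF T]
  obtain B p where B: "B \<in> alpha T" "p \<in> mod_epi G B"
    "\<forall>D\<in>alpha T. \<forall>f\<in>mod_hom G D. \<exists>f'\<in>mod_hom B D. \<forall>x\<in>carrier G. f' (p x) = f x"
    by (rule ex_alpha_reflection[OF T Gt G(1)])
  note ph = mod_epiD(1)[OF B(2)]
  have gen: "\<forall>D\<in>alpha T. \<forall>d\<in>carrier D. \<exists>h\<in>mod_hom B D. h (p t) = d"
  proof (intro ballI)
    fix D d assume D: "D \<in> alpha T" "d \<in> carrier D"
    obtain h where h: "h \<in> mod_hom G D" "h t = d" using G(3) alphaD(1)[OF D(1)] D(2) by blast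
    obtain h' where "h' \<in> mod_hom B D" "\<forall>x\<in>carrier G. h' (p x) = h x" using B(3) D(1) h(1) by blast
    then show "\<exists>h\<in>mod_hom B D. h (p t) = d" using h(2) G(2) by auto
  qed
  \<comment> \<open>On \<open>G\<close> this is the criterion for membership in
    \<open>alpha T\<close>; it descends to \<open>B\<close> because \<open>p\<close> is
    surjective.\<close>
  have uniq: "\<forall>D\<in>alpha T. \<forall>h\<in>mod_hom B D. h (p t) = \<zero>\<^bsub>D\<^esub> \<longrightarrow> (\<forall>y\<in>carrier B. h y = \<zero>\<^bsub>D\<^esub>)"
  proof (intro ballI impI)
    fix D h y assume D: "D \<in> alpha T" "h \<in> mod_hom B D" "h (p t) = \<zero>\<^bsub>D\<^esub>" "y \<in> carrier B"
    obtain s where s: "s \<in> carrier G" "p s = y" by (rule mod_epiE[OF B(2) D(4)])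
    have "h (p s) = \<zero>\<^bsub>D\<^esub>"
      using D(1)[unfolded iff, THEN conjunct2, THEN bspec, OF mod_hom_comp[OF ph D(2)]] D(3) s(1)
        by simp
    then show "h y = \<zero>\<^bsub>D\<^esub>" using s(2) by simp
  qed
  show ?thesis
    unfolding functorially_finite_def
  proof (intro ballI)
    fix X :: "('a, 'm) module" assume X: "X \<in> fgmod"
    obtain C1 g1 where C1: "C1 \<in> T" "g1 \<in> mod_hom X C1"
      "\<forall>D\<in>T. \<forall>h\<in>mod_hom X D. \<exists>h'\<in>mod_hom C1 D. \<forall>x\<in>carrier X. h' (g1 x) = h x"
      using ff[unfolded functorially_finite_def, rule_format, OF X] by auto
    obtain Q q where Q: "Q \<in> alpha T" "q \<in> mod_epi C1 Q"
      "\<forall>D\<in>alpha T. \<forall>f\<in>mod_hom C1 D. \<exists>f'\<in>mod_hom Q D. \<forall>x\<in>carrier C1. f' (q x) = f x"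
      by (rule ex_alpha_reflection[OF T Gt C1(1)])
    have left: "\<exists>h'\<in>mod_hom Q D. \<forall>x\<in>carrier X. h' (q (g1 x)) = h x" if D: "D \<in> alpha T"
      "h \<in> mod_hom X D" for D h
    proof -
      obtain k where k: "k \<in> mod_hom C1 D" "\<forall>x\<in>carrier X. k (g1 x) = h x"
        using C1(3) alphaD(1)[OF D(1)] D(2) by blast
      obtain h' where "h' \<in> mod_hom Q D" "\<forall>x\<in>carrier C1. h' (q x) = k x" using Q(3) D(1) k(1)
        by blast
      then show ?thesis using k(2) mod_hom_closed[OF C1(2)] by (intro bexI[of _ h']) auto
    qed
    obtain C2 g2 where C2: "C2 \<in> alpha T" "g2 \<in> mod_hom C2 X"
      "\<forall>D\<in>alpha T. \<forall>f\<in>mod_hom D X. \<exists>f'\<in>mod_hom D C2. \<forall>x\<in>carrier D. g2 (f' x) = f x"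
      by (rule ex_right_approximation[OF W B(1) mod_hom_closed[OF ph G(2)] gen uniq X])
    show "\<exists>C1\<in>alpha T. \<exists>C2\<in>alpha T. \<exists>g1\<in>mod_hom X C1. \<exists>g2\<in>mod_hom C2 X.
        (\<forall>D\<in>alpha T. \<forall>h\<in>mod_hom X D. \<exists>h'\<in>mod_hom C1 D. \<forall>x\<in>carrier X. h' (g1 x) = h x) \<and>
        (\<forall>D\<in>alpha T. \<forall>h\<in>mod_hom D X. \<exists>h'\<in>mod_hom D C2. \<forall>x\<in>carrier D. g2 (h' x) = h x)"
      using left C2(3)
      by (intro bexI[OF _ Q(1)] bexI[OF _ C2(1)]
          bexI[OF _ mod_hom_comp[OF C1(2) mod_epiD(1)[OF Q(2)]]]
          bexI[OF _ C2(2)] conjI ballI) auto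
  qed
qed

end

theorem theorem3p10:
  fixes scale :: "'k::alg_closed_field \<Rightarrow> 'a::{ring, monoid_mult} \<Rightarrow> 'a"
    and emb :: "'k \<Rightarrow> 'm"
  assumes "finite_dim_algebra scale"
    and "inj emb"
  shows "bij_betw (alpha :: ('a, 'm) module set \<Rightarrow> ('a, 'm) module set)
           {T. torsion_class T \<and> functorially_finite T}
           {W. wide W \<and> functorially_finite W \<and> functorially_finite (filt (gen W))}"
proof -
  interpret algebra_modules scale emb
    using assms by (simp add: algebra_modules_def algebra_modules_axioms_def)
  show ?thesis
  proof (rule bij_betw_byWitness[where f' = "\<lambda>W. filt (gen W)"])
    show "\<forall>T\<in>{T :: ('a, 'm) module set. torsion_class T \<and> functorially_finite T}.
        filt (gen (alpha T)) = T"
      using filt_gen_alpha by blast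
    show "\<forall>W\<in>{W :: ('a, 'm) module set. wide W \<and> functorially_finite W \<and>
        functorially_finite (filt (gen W))}.
        alpha (filt (gen W)) = W"
      using alpha_filt_gen by blast
    \<comment> \<open>\<open>filt (gen (alpha T))\<close> is \<open>T\<close> itself, so its
      functorial finiteness is that of \<open>T\<close>.\<close>
    show "alpha ` {T :: ('a, 'm) module set. torsion_class T \<and> functorially_finite T}
        \<subseteq> {W. wide W \<and> functorially_finite W \<and> functorially_finite (filt (gen W))}"
      using wide_alpha functorially_finite_alpha filt_gen_alpha by auto
    show "(\<lambda>W. filt (gen W)) ` {W :: ('a, 'm) module set. wide W \<and> functorially_finite W \<and>
          functorially_finite (filt (gen W))}
        \<subseteq> {T. torsion_class T \<and> functorially_finite T}"
      using torsion_class_filt_gen by blast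
  qed
qed

end
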